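(* Let $\ell$ be a prime and let $(V,Q)$ be a nondegenerate quadratic space of rank $2m$ over $\mathbb{Z}_\ell$. Let $H \subset \mathrm{O}(V,Q)$ be a union of cosets of $\Omega(V,Q)$. For $g$ drawn from the (probability-normalized) Haar measure on $H$, define the random variables \[ d_{j}(H) :=\dim_{\mathbb{F}_{\ell}}\Big( \ell^{j-1} \cdot \ker\big(g-\mathrm{id} \,\big|\, (V \otimes \mathbb{Q}_\ell/\mathbb{Z}_\ell)[\ell^{j}]\big)\Big), \qquad j \geq 1. \] Then the sequence $d_1(H), d_2(H), \ldots$ is Markov, and for $\ell$ odd or $d_i(H) \ne 2m$, the distribution of $d_{i+1}(H)$ given $d_i(H)$ is the same as the distribution of the dimension of the kernel of a uniform random alternating form on $\mathbb{F}_\ell^{d_i(H)}$.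
   Context: Here $\mathrm{O}(V,Q)$ is the orthogonal group of $(V,Q)$, and $\Omega(V,Q) \subset \mathrm{O}(V,Q)$ is the joint kernel of the Dickson invariant $\mathrm{O}(V,Q)\to \mathbb{Z}/2\mathbb{Z}$ and the $(-1)$-spinor norm $\mathrm{O}(V,Q) \to \mathbb{Z}_\ell^\times/(\mathbb{Z}_\ell^\times)^2$. The Haar measure on $\mathrm{O}(V,Q)(\mathbb{Z}_\ell)$ is the one whose pushforward to $\mathrm{O}(V,Q)(\mathbb{Z}/\ell^e\mathbb{Z})$ is uniform for each $e$; $g$ is drawn from its restriction to $H$, normalized to be a probability measure. For an abelian group $A$, $A[\ell^j]$ denotes its $\ell^j$-torsion. *)

theory Defs
  imports
    "HOL-Probability.Probability"
    "HOL-Computational_Algebra.Polynomial_Factorial"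
    "Berlekamp_Zassenhaus.Finite_Field"
    "Jordan_Normal_Form.Matrix"
    "Jordan_Normal_Form.Matrix_Kernel"
    "Jordan_Normal_Form.DL_Rank"
begin

unbundle no vec_syntax
hide_type (open) Finite_Cartesian_Product.vec
hide_const (open) Finite_Cartesian_Product.vec Finite_Cartesian_Product.mat
  Determinants.det Finite_Cartesian_Product.row

section \<open>The ring of \<open>\<ell>\<close>-adic integers and \<open>\<rat>\<^sub>\<ell>/\<int>\<^sub>\<ell>\<close>\<close>

text \<open>
  The prime is \<open>\<ell> = CARD('p)\<close>. An \<open>\<ell>\<close>-adic integer is an element of the inverse limit of the rings
  \<open>\<int>/\<ell>\<^sup>n\<int>\<close>, each residue class being represented by its element in \<open>{0..<\<ell>\<^sup>n}\<close>.
\<close>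

typedef (overloaded) 'p padic_int =
  "{x :: nat \<Rightarrow> int. \<forall>n. x n \<in> {0..<int CARD('p::prime_card) ^ n}
      \<and> x (Suc n) mod int CARD('p) ^ n = x n}"
  morphisms residue_padic Abs_padic_int
  by (intro exI[of _ "\<lambda>_. 0"]) (auto simp: prime_card zero_less_power)

setup_lifting type_definition_padic_int

lemma mod_mod_padic: "(a :: int) mod (q ^ Suc n) mod (q ^ n) = a mod (q ^ n)"
  by (simp add: mod_mod_cancel)

lemma mod_residue_padic: "(a :: int) mod int CARD('p::prime_card) ^ n \<in> {0..<int CARD('p) ^ n}"
proof -
  have "int CARD('p) ^ n > 0"
    using prime_card_int[where ?'a = 'p] by (simp add: prime_gt_0_int)
  then show ?thesis by simp
qed

instantiation padic_int :: (prime_card) comm_ring_1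
begin

lift_definition zero_padic_int :: "'a padic_int" is "\<lambda>_. 0"
  by auto

lift_definition one_padic_int :: "'a padic_int" is "\<lambda>n. 1 mod int CARD('a) ^ n"
  using mod_residue_padic[where ?'p = 'a] mod_mod_padic by blast

lift_definition plus_padic_int :: "'a padic_int \<Rightarrow> 'a padic_int \<Rightarrow> 'a padic_int"
  is "\<lambda>x y n. (x n + y n) mod int CARD('a) ^ n"
  unfolding mod_mod_padic
  by (auto intro!: mod_residue_padic simp del: atLeastLessThan_iff)
    (metis mod_add_eq)

lift_definition minus_padic_int :: "'a padic_int \<Rightarrow> 'a padic_int \<Rightarrow> 'a padic_int"
  is "\<lambda>x y n. (x n - y n) mod int CARD('a) ^ n"
  unfolding mod_mod_padic
  by (auto intro!: mod_residue_padic simp del: atLeastLessThan_iff)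
    (metis mod_diff_eq)

lift_definition uminus_padic_int :: "'a padic_int \<Rightarrow> 'a padic_int"
  is "\<lambda>x n. (- x n) mod int CARD('a) ^ n"
  unfolding mod_mod_padic
  by (auto intro!: mod_residue_padic simp del: atLeastLessThan_iff)
    (metis mod_minus_eq)

lift_definition times_padic_int :: "'a padic_int \<Rightarrow> 'a padic_int \<Rightarrow> 'a padic_int"
  is "\<lambda>x y n. (x n * y n) mod int CARD('a) ^ n"
  unfolding mod_mod_padic
  by (auto intro!: mod_residue_padic simp del: atLeastLessThan_iff)
    (metis mod_mult_eq)

instance
proof
  fix a b c :: "'a padic_int"
  show "a + b + c = a + (b + c)"
    by transfer (auto simp: mod_simps algebra_simps)
  show "a + b = b + a"
    by transfer (auto simp: algebra_simps)
  show "0 + a = a"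
    by transfer auto
  show "- a + a = 0"
    by transfer (auto simp: mod_simps)
  show "a - b = a + - b"
    by transfer (auto simp: mod_simps)
  show "a * b * c = a * (b * c)"
    by transfer (auto simp: mod_simps algebra_simps)
  show "a * b = b * a"
    by transfer (auto simp: algebra_simps)
  show "1 * a = a"
    by transfer (auto simp: mod_simps)
  show "(a + b) * c = a * c + b * c"
    by transfer (auto simp: mod_simps algebra_simps)
  show "(0 :: 'a padic_int) \<noteq> 1"
  proof
    assume "(0 :: 'a padic_int) = 1"
    then have "residue_padic (0 :: 'a padic_int) 1 = residue_padic 1 1" by simp
    moreover have "int CARD('a) > 1"
      using prime_card[where ?'a = 'a] prime_gt_1_nat by auto
    ultimately show False
      by (simp add: zero_padic_int.rep_eq one_padic_int.rep_eq)
  qed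
qed

end

lemma residue_padic_mod:
  fixes x :: "'p::prime_card padic_int"
  shows "residue_padic x (n + k) mod int CARD('p) ^ n = residue_padic x n"
proof (induction k)
  case 0
  show ?case using residue_padic[of x] by simp
next
  case (Suc k)
  have "residue_padic x (n + Suc k) mod int CARD('p) ^ n
      = residue_padic x (Suc (n + k)) mod int CARD('p) ^ (n + k) mod int CARD('p) ^ n"
    by (simp add: mod_mod_cancel le_imp_power_dvd)
  also have "residue_padic x (Suc (n + k)) mod int CARD('p) ^ (n + k) = residue_padic x (n + k)"
    using residue_padic[of x] by simp
  finally show ?case using Suc.IH by simp
qed

lemma prime_power_dvd_mult_split:
  fixes p a b :: "'a :: factorial_semiring"
  assumes "prime p" "p ^ (i + j) dvd a * b"
  shows "p ^ i dvd a \<or> p ^ j dvd b"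
proof (cases "a = 0 \<or> b = 0")
  case False
  then have "multiplicity p (a * b) = multiplicity p a + multiplicity p b"
    using assms(1) by (simp add: prime_elem_multiplicity_mult_distrib)
  moreover have "i + j \<le> multiplicity p (a * b)"
    using assms False by (intro multiplicity_geI) auto
  ultimately have "i \<le> multiplicity p a \<or> j \<le> multiplicity p b" by linarith
  then show ?thesis by (auto intro: multiplicity_dvd')
qed auto

instance padic_int :: (prime_card) idom
proof
  fix a b :: "'a padic_int"
  assume "a \<noteq> 0" "b \<noteq> 0"
  then obtain i j where ij: "residue_padic a i \<noteq> 0" "residue_padic b j \<noteq> 0"
    by (metis residue_padic_inject zero_padic_int.rep_eq ext)
  show "a * b \<noteq> 0"
  proof
    assume "a * b = 0"
    then have "(residue_padic a (i + j) * residue_padic b (i + j)) mod int CARD('a) ^ (i + j) = 0"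
      by (metis times_padic_int.rep_eq zero_padic_int.rep_eq)
    then have "int CARD('a) ^ (i + j) dvd residue_padic a (i + j) * residue_padic b (i + j)"
      by auto
    then have "int CARD('a) ^ i dvd residue_padic a (i + j)
        \<or> int CARD('a) ^ j dvd residue_padic b (i + j)"
      by (rule prime_power_dvd_mult_split[rotated]) (rule prime_card_int)
    with ij residue_padic_mod[of a i j] residue_padic_mod[of b j i] show False
      by (auto simp: add.commute dvd_eq_mod_eq_0)
  qed
qed

definition reduce_padic :: "'p::prime_card padic_int \<Rightarrow> 'p mod_ring" where
  "reduce_padic x = of_int (residue_padic x 1)"

type_synonym 'p padic = "'p padic_int fract"

quotient_type (overloaded) 'p padic_quot =
  "'p::prime_card padic" / "\<lambda>x y. x - y \<in> range to_fract"
proof (rule equivpI)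
  show "reflp (\<lambda>x y :: 'p padic. x - y \<in> range to_fract)"
    by (rule reflpI) (metis diff_self rangeI to_fract_0)
  show "symp (\<lambda>x y :: 'p padic. x - y \<in> range to_fract)"
  proof (rule sympI)
    fix x y :: "'p padic"
    assume "x - y \<in> range to_fract"
    then obtain a where "x - y = to_fract a" by auto
    then have "y - x = to_fract (- a)" by (metis minus_diff_eq to_fract_uminus)
    then show "y - x \<in> range to_fract" by (metis rangeI)
  qed
  show "transp (\<lambda>x y :: 'p padic. x - y \<in> range to_fract)"
  proof (rule transpI)
    fix x y z :: "'p padic"
    assume "x - y \<in> range to_fract" "y - z \<in> range to_fract"
    then obtain a b where "x - y = to_fract a" "y - z = to_fract b" by auto
    then have "x - z = to_fract (a + b)" by (simp add: algebra_simps flip: to_fract_add)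
    then show "x - z \<in> range to_fract" by (metis rangeI)
  qed
qed

instantiation padic_quot :: (prime_card) ab_group_add
begin

lift_definition zero_padic_quot :: "'a padic_quot" is 0 .

lift_definition plus_padic_quot :: "'a padic_quot \<Rightarrow> 'a padic_quot \<Rightarrow> 'a padic_quot" is "(+)"
proof -
  fix x x' y y' :: "'a padic"
  assume "x - x' \<in> range to_fract" "y - y' \<in> range to_fract"
  then obtain a b where "x - x' = to_fract a" "y - y' = to_fract b" by auto
  then have "(x + y) - (x' + y') = to_fract (a + b)" by (simp add: algebra_simps flip: to_fract_add)
  then show "(x + y) - (x' + y') \<in> range to_fract" by (metis rangeI)
qed

lift_definition minus_padic_quot :: "'a padic_quot \<Rightarrow> 'a padic_quot \<Rightarrow> 'a padic_quot" is "(-)"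
proof -
  fix x x' y y' :: "'a padic"
  assume "x - x' \<in> range to_fract" "y - y' \<in> range to_fract"
  then obtain a b where "x - x' = to_fract a" "y - y' = to_fract b" by auto
  then have "(x - y) - (x' - y') = to_fract (a - b)"
    by (simp add: algebra_simps flip: to_fract_diff)
  then show "(x - y) - (x' - y') \<in> range to_fract" by (metis rangeI)
qed

lift_definition uminus_padic_quot :: "'a padic_quot \<Rightarrow> 'a padic_quot" is "uminus"
proof -
  fix x x' :: "'a padic"
  assume "x - x' \<in> range to_fract"
  then obtain a where "x - x' = to_fract a" by auto
  then have "- x - - x' = to_fract (- a)" by (simp add: algebra_simps flip: to_fract_uminus)
  then show "- x - - x' \<in> range to_fract" by (metis rangeI)
qed

instance
proof
  have *: "a \<in> range (to_fract :: 'a padic_int \<Rightarrow> _)" if "a = 0" for a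
    using that by (metis rangeI to_fract_0)
  fix a b c :: "'a padic_quot"
  show "a + b + c = a + (b + c)" by transfer (rule *, simp)
  show "a + b = b + a" by transfer (rule *, simp)
  show "0 + a = a" by transfer (rule *, simp)
  show "- a + a = 0" by transfer (rule *, simp)
  show "a - b = a + - b" by transfer (rule *, simp)
qed

end

lifting_forget padic_int.lifting

lift_definition scale_padic_quot ::
    "'p::prime_card padic_int \<Rightarrow> 'p padic_quot \<Rightarrow> 'p padic_quot"
  is "\<lambda>c x. to_fract c * x"
proof -
  fix c :: "'p padic_int" and x x' :: "'p padic"
  assume "x - x' \<in> range to_fract"
  then obtain a where "x - x' = to_fract a" by auto
  then have "to_fract c * x - to_fract c * x' = to_fract (c * a)"
    by (simp add: algebra_simps to_fract_mult flip: right_diff_distrib)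
  then show "to_fract c * x - to_fract c * x' \<in> range to_fract" by (metis rangeI)
qed


section \<open>Quadratic spaces and their orthogonal groups\<close>

text \<open>
  A free module of rank \<open>n\<close> over \<open>\<int>\<^sub>\<ell>\<close> is written as \<open>carrier_vec n\<close>, and its endomorphisms as
  \<open>n\<close> by \<open>n\<close> matrices.
\<close>

definition polar :: "('a::comm_ring_1 vec \<Rightarrow> 'a) \<Rightarrow> 'a vec \<Rightarrow> 'a vec \<Rightarrow> 'a" where
  "polar Q v w = Q (v + w) - Q v - Q w"

definition quadratic_form :: "nat \<Rightarrow> ('a::comm_ring_1 vec \<Rightarrow> 'a) \<Rightarrow> bool" where
  "quadratic_form n Q \<longleftrightarrow>
     (\<forall>a. \<forall>v\<in>carrier_vec n. Q (a \<cdot>\<^sub>v v) = a\<^sup>2 * Q v) \<and>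
     (\<forall>u\<in>carrier_vec n. \<forall>v\<in>carrier_vec n. \<forall>w\<in>carrier_vec n.
        polar Q (u + v) w = polar Q u w + polar Q v w) \<and>
     (\<forall>a. \<forall>v\<in>carrier_vec n. \<forall>w\<in>carrier_vec n. polar Q (a \<cdot>\<^sub>v v) w = a * polar Q v w)"

definition linear_functional :: "nat \<Rightarrow> ('a::comm_ring_1 vec \<Rightarrow> 'a) \<Rightarrow> bool" where
  "linear_functional n f \<longleftrightarrow>
     (\<forall>v\<in>carrier_vec n. \<forall>w\<in>carrier_vec n. f (v + w) = f v + f w) \<and>
     (\<forall>a. \<forall>v\<in>carrier_vec n. f (a \<cdot>\<^sub>v v) = a * f v)"

text \<open>
  Nondegeneracy is perfectness of the polar form: \<open>v \<mapsto> polar Q v\<close> is a bijection onto the dual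
  module. In residue characteristic 2 this is the usual notion only because the rank is even.
\<close>

definition nondegenerate_quadratic_space :: "nat \<Rightarrow> ('a::comm_ring_1 vec \<Rightarrow> 'a) \<Rightarrow> bool" where
  "nondegenerate_quadratic_space n Q \<longleftrightarrow> quadratic_form n Q \<and>
     (\<forall>f. linear_functional n f \<longrightarrow>
        (\<exists>!v. v \<in> carrier_vec n \<and> (\<forall>w\<in>carrier_vec n. f w = polar Q v w)))"

definition orthogonal_group :: "nat \<Rightarrow> ('a::comm_ring_1 vec \<Rightarrow> 'a) \<Rightarrow> 'a mat set" where
  "orthogonal_group n Q =
     {g \<in> carrier_mat n n. invertible_mat g \<and> (\<forall>v\<in>carrier_vec n. Q (g *\<^sub>v v) = Q v)}"

text \<open>
  The Dickson invariant takes values in a constant group, so it can be computed after reduction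
  modulo \<open>\<ell>\<close>; for a nondegenerate quadratic space of even dimension over a field (of any
  characteristic) it is the parity of the rank of \<open>g - id\<close>.
\<close>

definition dickson_invariant :: "nat \<Rightarrow> 'p::prime_card padic_int mat \<Rightarrow> nat" where
  "dickson_invariant n g = vec_space.rank n (map_mat reduce_padic (g - 1\<^sub>m n)) mod 2"

text \<open>
  The reflection \<open>x \<mapsto> x - polar Q x v / Q v \<cdot> v\<close> of \<open>V \<otimes> \<rat>\<^sub>\<ell>\<close>, as a matrix. Since every line of
  \<open>V \<otimes> \<rat>\<^sub>\<ell>\<close> is spanned by a vector of \<open>V\<close>, all reflections arise from some \<open>v\<close> in \<open>V\<close>.
\<close>

definition reflection ::
    "nat \<Rightarrow> ('p::prime_card padic_int vec \<Rightarrow> 'p padic_int) \<Rightarrow> 'p padic_int vec \<Rightarrow> 'p padic mat"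
  where
  "reflection n Q v = mat n n (\<lambda>(i, j). (if i = j then 1 else 0)
     - to_fract (polar Q (unit_vec n j) v) / to_fract (Q v) * to_fract (v $ i))"

text \<open>
  The \<open>(-1)\<close>-spinor norm sends the reflection in \<open>v\<close> to the class of \<open>- Q v\<close>. Its value at \<open>g\<close>, an
  element of \<open>\<int>\<^sub>\<ell>\<^sup>\<times>/(\<int>\<^sub>\<ell>\<^sup>\<times>)\<^sup>2\<close>, is given as a coset, that is, as a set of units. Writing \<open>g\<close> as a
  product of reflections may require reflections that do not preserve \<open>V\<close> (if \<open>\<ell> = 2\<close>), so the
  product is taken in the orthogonal group over \<open>\<rat>\<^sub>\<ell>\<close>; the resulting class in \<open>\<rat>\<^sub>\<ell>\<^sup>\<times>/(\<rat>\<^sub>\<ell>\<^sup>\<times>)\<^sup>2\<close>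
  does not depend on the factorization, and is represented by units.
\<close>

definition neg_spinor_norm ::
    "nat \<Rightarrow> ('p::prime_card padic_int vec \<Rightarrow> 'p padic_int) \<Rightarrow> 'p padic_int mat \<Rightarrow> 'p padic_int set"
  where
  "neg_spinor_norm n Q g = {c. c dvd 1 \<and>
     (\<exists>vs. set vs \<subseteq> {v \<in> carrier_vec n. Q v \<noteq> 0} \<and>
        map_mat to_fract g = foldr (*) (map (reflection n Q) vs) (1\<^sub>m n) \<and>
        (\<exists>s :: 'p padic. s \<noteq> 0 \<and> to_fract (\<Prod>v\<leftarrow>vs. - Q v) = to_fract c * s\<^sup>2))}"

text \<open>The coset \<open>neg_spinor_norm n Q g\<close> is the trivial one iff it contains \<open>1\<close>.\<close>

definition Omega ::
    "nat \<Rightarrow> ('p::prime_card padic_int vec \<Rightarrow> 'p padic_int) \<Rightarrow> 'p padic_int mat set" where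
  "Omega n Q =
     {g \<in> orthogonal_group n Q. dickson_invariant n g = 0 \<and> 1 \<in> neg_spinor_norm n Q g}"

definition union_of_cosets_Omega ::
    "nat \<Rightarrow> ('p::prime_card padic_int vec \<Rightarrow> 'p padic_int) \<Rightarrow> 'p padic_int mat set \<Rightarrow> bool" where
  "union_of_cosets_Omega n Q H \<longleftrightarrow>
     (\<exists>S \<subseteq> orthogonal_group n Q. H = (\<Union>h\<in>S. (\<lambda>w. h * w) ` Omega n Q))"


section \<open>Haar measure\<close>

definition reduce_mat :: "nat \<Rightarrow> 'p::prime_card padic_int mat \<Rightarrow> int mat" where
  "reduce_mat e g = map_mat (\<lambda>x. residue_padic x e) g"

text \<open>
  The isometry group of \<open>(V/\<ell>\<^sup>eV, Q mod \<ell>\<^sup>e)\<close>. Its elements are matrices over \<open>\<int>/\<ell>\<^sup>e\<int>\<close>, with entries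
  in \<open>{0..<\<ell>\<^sup>e}\<close>; the conditions are stated for an arbitrary lift \<open>A\<close> to \<open>\<int>\<^sub>\<ell>\<close>, which need not be
  an isometry itself.
\<close>

definition orthogonal_group_mod ::
    "nat \<Rightarrow> ('p::prime_card padic_int vec \<Rightarrow> 'p padic_int) \<Rightarrow> nat \<Rightarrow> int mat set" where
  "orthogonal_group_mod n Q e = reduce_mat e `
     {A :: 'p padic_int mat. A \<in> carrier_mat n n \<and>
        (\<exists>B \<in> carrier_mat n n. reduce_mat e (A * B) = reduce_mat e (1\<^sub>m n :: 'p padic_int mat) \<and>
           reduce_mat e (B * A) = reduce_mat e (1\<^sub>m n :: 'p padic_int mat)) \<and>
        (\<forall>v\<in>carrier_vec n. residue_padic (Q (A *\<^sub>v v)) e = residue_padic (Q v) e)}"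

definition haar_measure ::
    "nat \<Rightarrow> ('p::prime_card padic_int vec \<Rightarrow> 'p padic_int) \<Rightarrow> 'p padic_int mat measure \<Rightarrow> bool"
  where
  "haar_measure n Q M \<longleftrightarrow>
     space M = orthogonal_group n Q \<and>
     sets M = sigma_sets (orthogonal_group n Q)
       {reduce_mat e -` {A} \<inter> orthogonal_group n Q | e A. True} \<and>
     (\<forall>e. distr M (count_space (orthogonal_group_mod n Q e)) (reduce_mat e)
        = uniform_count_measure (orthogonal_group_mod n Q e))"


section \<open>The random variables\<close>

text \<open>For \<open>V = \<int>\<^sub>\<ell>\<^sup>n\<close>, the module \<open>V \<otimes> \<rat>\<^sub>\<ell>/\<int>\<^sub>\<ell>\<close> is \<open>(\<rat>\<^sub>\<ell>/\<int>\<^sub>\<ell>)\<^sup>n\<close>, with \<open>g\<close> acting as \<open>g \<otimes> id\<close>.\<close>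

definition tensor_act ::
    "'p::prime_card padic_int mat \<Rightarrow> 'p padic_quot vec \<Rightarrow> 'p padic_quot vec" where
  "tensor_act g x =
     vec (dim_row g) (\<lambda>i. \<Sum>j<dim_col g. scale_padic_quot (g $$ (i, j)) (x $ j))"

definition scale_vec :: "'p::prime_card padic_int \<Rightarrow> 'p padic_quot vec \<Rightarrow> 'p padic_quot vec" where
  "scale_vec c x = map_vec (scale_padic_quot c) x"

definition torsion :: "nat \<Rightarrow> nat \<Rightarrow> 'p::prime_card padic_quot vec set" where
  "torsion n j = {x \<in> carrier_vec n. scale_vec (of_nat CARD('p) ^ j) x = 0\<^sub>v n}"

definition kernel_on_torsion ::
    "nat \<Rightarrow> nat \<Rightarrow> 'p::prime_card padic_int mat \<Rightarrow> 'p padic_quot vec set" where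
  "kernel_on_torsion n j g = {x \<in> torsion n j. tensor_act g x - x = 0\<^sub>v n}"

text \<open>Dimension over \<open>\<bbbF>\<^sub>\<ell>\<close> of a subgroup of \<open>(\<rat>\<^sub>\<ell>/\<int>\<^sub>\<ell>)\<^sup>n\<close> that is annihilated by \<open>\<ell>\<close>.\<close>

definition dim_F :: "nat \<Rightarrow> 'p::prime_card padic_quot vec set \<Rightarrow> nat" where
  "dim_F n W = vectorspace.dim (class_ring :: 'p mod_ring ring)
     \<lparr>carrier = W, mult = undefined, one = undefined, zero = 0\<^sub>v n, add = (+),
      smult = (\<lambda>c. scale_vec (of_int (to_int_mod_ring c)))\<rparr>"

definition layer_dim :: "nat \<Rightarrow> nat \<Rightarrow> 'p::prime_card padic_int mat \<Rightarrow> nat" where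
  "layer_dim n j g = dim_F n (scale_vec (of_nat CARD('p) ^ (j - 1)) ` kernel_on_torsion n j g)"

text \<open>
  A Markov chain, not necessarily homogeneous in time, with values in \<open>\<nat>\<close> and indexed from 1.
\<close>

definition markov_chain :: "'a measure \<Rightarrow> (nat \<Rightarrow> 'a \<Rightarrow> nat) \<Rightarrow> bool" where
  "markov_chain P X \<longleftrightarrow> prob_space P \<and>
     (\<forall>j\<ge>1. X j \<in> measurable P (count_space UNIV)) \<and>
     (\<forall>i\<ge>1. \<forall>a k. \<P>(x in P. \<forall>j\<in>{1..i}. X j x = a j) > 0 \<longrightarrow>
        \<P>(x in P. X (Suc i) x = k \<bar> \<forall>j\<in>{1..i}. X j x = a j)
          = \<P>(x in P. X (Suc i) x = k \<bar> X i x = a i))"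

text \<open>Alternating bilinear forms on \<open>F\<^sup>r\<close>, given by their Gram matrices.\<close>

definition alternating_forms :: "nat \<Rightarrow> 'a::comm_ring_1 mat set" where
  "alternating_forms r = {A \<in> carrier_mat r r. \<forall>v\<in>carrier_vec r. v \<bullet> (A *\<^sub>v v) = 0}"

end

theory Submission
  imports Defs "Berlekamp_Zassenhaus.Berlekamp_Type_Based"
begin

text \<open>
  Let \<open>L\<^sub>j\<close> be the set of \<open>x \<in> V\<close> with \<open>(g - 1) x \<in> \<ell>\<^sup>j V\<close>, so that \<open>d\<^sub>j\<close> is the dimension of the reduction
  of \<open>L\<^sub>j\<close> modulo \<open>\<ell>\<close>. The form \<open>\<ell>\<^sup>-\<^sup>j B((g - 1) x, y)\<close> induces an alternating form on this reduction whose
  kernel is the reduction of \<open>L\<^sub>j\<^sub>+\<^sub>1\<close>. Replacing \<open>g\<close> by \<open>g k\<close> with \<open>k = 1 + \<ell>\<^sup>j N\<close> an isometry adds the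
  restriction of \<open>B(N x, y)\<close> to it. Products of two reflections in vectors with norms of square ratio give
  enough such \<open>k\<close> in \<open>\<Omega>\<close> to add every alternating form, unless \<open>\<ell> = 2\<close> and \<open>L\<^sub>j = V\<close>. Since \<open>H\<close> is stable
  under these \<open>k\<close>, the alternating form is uniformly distributed given \<open>g\<close> modulo \<open>\<ell>\<^sup>j\<close>. Only membership of
  explicit elements in \<open>\<Omega>\<close> is needed, not that the spinor norm is well defined.
\<close>

section \<open>The ring of \<open>\<ell>\<close>-adic integers\<close>

text \<open>That the kernel of the alternating form is no larger than the reduction of L_{j+1} rests
  on a count: the graph of ell^-j (g - 1), reduced modulo ell, has ell^n elements for every j, which
  forces its second projection to be the full orthogonal complement of the reduction of L_{j+1}. The
  prime 2 shapes the construction of k. A 2-adic unit is a square only if it is 1 modulo 8, so the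
  reflection vectors have to be corrected modulo 2, and a single pair v, w with odd B(v, w) is not
  covered. A primitive vector orthogonal to L_j modulo 2 allows such a pair to be replaced by
  admissible pairs with the same total form on L_j; it exists exactly when L_j does not reduce onto
  V modulo 2, whence the exception in the theorem. That H is measurable has to be proved: isometries
  near the identity are written as products of reflections, so membership in H is decided modulo
  some power of ell. Probabilities then become counts of residue classes, and dimensions are
  compared through cardinalities, since the spaces over the residue field occur in several
  encodings.\<close>

abbreviation ell :: "'p::prime_card padic_int" where
  "ell \<equiv> of_nat CARD('p)"

lemma card_gt_1 [simp]: "1 < int CARD('p::prime_card)"
  using prime_card_int[where ?'a = 'p] by (rule prime_gt_1_int)

section \<open>Residues and divisibility by powers of \<open>ell\<close>\<close>

lemma residue_padic_range:
  "0 \<le> residue_padic x n" "residue_padic (x :: 'p::prime_card padic_int) n < int CARD('p) ^ n"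
  using residue_padic[of x] by auto

lemma residue_padic_mod_le:
  "m \<le> n \<Longrightarrow> residue_padic (x :: 'p::prime_card padic_int) n mod int CARD('p) ^ m = residue_padic x m"
  using residue_padic_mod[of x m "n - m"] by simp

lemma residue_padic_mod_self [simp]:
  "residue_padic (x :: 'p::prime_card padic_int) n mod int CARD('p) ^ n = residue_padic x n"
  by (rule residue_padic_mod_le) simp

lemma padic_int_eqI: "(\<And>n. residue_padic x n = residue_padic y n) \<Longrightarrow> x = y"
  by (metis residue_padic_inject ext)

lemma residue_padic_of_int:
  "residue_padic (of_int a :: 'p::prime_card padic_int) n = a mod int CARD('p) ^ n"
proof -
  have *: "residue_padic (of_nat k :: 'p padic_int) n = int k mod int CARD('p) ^ n" for k
    by (induction k) (auto simp: zero_padic_int.rep_eq one_padic_int.rep_eq plus_padic_int.rep_eq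
        mod_simps algebra_simps)
  obtain i j where a: "a = int i - int j" by (rule int_diff_cases)
  show ?thesis
    unfolding a of_int_diff of_int_of_nat_eq minus_padic_int.rep_eq * by (simp only: mod_diff_eq)
qed

lemma ell_power_eq_of_int: "ell ^ e = (of_int (int CARD('p) ^ e) :: 'p::prime_card padic_int)"
  by simp

lemma residue_padic_ell_power_mult:
  "residue_padic (ell ^ e * y :: 'p::prime_card padic_int) n
    = (int CARD('p) ^ e * residue_padic y n) mod int CARD('p) ^ n"
  unfolding ell_power_eq_of_int times_padic_int.rep_eq residue_padic_of_int by (simp add: mod_simps)

lemma residue_padic_eq_0_iff:
  "residue_padic (x :: 'p::prime_card padic_int) e = 0 \<longleftrightarrow> ell ^ e dvd x"
proof
  assume "ell ^ e dvd x"
  then obtain y where "x = ell ^ e * y" by auto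
  then show "residue_padic x e = 0" by (simp only: residue_padic_ell_power_mult) simp
next
  let ?l = "int CARD('p)"
  assume x: "residue_padic x e = 0"
  have pos: "?l ^ k > 0" for k
    using card_gt_1[where ?'p = 'p] by (intro zero_less_power) linarith
  have dvd: "?l ^ e dvd residue_padic x (n + e)" for n
    using residue_padic_mod_le[of e "n + e" x] x by auto
  \<comment> \<open>Division by \<open>ell ^ e\<close> loses \<open>e\<close> digits, hence the
    shift: the quotient modulo \<open>ell ^ n\<close> is read off from \<open>x\<close> modulo
    \<open>ell ^ (n + e)\<close>.\<close>
  define y :: "'p padic_int" where "y = Abs_padic_int (\<lambda>n. residue_padic x (n + e) div ?l ^ e)"
  have y: "residue_padic y n = residue_padic x (n + e) div ?l ^ e" for n
  proof -
    have "residue_padic x (n + e) div ?l ^ e < ?l ^ n" for n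
      using residue_padic_range(2)[of x "n + e"] dvd[of n] pos[of e]
      by (auto simp: power_add elim!: dvdE)
    moreover have "residue_padic x (Suc n + e) div ?l ^ e mod ?l ^ n = residue_padic x (n + e) div ?l ^ e" for n
    proof -
      have "residue_padic x (n + e) = residue_padic x (Suc n + e) mod ?l ^ (n + e)"
        by (rule residue_padic_mod_le[symmetric]) simp
      then have "residue_padic x (n + e) div ?l ^ e = residue_padic x (Suc n + e) mod (?l ^ e * ?l ^ n) div ?l ^ e"
        by (simp add: power_add mult.commute)
      also have "\<dots> = residue_padic x (Suc n + e) div ?l ^ e mod ?l ^ n"
      proof -
        obtain c where c: "residue_padic x (Suc n + e) = ?l ^ e * c" using dvd by blast
        show ?thesis unfolding c using pos[of e] by simp
      qed
      finally show ?thesis ..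
    qed
    ultimately have "(\<lambda>n. residue_padic x (n + e) div ?l ^ e) \<in>
      {x. \<forall>n. x n \<in> {0..<?l ^ n} \<and> x (Suc n) mod ?l ^ n = x n}"
      using residue_padic_range(1)[of x] pos by (auto simp: pos_imp_zdiv_nonneg_iff)
    from Abs_padic_int_inverse[OF this] show ?thesis by (simp add: y_def)
  qed
  have "x = ell ^ e * y"
  proof (rule padic_int_eqI)
    fix n
    have "?l ^ e * residue_padic y n = residue_padic x (n + e)"
      using dvd[of n] by (simp add: y)
    then show "residue_padic x n = residue_padic (ell ^ e * y) n"
      using residue_padic_mod_le[of n "n + e" x] by (simp only: residue_padic_ell_power_mult)
  qed
  then show "ell ^ e dvd x" by simp
qed

lemma residue_padic_eq_iff:
  "residue_padic (x :: 'p::prime_card padic_int) e = residue_padic y e \<longleftrightarrow> ell ^ e dvd x - y"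
proof -
  have "residue_padic x e = residue_padic y e \<longleftrightarrow> residue_padic (x - y) e = 0"
    unfolding minus_padic_int.rep_eq
    by (metis mod_eq_dvd_iff dvd_eq_mod_eq_0 residue_padic_mod_self)
  then show ?thesis by (simp add: residue_padic_eq_0_iff)
qed

lemma ell_power_dvd_all_imp_0:
  assumes "\<And>e. ell ^ e dvd (x :: 'p::prime_card padic_int)"
  shows "x = 0"
  by (rule padic_int_eqI) (use assms in \<open>simp add: residue_padic_eq_0_iff zero_padic_int.rep_eq\<close>)

section \<open>Completeness, units and square roots\<close>

text \<open>Completeness as a contraction principle: the iterates of 0 agree modulo growing powers
  of \<open>ell\<close>, so their diagonal residues define an element. It supplies both inverses of
  units and square roots.\<close>

lemma padic_contraction_fixpoint:
  fixes f :: "'p::prime_card padic_int \<Rightarrow> 'p padic_int"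
  assumes f: "\<And>k x y. ell ^ k dvd x - y \<Longrightarrow> ell ^ Suc k dvd f x - f y"
  shows "\<exists>t. f t = t"
proof -
  let ?l = "int CARD('p)"
  define X where "X n = (f ^^ n) 0" for n
  have step: "ell ^ n dvd X (Suc n) - X n" for n
    by (induction n) (use f in \<open>auto simp: X_def\<close>)
  define t :: "'p padic_int" where "t = Abs_padic_int (\<lambda>n. residue_padic (X n) n)"
  have t: "residue_padic t n = residue_padic (X n) n" for n
  proof -
    have "residue_padic (X (Suc n)) (Suc n) mod ?l ^ n = residue_padic (X n) n" for n
      using residue_padic_mod_le[of n "Suc n" "X (Suc n)"] step[of n]
      by (simp flip: residue_padic_eq_iff)
    then have "(\<lambda>n. residue_padic (X n) n) \<in> {x. \<forall>n. x n \<in> {0..<?l ^ n} \<and> x (Suc n) mod ?l ^ n = x n}"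
      using residue_padic_range by auto
    from Abs_padic_int_inverse[OF this] show ?thesis by (simp add: t_def)
  qed
  then have X: "ell ^ n dvd t - X n" for n
    by (simp flip: residue_padic_eq_iff)
  have "f t - t = 0"
  proof (rule ell_power_dvd_all_imp_0)
    fix e
    have "ell ^ Suc e dvd f t - X (Suc e)"
      using f[OF X[of e]] by (simp add: X_def)
    from dvd_diff[OF this X[of "Suc e"]] have "ell ^ Suc e dvd f t - t" by simp
    then show "ell ^ e dvd f t - t"
      by (rule dvd_trans[rotated]) (simp add: le_imp_power_dvd)
  qed
  then show ?thesis by auto
qed

lemma ell_nonzero [simp]: "(ell :: 'p::prime_card padic_int) \<noteq> 0"
proof
  assume "(ell :: 'p padic_int) = 0"
  then have "residue_padic (of_int (int CARD('p)) :: 'p padic_int) 2 = 0"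
    by (simp add: zero_padic_int.rep_eq)
  moreover have "int CARD('p) mod int CARD('p) ^ 2 = int CARD('p)"
    using card_gt_1[where ?'p = 'p] by (intro mod_pos_pos_trivial) (auto simp: power2_eq_square)
  ultimately show False
    by (simp add: residue_padic_of_int del: of_int_of_nat_eq)
qed

lemma reduce_padic_of_int: "reduce_padic (of_int a :: 'p::prime_card padic_int) = of_int a"
  using of_int_mod_CHAR[where ?'a = "'p mod_ring", of a]
  by (simp add: reduce_padic_def residue_padic_of_int)

lemma of_int_mod_card: "(of_int (a mod int CARD('p)) :: 'p::prime_card mod_ring) = of_int a"
  using of_int_mod_CHAR[where ?'a = "'p mod_ring", of a] by simp

lemma reduce_padic_simps [simp]:
  "reduce_padic (x + y) = reduce_padic x + reduce_padic y"
  "reduce_padic (x - y) = reduce_padic x - reduce_padic y"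
  "reduce_padic (- x) = - reduce_padic x"
  "reduce_padic (x * y) = reduce_padic x * reduce_padic y"
  "reduce_padic 0 = 0"
  "reduce_padic 1 = 1"
  by (simp_all add: reduce_padic_def plus_padic_int.rep_eq minus_padic_int.rep_eq
      uminus_padic_int.rep_eq times_padic_int.rep_eq zero_padic_int.rep_eq one_padic_int.rep_eq
      of_int_mod_card)

lemma reduce_padic_eq_0_iff: "reduce_padic (x :: 'p::prime_card padic_int) = 0 \<longleftrightarrow> ell dvd x"
proof -
  have "reduce_padic x = 0 \<longleftrightarrow> int CARD('p) dvd residue_padic x 1"
    by (simp add: reduce_padic_def of_int_eq_0_iff_char_dvd)
  also have "\<dots> \<longleftrightarrow> residue_padic x 1 = 0"
    using residue_padic_range[of x 1] by (auto dest: zdvd_imp_le)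
  finally show ?thesis using residue_padic_eq_0_iff[of x 1] by simp
qed

lemma reduce_padic_eq_iff: "reduce_padic x = reduce_padic y \<longleftrightarrow> ell dvd x - y"
  unfolding reduce_padic_eq_0_iff[symmetric] by simp

definition lift_mod_ring :: "'p::prime_card mod_ring \<Rightarrow> 'p padic_int" where
  "lift_mod_ring c = of_int (to_int_mod_ring c)"

lemma reduce_lift_mod_ring [simp]: "reduce_padic (lift_mod_ring c) = c"
  by (simp add: lift_mod_ring_def reduce_padic_of_int of_int_of_int_mod_ring)

lemma padic_unit_iff: "(x :: 'p::prime_card padic_int) dvd 1 \<longleftrightarrow> \<not> ell dvd x"
proof
  assume "x dvd 1"
  then obtain y where "1 = x * y" by auto
  then have "reduce_padic x * reduce_padic y = 1"
    by (metis reduce_padic_simps(4,6))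
  then show "\<not> ell dvd x" by (auto simp flip: reduce_padic_eq_0_iff)
next
  assume "\<not> ell dvd x"
  then have nz: "reduce_padic x \<noteq> 0" by (simp add: reduce_padic_eq_0_iff)
  define y where "y = lift_mod_ring (inverse (reduce_padic x))"
  have "reduce_padic (x * y) = reduce_padic 1" using nz by (simp add: y_def)
  then have "ell dvd x * y - 1" by (simp only: reduce_padic_eq_iff)
  then obtain z where z: "x * y - 1 = ell * z" by blast
  \<comment> \<open>A fixed point inverts \<open>1 + ell * z = x * y\<close>; the factor
    \<open>ell\<close> makes the map contracting.\<close>
  have "\<exists>t. 1 - ell * z * t = t"
  proof (rule padic_contraction_fixpoint)
    fix k and a b :: "'p padic_int"
    assume "ell ^ k dvd a - b"
    then have "ell * ell ^ k dvd ell * (z * (b - a))"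
      by (intro mult_dvd_mono dvd_mult) (auto simp: dvd_minus_iff[of _ "b - a", symmetric] simp del: dvd_minus_iff)
    then show "ell ^ Suc k dvd (1 - ell * z * a) - (1 - ell * z * b)"
      by (simp add: algebra_simps)
  qed
  then obtain t where "1 - ell * z * t = t" ..
  with z have "1 - (x * y - 1) * t = t" by simp
  then have "x * (y * t) = 1" by (simp add: algebra_simps)
  then show "x dvd 1" by (metis dvdI)
qed

lemma not_ell_dvd_1 [simp]: "\<not> ell dvd (1 :: 'p::prime_card padic_int)"
  using padic_unit_iff[of 1] by simp

lemma ell_dvd_mult_iff: "ell dvd x * y \<longleftrightarrow> ell dvd x \<or> ell dvd (y :: 'p::prime_card padic_int)"
  by (simp flip: reduce_padic_eq_0_iff)

text \<open>The ansatz \<open>1 + 2 * ell * t\<close> for the root turns the equation into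
  \<open>t + ell * t\<^sup>2 = x\<close>, which is contracting in \<open>t\<close>. With the factor
  4 one statement serves all primes, including 2.\<close>

lemma one_plus_4_ell_square: "\<exists>s. s\<^sup>2 = 1 + 4 * ell * (x :: 'p::prime_card padic_int)"
proof -
  have "\<exists>t. x - ell * t\<^sup>2 = t"
  proof (rule padic_contraction_fixpoint)
    fix k and a b :: "'p padic_int"
    assume "ell ^ k dvd a - b"
    then have "ell * ell ^ k dvd ell * ((b + a) * (b - a))"
      by (intro mult_dvd_mono dvd_mult) (auto simp: dvd_minus_iff[of _ "b - a", symmetric] simp del: dvd_minus_iff)
    then show "ell ^ Suc k dvd (x - ell * a\<^sup>2) - (x - ell * b\<^sup>2)"
      by (simp add: algebra_simps power2_eq_square)
  qed
  then obtain t where t: "x = t + ell * t\<^sup>2" by (metis add.commute diff_eq_eq)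
  have "(1 + 2 * ell * t)\<^sup>2 = 1 + 4 * ell * x" unfolding t by (simp add: power2_eq_square algebra_simps)
  then show ?thesis by blast
qed

lemma ell_odd_unit_2: "odd CARD('p) \<Longrightarrow> (2 :: 'p::prime_card padic_int) dvd 1"
proof -
  assume odd: "odd CARD('p)"
  have "reduce_padic (of_int 2 :: 'p padic_int) \<noteq> 0"
  proof
    assume "reduce_padic (of_int 2 :: 'p padic_int) = 0"
    then have "int CARD('p) dvd 2"
      unfolding reduce_padic_of_int by (simp only: of_int_eq_0_iff_char_dvd) simp
    then have "int CARD('p) \<le> 2" by (auto dest: zdvd_imp_le)
    with card_gt_1[where ?'p = 'p] odd show False by (cases "CARD('p) = 2") auto
  qed
  then show ?thesis by (simp add: reduce_padic_eq_0_iff padic_unit_iff)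
qed

lemma two_nonzero [simp]: "(2 :: 'p::prime_card padic_int) \<noteq> 0"
proof (cases "odd CARD('p)")
  case True then show ?thesis using ell_odd_unit_2 by force
next
  case False
  then have "2 = CARD('p)"
    using primes_dvd_imp_eq[OF two_is_prime_nat prime_card[where ?'a = 'p]] by simp
  with ell_nonzero[where ?'p = 'p] show ?thesis by (metis of_nat_numeral)
qed

lemma nonzero_dvd_ell_power:
  assumes "(x :: 'p::prime_card padic_int) \<noteq> 0"
  shows "\<exists>t. x dvd ell ^ t"
proof -
  obtain e where e: "\<not> ell ^ e dvd x" using assms ell_power_dvd_all_imp_0 by blast
  then show ?thesis using assms
  proof (induction e arbitrary: x)
    case (Suc e)
    show ?case
    proof (cases "ell dvd x")
      case True
      then obtain y where y: "x = ell * y" by blast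
      with Suc.prems have "\<not> ell ^ e dvd y" "y \<noteq> 0" by auto
      from Suc.IH[OF this] obtain t where "y dvd ell ^ t" ..
      then have "x dvd ell ^ Suc t" by (simp add: y)
      then show ?thesis ..
    next
      case False
      then have "x dvd ell ^ 0" by (simp add: padic_unit_iff)
      then show ?thesis ..
    qed
  qed auto
qed

section \<open>Divisibility of vectors and reduction modulo \<open>\<ell>\<close>\<close>

definition vdvd :: "'a::comm_ring_1 \<Rightarrow> 'a vec \<Rightarrow> bool" where
  "vdvd c v \<longleftrightarrow> (\<forall>i<dim_vec v. c dvd v $ i)"

lemma vdvdE:
  assumes "vdvd c v" "v \<in> carrier_vec n"
  obtains u where "u \<in> carrier_vec n" "v = c \<cdot>\<^sub>v u"
proof -
  from assms have "\<forall>i. \<exists>u. i < n \<longrightarrow> v $ i = c * u" by (auto simp: vdvd_def dvd_def)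
  then obtain u where u: "\<And>i. i < n \<Longrightarrow> v $ i = c * u i" by metis
  show ?thesis
    by (rule that[of "vec n u"]) (use assms u in auto)
qed

lemma vdvd_smult_self [simp]: "vdvd c (c \<cdot>\<^sub>v u)"
  by (simp add: vdvd_def)

lemma vdvd_zero [simp]: "vdvd c (0\<^sub>v n)"
  by (simp add: vdvd_def)

lemma vdvd_smult: "vdvd c v \<Longrightarrow> vdvd c (a \<cdot>\<^sub>v v)"
  by (simp add: vdvd_def)

lemma vdvd_uminus [simp]: "vdvd c (- v) \<longleftrightarrow> vdvd c v"
  by (simp add: vdvd_def)

lemma vdvd_add:
  "v \<in> carrier_vec n \<Longrightarrow> w \<in> carrier_vec n \<Longrightarrow> vdvd c v \<Longrightarrow> vdvd c w \<Longrightarrow> vdvd c (v + w)"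
  by (auto simp: vdvd_def)

lemma vdvd_diff:
  "v \<in> carrier_vec n \<Longrightarrow> w \<in> carrier_vec n \<Longrightarrow> vdvd c v \<Longrightarrow> vdvd c w \<Longrightarrow> vdvd c (v - w)"
  by (auto simp: vdvd_def)

lemma vdvd_trans: "vdvd c v \<Longrightarrow> d dvd c \<Longrightarrow> vdvd d v"
  by (auto simp: vdvd_def intro: dvd_trans)

lemma vdvd_smult_cancel:
  fixes c :: "'a::idom"
  shows "c \<noteq> 0 \<Longrightarrow> vdvd (c * d) (c \<cdot>\<^sub>v v) \<longleftrightarrow> vdvd d v"
  by (simp add: vdvd_def)

lemma mult_mat_vec_smult:
  fixes c :: "'a::comm_ring_1"
  assumes "A \<in> carrier_mat k n" "v \<in> carrier_vec n"
  shows "A *\<^sub>v (c \<cdot>\<^sub>v v) = c \<cdot>\<^sub>v (A *\<^sub>v v)"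
  using assms by auto

lemma vdvd_mult_mat_vec:
  assumes "A \<in> carrier_mat k n" "v \<in> carrier_vec n" "vdvd c v"
  shows "vdvd c (A *\<^sub>v v)"
proof -
  obtain u where u: "u \<in> carrier_vec n" "v = c \<cdot>\<^sub>v u" using assms vdvdE by metis
  then have "A *\<^sub>v v = c \<cdot>\<^sub>v (A *\<^sub>v u)" using assms by (simp add: mult_mat_vec_smult)
  then show ?thesis by simp
qed

definition red_vec :: "'p::prime_card padic_int vec \<Rightarrow> 'p mod_ring vec" where
  "red_vec v = map_vec reduce_padic v"

lemma red_vec_carrier [simp]: "red_vec v \<in> carrier_vec n \<longleftrightarrow> v \<in> carrier_vec n"
  by (simp add: red_vec_def)

lemma red_vec_index [simp]: "i < dim_vec v \<Longrightarrow> red_vec v $ i = reduce_padic (v $ i)"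
  by (simp add: red_vec_def)

lemma red_vec_simps:
  assumes "v \<in> carrier_vec n" "w \<in> carrier_vec n"
  shows "red_vec (v + w) = red_vec v + red_vec w"
    and "red_vec (v - w) = red_vec v - red_vec w"
    and "red_vec (c \<cdot>\<^sub>v v) = reduce_padic c \<cdot>\<^sub>v red_vec v"
    and "red_vec (0\<^sub>v n) = 0\<^sub>v n"
  using assms by (auto simp: red_vec_def)

lemma red_vec_eq_0_iff: "v \<in> carrier_vec n \<Longrightarrow> red_vec v = 0\<^sub>v n \<longleftrightarrow> vdvd ell v"
  by (auto simp: red_vec_def vdvd_def reduce_padic_eq_0_iff vec_eq_iff)

lemma red_vec_eq_iff:
  "v \<in> carrier_vec n \<Longrightarrow> w \<in> carrier_vec n \<Longrightarrow> red_vec v = red_vec w \<longleftrightarrow> vdvd ell (v - w)"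
  by (auto simp: red_vec_def vdvd_def reduce_padic_eq_iff vec_eq_iff)

definition lift_vec :: "'p::prime_card mod_ring vec \<Rightarrow> 'p padic_int vec" where
  "lift_vec v = map_vec lift_mod_ring v"

lemma lift_vec_carrier [simp]: "lift_vec v \<in> carrier_vec n \<longleftrightarrow> v \<in> carrier_vec n"
  by (simp add: lift_vec_def)

lemma red_lift_vec [simp]: "red_vec (lift_vec v) = v"
  by (auto simp: red_vec_def lift_vec_def)

lemma neg_one_smult_vec: "- 1 \<cdot>\<^sub>v v = - (v :: 'a::comm_ring_1 vec)"
  by auto

section \<open>Linear functionals, linear maps and matrices\<close>

lemma linear_functional_expand:
  assumes f: "linear_functional n f" and x: "x \<in> carrier_vec n"
  shows "f x = (\<Sum>j<n. x $ j * f (unit_vec n j))"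
proof -
  define y where "y k = vec n (\<lambda>i. if i < k then x $ i else 0)" for k
  have add: "f (v + w) = f v + f w" if "v \<in> carrier_vec n" "w \<in> carrier_vec n" for v w
    using f that by (simp add: linear_functional_def)
  have smult: "f (a \<cdot>\<^sub>v v) = a * f v" if "v \<in> carrier_vec n" for a v
    using f that by (simp add: linear_functional_def)
  have y_n: "y n = x" using x by (auto simp: y_def)
  have "f (y k) = (\<Sum>j<k. x $ j * f (unit_vec n j))" if "k \<le> n" for k
    using that
  proof (induction k)
    case 0
    have "y 0 = 0 \<cdot>\<^sub>v 0\<^sub>v n" by (auto simp: y_def)
    then show ?case using smult[of "0\<^sub>v n" 0] by simp
  next
    case (Suc k)
    have "y (Suc k) = y k + x $ k \<cdot>\<^sub>v unit_vec n k"
      using Suc.prems by (auto simp: y_def less_Suc_eq)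
    moreover have "y k \<in> carrier_vec n" by (simp add: y_def)
    ultimately show ?case using Suc by (simp add: add smult)
  qed
  from this[of n] show ?thesis by (simp add: y_n)
qed

lemma linear_map_matrix:
  fixes F :: "'a::comm_ring_1 vec \<Rightarrow> 'a vec"
  assumes car: "\<And>x. x \<in> carrier_vec n \<Longrightarrow> F x \<in> carrier_vec n"
    and add: "\<And>x y. x \<in> carrier_vec n \<Longrightarrow> y \<in> carrier_vec n \<Longrightarrow> F (x + y) = F x + F y"
    and smult: "\<And>a x. x \<in> carrier_vec n \<Longrightarrow> F (a \<cdot>\<^sub>v x) = a \<cdot>\<^sub>v F x"
  obtains A where "A \<in> carrier_mat n n" "\<And>x. x \<in> carrier_vec n \<Longrightarrow> A *\<^sub>v x = F x"
proof
  let ?A = "mat n n (\<lambda>(i, j). F (unit_vec n j) $ i)"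
  show "?A \<in> carrier_mat n n" by simp
  fix x :: "'a vec" assume x: "x \<in> carrier_vec n"
  show "?A *\<^sub>v x = F x"
  proof (rule eq_vecI)
    fix i assume i: "i < dim_vec (F x)"
    with car[OF x] have i: "i < n" by simp
    have "linear_functional n (\<lambda>x. F x $ i)"
      using i by (auto simp: linear_functional_def add smult car[THEN carrier_vecD])
    from linear_functional_expand[OF this x] show "(?A *\<^sub>v x) $ i = F x $ i"
      using x i by (simp add: scalar_prod_def atLeast0LessThan mult.commute)
  qed (use car[OF x] in simp)
qed

lemma mat_eqI_mult_vec:
  assumes "A \<in> carrier_mat n n" "C \<in> carrier_mat n n"
    "\<And>x. x \<in> carrier_vec n \<Longrightarrow> A *\<^sub>v x = C *\<^sub>v (x :: 'a::comm_ring_1 vec)"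
  shows "A = C"
proof (rule eq_matI)
  fix i j assume "i < dim_row C" "j < dim_col C"
  with assms(1,2) have ij: "i < n" "j < n" by auto
  have *: "(D *\<^sub>v unit_vec n j) $ i = D $$ (i, j)" if "D \<in> carrier_mat n n" for D :: "'a mat"
    using that ij by (simp add: scalar_prod_right_unit)
  show "A $$ (i, j) = C $$ (i, j)" using *[OF assms(1)] *[OF assms(2)] assms(3)[of "unit_vec n j"] by simp
qed (use assms in auto)

text \<open>A left inverse is two-sided over the fraction field, and \<open>to_fract\<close> is
  injective on matrices.\<close>

lemma left_inverse_imp_invertible_mat:
  fixes A :: "'a::idom mat"
  assumes A: "A \<in> carrier_mat n n" and C: "C \<in> carrier_mat n n" and CA: "C * A = 1\<^sub>m n"
  shows "A * C = 1\<^sub>m n" "invertible_mat A"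
proof -
  have "to_fract_hom.mat_hom C * to_fract_hom.mat_hom A = 1\<^sub>m n"
    using CA A C by (metis to_fract_hom.mat_hom_mult to_fract_hom.mat_hom_one)
  then have "to_fract_hom.mat_hom A * to_fract_hom.mat_hom C = 1\<^sub>m n"
    using mat_mult_left_right_inverse[of "to_fract_hom.mat_hom C" n "to_fract_hom.mat_hom A"] A C by simp
  then have "to_fract_hom.mat_hom (A * C) = to_fract_hom.mat_hom (1\<^sub>m n)"
    using A C by (simp add: to_fract_hom.mat_hom_mult[of A n n C n] to_fract_hom.mat_hom_one)
  then show AC: "A * C = 1\<^sub>m n" by (rule to_fract_hom.mat_hom_inj)
  show "invertible_mat A"
    unfolding invertible_mat_def inverts_mat_def using A C AC CA by auto
qed

section \<open>Quadratic spaces\<close>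

locale quadratic_space =
  fixes n :: nat and Q :: "'p::prime_card padic_int vec \<Rightarrow> 'p padic_int"
  assumes nondegenerate: "nondegenerate_quadratic_space n Q"
begin

abbreviation V where "V \<equiv> (carrier_vec n :: 'p padic_int vec set)"
abbreviation B where "B \<equiv> polar Q"
abbreviation OV where "OV \<equiv> orthogonal_group n Q"

lemma quadratic_form: "quadratic_form n Q"
  using nondegenerate by (simp add: nondegenerate_quadratic_space_def)

lemma Q_smult: "v \<in> V \<Longrightarrow> Q (a \<cdot>\<^sub>v v) = a\<^sup>2 * Q v"
  and B_add_left: "u \<in> V \<Longrightarrow> v \<in> V \<Longrightarrow> w \<in> V \<Longrightarrow> B (u + v) w = B u w + B v w"
  and B_smult_left: "v \<in> V \<Longrightarrow> w \<in> V \<Longrightarrow> B (a \<cdot>\<^sub>v v) w = a * B v w"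
  using quadratic_form by (simp_all add: quadratic_form_def)

lemma Q_add: "Q (v + w) = Q v + Q w + B v w"
  by (simp add: polar_def)

lemma B_sym: "v \<in> V \<Longrightarrow> w \<in> V \<Longrightarrow> B v w = B w v"
  by (simp add: polar_def comm_add_vec[of v n w])

lemma B_add_right: "u \<in> V \<Longrightarrow> v \<in> V \<Longrightarrow> w \<in> V \<Longrightarrow> B w (u + v) = B w u + B w v"
  by (simp add: B_sym[of w] B_add_left)

lemma B_smult_right: "v \<in> V \<Longrightarrow> w \<in> V \<Longrightarrow> B w (a \<cdot>\<^sub>v v) = a * B w v"
  by (simp add: B_sym[of w] B_smult_left)

lemma B_uminus_left: "v \<in> V \<Longrightarrow> w \<in> V \<Longrightarrow> B (- v) w = - B v w"
  using B_smult_left[of v w "- 1"] by (simp add: neg_one_smult_vec)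

lemma B_uminus_right: "v \<in> V \<Longrightarrow> w \<in> V \<Longrightarrow> B w (- v) = - B w v"
  by (simp add: B_sym[of w] B_uminus_left)

lemma B_diff_left: "u \<in> V \<Longrightarrow> v \<in> V \<Longrightarrow> w \<in> V \<Longrightarrow> B (u - v) w = B u w - B v w"
  by (simp add: minus_add_uminus_vec[of u n v] B_add_left B_uminus_left)

lemma B_diff_right: "u \<in> V \<Longrightarrow> v \<in> V \<Longrightarrow> w \<in> V \<Longrightarrow> B w (u - v) = B w u - B w v"
  by (simp add: B_sym[of w] B_diff_left)

lemmas B_simps = B_add_left B_smult_left B_add_right B_smult_right
  B_uminus_left B_uminus_right B_diff_left B_diff_right

lemma B_self: "v \<in> V \<Longrightarrow> B v v = 2 * Q v"
proof -
  assume v: "v \<in> V"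
  have "v + v = 2 \<cdot>\<^sub>v v" using v by auto
  then show ?thesis using Q_smult[OF v, of 2] by (simp add: polar_def)
qed

lemma linear_functional_B: "w \<in> V \<Longrightarrow> linear_functional n (B w)"
  by (simp add: linear_functional_def B_simps)

lemma representing_vector:
  assumes "linear_functional n f"
  obtains v where "v \<in> V" "\<And>w. w \<in> V \<Longrightarrow> B v w = f w"
  using nondegenerate assms unfolding nondegenerate_quadratic_space_def by metis

text \<open>The basis dual to the unit vectors with respect to \<open>B\<close>, available by
  nondegeneracy. It turns coordinates into pairings.\<close>

definition dual where "dual i = (SOME v. v \<in> V \<and> (\<forall>w\<in>V. B v w = w $ i))"

lemma dual: "i < n \<Longrightarrow> dual i \<in> V" "i < n \<Longrightarrow> w \<in> V \<Longrightarrow> B (dual i) w = w $ i"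
proof -
  have "dual i \<in> V \<and> (\<forall>w\<in>V. B (dual i) w = w $ i)" if "i < n"
    unfolding dual_def
  proof (rule someI_ex)
    have "linear_functional n (\<lambda>w :: 'p padic_int vec. w $ i)"
      using that by (auto simp: linear_functional_def)
    then show "\<exists>v. v \<in> V \<and> (\<forall>w\<in>V. B v w = w $ i)" by (metis representing_vector)
  qed
  then show "i < n \<Longrightarrow> dual i \<in> V" "i < n \<Longrightarrow> w \<in> V \<Longrightarrow> B (dual i) w = w $ i" by auto
qed

lemma vdvd_imp_dvd_B: "vdvd c v \<Longrightarrow> v \<in> V \<Longrightarrow> w \<in> V \<Longrightarrow> c dvd B v w"
  by (metis vdvdE B_smult_left dvd_triv_left)

lemma vdvd_imp_dvd_B': "vdvd c v \<Longrightarrow> v \<in> V \<Longrightarrow> w \<in> V \<Longrightarrow> c dvd B w v"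
  by (metis vdvd_imp_dvd_B B_sym)

lemma eq_vecI_B:
  assumes "v \<in> V" "w \<in> V" "\<And>x. x \<in> V \<Longrightarrow> B v x = B w x"
  shows "v = w"
proof (rule eq_vecI)
  fix i assume "i < dim_vec w"
  then have "i < n" using assms by simp
  then show "v $ i = w $ i" using assms dual B_sym by metis
qed (use assms in auto)

lemma primitive_imp_B_eq_1:
  assumes "v \<in> V" "\<not> vdvd ell v"
  obtains z where "z \<in> V" "B v z = 1"
proof -
  from assms obtain i where i: "i < n" "\<not> ell dvd v $ i" by (auto simp: vdvd_def)
  then obtain a where "v $ i * a = 1" by (metis padic_unit_iff dvdE)
  with i assms show ?thesis
    by (intro that[of "a \<cdot>\<^sub>v dual i"]) (auto simp: B_simps dual B_sym[of v] mult.commute)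
qed

section \<open>Isometries\<close>

lemma OV_D: "g \<in> OV \<Longrightarrow> g \<in> carrier_mat n n" "g \<in> OV \<Longrightarrow> v \<in> V \<Longrightarrow> Q (g *\<^sub>v v) = Q v"
  by (auto simp: orthogonal_group_def)

lemma OV_carrier: "g \<in> OV \<Longrightarrow> v \<in> V \<Longrightarrow> g *\<^sub>v v \<in> V"
  by (auto simp: orthogonal_group_def)

lemma OV_B: "g \<in> OV \<Longrightarrow> v \<in> V \<Longrightarrow> w \<in> V \<Longrightarrow> B (g *\<^sub>v v) (g *\<^sub>v w) = B v w"
  by (simp add: polar_def OV_D(2) mult_add_distrib_mat_vec[OF OV_D(1), symmetric] del: mult_add_distrib_mat_vec)

text \<open>Invertibility comes from nondegeneracy: \<open>A\<close> has an adjoint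
  \<open>F\<close>, and \<open>F (A *\<^sub>v x) = x\<close> because \<open>A\<close> preserves
  \<open>B\<close>.\<close>

lemma OV_I:
  assumes A: "A \<in> carrier_mat n n" and Q: "\<And>v. v \<in> V \<Longrightarrow> Q (A *\<^sub>v v) = Q v"
  shows "A \<in> OV"
proof -
  have AB: "B (A *\<^sub>v v) (A *\<^sub>v w) = B v w" if "v \<in> V" "w \<in> V" for v w
    unfolding polar_def mult_add_distrib_mat_vec[OF A that, symmetric] using that by (simp add: Q)
  have "\<exists>z. z \<in> V \<and> (\<forall>x\<in>V. B z x = B y (A *\<^sub>v x))" if "y \<in> V" for y
  proof -
    have "linear_functional n (\<lambda>x. B y (A *\<^sub>v x))"
      using A that by (auto simp: linear_functional_def mult_add_distrib_mat_vec[OF A] mult_mat_vec_smult[OF A] B_simps)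
    then show ?thesis by (metis representing_vector)
  qed
  then obtain F where F: "\<And>y. y \<in> V \<Longrightarrow> F y \<in> V" "\<And>y x. y \<in> V \<Longrightarrow> x \<in> V \<Longrightarrow> B (F y) x = B y (A *\<^sub>v x)"
    by metis
  obtain C where C: "C \<in> carrier_mat n n" "\<And>x. x \<in> V \<Longrightarrow> C *\<^sub>v x = F x"
  proof (rule linear_map_matrix[of n F])
    show "F (x + y) = F x + F y" if "x \<in> V" "y \<in> V" for x y
      using that A by (intro eq_vecI_B) (auto simp: F B_simps)
    show "F (a \<cdot>\<^sub>v x) = a \<cdot>\<^sub>v F x" if "x \<in> V" for a x
      using that A by (intro eq_vecI_B) (auto simp: F B_simps)
  qed (auto simp: F)
  have "C * A = 1\<^sub>m n"
  proof (rule mat_eqI_mult_vec)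
    fix x assume x: "x \<in> V"
    have "F (A *\<^sub>v x) = x"
      using x A by (intro eq_vecI_B) (auto simp: F AB)
    then show "(C * A) *\<^sub>v x = 1\<^sub>m n *\<^sub>v x"
      using x A C by (simp add: assoc_mult_mat_vec[of C n n A n])
  qed (use A C in auto)
  then have "invertible_mat A" using left_inverse_imp_invertible_mat A C by blast
  then show ?thesis using A Q by (simp add: orthogonal_group_def)
qed

lemma OV_one: "1\<^sub>m n \<in> OV"
  by (rule OV_I) auto

lemma OV_mult: "g \<in> OV \<Longrightarrow> h \<in> OV \<Longrightarrow> g * h \<in> OV"
  by (rule OV_I[OF mult_carrier_mat[OF OV_D(1) OV_D(1)]])
    (auto simp: OV_D(2) assoc_mult_mat_vec[OF OV_D(1) OV_D(1)] OV_carrier)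

lemma mult_vec_assoc: "g \<in> OV \<Longrightarrow> h \<in> OV \<Longrightarrow> v \<in> V \<Longrightarrow> (g * h) *\<^sub>v v = g *\<^sub>v (h *\<^sub>v v)"
  using assoc_mult_mat_vec OV_D(1) by blast

lemma OV_inverse:
  assumes g: "g \<in> OV"
  obtains h where "h \<in> OV" "h * g = 1\<^sub>m n" "g * h = 1\<^sub>m n"
proof -
  from g have gc: "g \<in> carrier_mat n n" "invertible_mat g" by (auto simp: orthogonal_group_def)
  then obtain h where h: "g * h = 1\<^sub>m n" "h * g = 1\<^sub>m (dim_row h)"
    unfolding invertible_mat_def inverts_mat_def by auto
  from h gc have "dim_row h = n" "dim_col h = n"
    by (metis index_mult_mat(2,3) index_one_mat(2,3) carrier_matD(1,2))+
  then have hc: "h \<in> carrier_mat n n" by auto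
  have "h \<in> OV"
  proof (rule OV_I[OF hc])
    fix v assume v: "v \<in> V"
    have "g *\<^sub>v (h *\<^sub>v v) = v"
      using v hc gc h by (simp flip: assoc_mult_mat_vec[of g n n h n])
    then show "Q (h *\<^sub>v v) = Q v" using OV_D(2)[OF g, of "h *\<^sub>v v"] hc v by simp
  qed
  then show ?thesis using that h hc by auto
qed

section \<open>Congruence of matrices modulo powers of \<open>ell\<close>\<close>

text \<open>Tested on vectors instead of entries, so that products can be treated through their
  action on \<open>V\<close>.\<close>

definition mcong :: "nat \<Rightarrow> 'p padic_int mat \<Rightarrow> 'p padic_int mat \<Rightarrow> bool" where
  "mcong e g h \<longleftrightarrow> (\<forall>v\<in>V. vdvd (ell ^ e) (g *\<^sub>v v - h *\<^sub>v v))"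

lemma reduce_mat_eq_iff:
  assumes "g \<in> carrier_mat n n" "h \<in> carrier_mat n n"
  shows "reduce_mat e g = reduce_mat e h \<longleftrightarrow> mcong e g h"
proof
  assume eq: "reduce_mat e g = reduce_mat e h"
  have gh: "ell ^ e dvd g $$ (i, j) - h $$ (i, j)" if "i < n" "j < n" for i j
    using arg_cong[OF eq, of "\<lambda>M. M $$ (i, j)"] that assms
    by (simp add: reduce_mat_def residue_padic_eq_iff)
  show "mcong e g h"
    unfolding mcong_def vdvd_def
  proof (intro ballI allI impI)
    fix v i assume v: "v \<in> V" and i: "i < dim_vec (g *\<^sub>v v - h *\<^sub>v v)"
    have "(g *\<^sub>v v - h *\<^sub>v v) $ i = (\<Sum>j<n. (g $$ (i, j) - h $$ (i, j)) * v $ j)"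
      using v i assms by (simp add: scalar_prod_def atLeast0LessThan sum_subtractf left_diff_distrib)
    also have "ell ^ e dvd \<dots>" using i assms gh by (intro dvd_sum dvd_mult2) auto
    finally show "ell ^ e dvd (g *\<^sub>v v - h *\<^sub>v v) $ i" .
  qed
next
  assume gh: "mcong e g h"
  show "reduce_mat e g = reduce_mat e h"
  proof (rule eq_matI)
    fix i j assume "i < dim_row (reduce_mat e h)" "j < dim_col (reduce_mat e h)"
    then have ij: "i < n" "j < n" using assms by (auto simp: reduce_mat_def)
    have "vdvd (ell ^ e) (g *\<^sub>v unit_vec n j - h *\<^sub>v unit_vec n j)"
      using gh by (simp add: mcong_def)
    then have "ell ^ e dvd (g *\<^sub>v unit_vec n j - h *\<^sub>v unit_vec n j) $ i"
      using ij assms unfolding vdvd_def by auto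
    then show "reduce_mat e g $$ (i, j) = reduce_mat e h $$ (i, j)"
      using ij assms by (simp add: reduce_mat_def residue_padic_eq_iff scalar_prod_right_unit)
  qed (use assms in \<open>auto simp: reduce_mat_def\<close>)
qed

lemma mcong_refl [simp]: "g \<in> carrier_mat n n \<Longrightarrow> mcong e g g"
  using reduce_mat_eq_iff[of g g e] by simp

lemma mcong_sym: "g \<in> carrier_mat n n \<Longrightarrow> h \<in> carrier_mat n n \<Longrightarrow> mcong e g h \<Longrightarrow> mcong e h g"
  using reduce_mat_eq_iff[of g h e] reduce_mat_eq_iff[of h g e] by simp

lemma mcong_trans:
  "f \<in> carrier_mat n n \<Longrightarrow> g \<in> carrier_mat n n \<Longrightarrow> h \<in> carrier_mat n n \<Longrightarrow>
    mcong e f g \<Longrightarrow> mcong e g h \<Longrightarrow> mcong e f h"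
  using reduce_mat_eq_iff[of f g e] reduce_mat_eq_iff[of g h e] reduce_mat_eq_iff[of f h e] by simp

lemma mcong_le: "mcong e g h \<Longrightarrow> e' \<le> e \<Longrightarrow> mcong e' g h"
  unfolding mcong_def using vdvd_trans le_imp_power_dvd by blast

lemma mcong_mult_right:
  assumes "mcong e g h" "g \<in> OV" "h \<in> OV" "k \<in> OV"
  shows "mcong e (g * k) (h * k)"
  using assms by (auto simp: mcong_def mult_vec_assoc OV_carrier)

lemma mcong_mult_left:
  assumes "mcong e g h" "g \<in> OV" "h \<in> OV" "k \<in> OV"
  shows "mcong e (k * g) (k * h)"
  unfolding mcong_def
proof
  fix v assume v: "v \<in> V"
  have "vdvd (ell ^ e) (k *\<^sub>v (g *\<^sub>v v - h *\<^sub>v v))"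
    using assms v by (intro vdvd_mult_mat_vec[OF OV_D(1)]) (auto simp: mcong_def OV_carrier)
  also have "k *\<^sub>v (g *\<^sub>v v - h *\<^sub>v v) = (k * g) *\<^sub>v v - (k * h) *\<^sub>v v"
    using assms v by (simp add: mult_minus_distrib_mat_vec[OF OV_D(1)] mult_vec_assoc OV_carrier)
  finally show "vdvd (ell ^ e) ((k * g) *\<^sub>v v - (k * h) *\<^sub>v v)" .
qed

end

section \<open>Products of two reflections\<close>

lemma card_eq_2_if_even: "even CARD('p::prime_card) \<Longrightarrow> CARD('p) = 2"
  using primes_dvd_imp_eq[OF two_is_prime_nat prime_card[where ?'a = 'p]] by simp

lemma four_ell_dvd_odd:
  assumes "odd CARD('p)" "ell dvd (x :: 'p::prime_card padic_int)"
  shows "4 * ell dvd x"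
proof -
  obtain a where a: "2 * a = (1 :: 'p padic_int)" using ell_odd_unit_2[OF assms(1)] by (metis dvdE)
  obtain y where "x = ell * y" using assms(2) ..
  moreover have "4 * ell * (y * a * a) = ell * y * ((2 * a) * (2 * a))" by (simp add: algebra_simps)
  ultimately have "x = 4 * ell * (y * a * a)" by (simp add: a)
  then show ?thesis by (rule dvdI)
qed

text \<open>The exponent 3 comes from \<open>ell = 2\<close>, where
  \<open>4 * ell = ell ^ 3\<close>; for odd \<open>ell\<close> the 4 is a unit.\<close>

lemma four_ell_dvd_power:
  assumes "3 \<le> f"
  shows "4 * ell dvd (ell ^ f :: 'p::prime_card padic_int)"
proof (cases "odd CARD('p)")
  case True
  then show ?thesis using assms by (intro four_ell_dvd_odd dvd_power) auto
next
  case False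
  then have "(ell :: 'p padic_int) = 2" using card_eq_2_if_even[where ?'p = 'p] by simp
  then have "4 * ell = (ell ^ 3 :: 'p padic_int)" by simp
  also have "\<dots> dvd ell ^ f" using assms by (rule le_imp_power_dvd)
  finally show ?thesis .
qed

text \<open>One matrix entry of the product of reflections in \<open>double_reflection\<close>:
  \<open>v\<close> and \<open>w\<close> stand for entries of the two vectors, \<open>X\<close> and
  \<open>Y\<close> for the pairings of a unit vector with them, \<open>b\<close> for
  \<open>B v w\<close>, \<open>s\<close> for \<open>Q w\<close>, and \<open>q\<close>,
  \<open>q * r\<close> for the norms of the two reflection vectors.\<close>

lemma reflection_product_identity:
  fixes q :: "'a::field"
  assumes "q \<noteq> 0" "r \<noteq> 0" "r = 1 + e * b + e\<^sup>2 * q * s"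
  shows "v * ((X + e * q * Y) / (q * r)) * ((2 * q + e * q * b) / q)
      - (X + e * q * Y) / (q * r) * (v + e * q * w) - X / q * v
    = (e * (1 + e * b) * Y - e\<^sup>2 * s * X) / r * v - (e * X + e\<^sup>2 * q * Y) / r * w" (is "?L = ?R")
proof -
  have "?L * (q * r) = v * (X + e * q * Y) * (2 + e * b) - (X + e * q * Y) * (v + e * q * w) - X * r * v"
    using assms(1,2) by (simp add: field_simps)
  also have "\<dots> = q * ((e * (1 + e * b) * Y - e\<^sup>2 * s * X) * v - (e * X + e\<^sup>2 * q * Y) * w)"
    unfolding assms(3) by (simp add: algebra_simps power2_eq_square)
  also have "\<dots> = ?R * (q * r)"
    using assms(1,2) by (simp add: field_simps)
  finally show ?thesis using assms(1,2) by simp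
qed

lemma sum_indicator_mult:
  fixes f :: "nat \<Rightarrow> 'a::comm_ring_1"
  shows "(\<Sum>l<n. (if i = l then 1 else 0) * f l) = (if i < n then f i else 0)"
    and "(\<Sum>l<n. (if l = i then 1 else 0) * f l) = (if i < n then f i else 0)"
  by (auto simp: if_distrib[of "\<lambda>x. x * _"] cong: if_cong)

context quadratic_space
begin

section \<open>Factorizations into reflections with square product of norms\<close>

definition spin :: "'p padic_int mat \<Rightarrow> bool" where
  "spin g \<longleftrightarrow> (\<exists>vs. set vs \<subseteq> {v \<in> V. Q v \<noteq> 0} \<and>
     map_mat to_fract g = foldr (*) (map (reflection n Q) vs) (1\<^sub>m n) \<and>
     (\<exists>s :: 'p padic. s \<noteq> 0 \<and> to_fract (\<Prod>v\<leftarrow>vs. - Q v) = s\<^sup>2))"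

lemma one_in_neg_spinor_norm_iff: "1 \<in> neg_spinor_norm n Q g \<longleftrightarrow> spin g"
  by (simp add: neg_spinor_norm_def spin_def)

lemma reflection_carrier [simp]: "reflection n Q v \<in> carrier_mat n n"
  by (simp add: reflection_def)

lemma foldr_reflection_carrier: "foldr (*) (map (reflection n Q) vs) (1\<^sub>m n) \<in> carrier_mat n n"
  by (induction vs) (auto intro!: mult_carrier_mat)

lemma foldr_reflection_append:
  "foldr (*) (map (reflection n Q) (vs @ ws)) (1\<^sub>m n)
    = foldr (*) (map (reflection n Q) vs) (1\<^sub>m n) * foldr (*) (map (reflection n Q) ws) (1\<^sub>m n)"
proof (induction vs)
  case Nil
  show ?case using left_mult_one_mat[OF foldr_reflection_carrier] by simp
next
  case (Cons v vs)
  then show ?case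
    using assoc_mult_mat[OF reflection_carrier[of v] foldr_reflection_carrier foldr_reflection_carrier]
    by simp
qed

lemma spin_one: "spin (1\<^sub>m n)"
  unfolding spin_def by (rule exI[of _ "[]"]) (auto simp: to_fract_hom.mat_hom_one intro!: exI[of _ 1])

lemma spin_mult:
  assumes "spin g" "spin h" "g \<in> carrier_mat n n" "h \<in> carrier_mat n n"
  shows "spin (g * h)"
proof -
  from assms(1) obtain vs s where vs: "set vs \<subseteq> {v \<in> V. Q v \<noteq> 0}"
    "map_mat to_fract g = foldr (*) (map (reflection n Q) vs) (1\<^sub>m n)"
    "s \<noteq> 0" "to_fract (\<Prod>v\<leftarrow>vs. - Q v) = s\<^sup>2" unfolding spin_def by auto
  from assms(2) obtain ws t where ws: "set ws \<subseteq> {v \<in> V. Q v \<noteq> 0}"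
    "map_mat to_fract h = foldr (*) (map (reflection n Q) ws) (1\<^sub>m n)"
    "t \<noteq> 0" "to_fract (\<Prod>v\<leftarrow>ws. - Q v) = t\<^sup>2" unfolding spin_def by auto
  have "to_fract (\<Prod>v\<leftarrow>vs @ ws. - Q v) = (s * t)\<^sup>2"
    using vs(4) ws(4) by (simp add: power_mult_distrib)
  moreover have "map_mat to_fract (g * h) = foldr (*) (map (reflection n Q) (vs @ ws)) (1\<^sub>m n)"
    unfolding to_fract_hom.mat_hom_mult[OF assms(3,4)] foldr_reflection_append vs(2) ws(2) ..
  ultimately show ?thesis
    unfolding spin_def using vs(1,3) ws(1,3) by (intro exI[of _ "vs @ ws"]) (auto intro!: exI[of _ "s * t"])
qed

lemma reflection_mult_index:
  assumes v: "v \<in> V" and v': "v' \<in> V" and ij: "i < n" "j < n"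
  shows "(reflection n Q v * reflection n Q v') $$ (i, j)
    = (if i = j then 1 else 0)
      + (to_fract (v $ i) * (to_fract (B (unit_vec n j) v') / to_fract (Q v')) * (to_fract (B v' v) / to_fract (Q v))
      - to_fract (B (unit_vec n j) v') / to_fract (Q v') * to_fract (v' $ i)
      - to_fract (B (unit_vec n j) v) / to_fract (Q v) * to_fract (v $ i))"
proof -
  let ?c = "\<lambda>l. to_fract (B (unit_vec n l) v) / to_fract (Q v)"
  let ?d = "to_fract (B (unit_vec n j) v') / to_fract (Q v')"
  let ?\<delta> = "\<lambda>i j. if i = j then 1 else (0 :: 'p padic)"
  have "(reflection n Q v * reflection n Q v') $$ (i, j)
    = (\<Sum>l<n. (?\<delta> i l - ?c l * to_fract (v $ i)) * (?\<delta> l j - ?d * to_fract (v' $ l)))"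
    using ij by (simp add: reflection_def times_mat_def scalar_prod_def atLeast0LessThan)
  also have "\<dots> = (\<Sum>l<n. ?\<delta> i l * ?\<delta> l j) - (\<Sum>l<n. ?\<delta> i l * (?d * to_fract (v' $ l)))
      - (\<Sum>l<n. ?\<delta> l j * (?c l * to_fract (v $ i))) + (\<Sum>l<n. to_fract (v $ i) * ?d * (?c l * to_fract (v' $ l)))"
    by (simp add: algebra_simps sum.distrib sum_subtractf)
  also have "(\<Sum>l<n. ?\<delta> i l * ?\<delta> l j) = ?\<delta> i j"
    using ij by (simp only: sum_indicator_mult if_True)
  also have "(\<Sum>l<n. ?\<delta> i l * (?d * to_fract (v' $ l))) = ?d * to_fract (v' $ i)"
    using ij by (simp only: sum_indicator_mult if_True)
  also have "(\<Sum>l<n. ?\<delta> l j * (?c l * to_fract (v $ i))) = ?c j * to_fract (v $ i)"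
    using ij by (simp only: sum_indicator_mult if_True)
  also have "(\<Sum>l<n. to_fract (v $ i) * ?d * (?c l * to_fract (v' $ l)))
      = to_fract (v $ i) * ?d * (to_fract (B v' v) / to_fract (Q v))"
  proof -
    \<comment> \<open>Expanding \<open>v'\<close> in unit vectors identifies the contraction over
      the middle index with a pairing.\<close>
    have "B v' v = (\<Sum>l<n. v' $ l * B v (unit_vec n l))"
      using linear_functional_expand[OF linear_functional_B[OF v] v'] B_sym[OF v v'] by simp
    also have "\<dots> = (\<Sum>l<n. B (unit_vec n l) v * v' $ l)"
      by (intro sum.cong refl) (use v in \<open>simp add: B_sym[of v] mult.commute\<close>)
    finally have "to_fract (B v' v) = (\<Sum>l<n. to_fract (B (unit_vec n l) v) * to_fract (v' $ l))"
      by (simp add: to_fract_sum)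
    then show ?thesis
      by (simp add: sum_divide_distrib sum_distrib_left)
  qed
  finally show ?thesis by simp
qed

text \<open>The skew endomorphism attached to a bivector, an element of the Lie algebra of the
  orthogonal group: \<open>B (wedge v w x) y\<close> is alternating in \<open>x\<close> and
  \<open>y\<close>. It is the first-order term of \<open>double_reflection\<close>.\<close>

definition wedge :: "'p padic_int vec \<Rightarrow> 'p padic_int vec \<Rightarrow> 'p padic_int vec \<Rightarrow> 'p padic_int vec" where
  "wedge v w x = B x w \<cdot>\<^sub>v v - B x v \<cdot>\<^sub>v w"

lemma wedge_carrier [simp]: "v \<in> V \<Longrightarrow> w \<in> V \<Longrightarrow> wedge v w x \<in> V"
  by (simp add: wedge_def)

text \<open>
  The map \<open>k\<close> is the product of the reflections in \<open>v\<close> and \<open>v + e Q(v) w\<close>. The factor \<open>Q(v)\<close> makes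
  it integral even when the two reflections are not, and the two reflection vectors have the ratio
  \<open>1 + e B(v,w) + e\<^sup>2 Q(v) Q(w)\<close> of norms.
\<close>

lemma double_reflection:
  assumes v: "v \<in> V" and w: "w \<in> V" and q: "Q v \<noteq> 0"
    and sq: "4 * ell dvd e * B v w + e\<^sup>2 * Q v * Q w"
  obtains k \<sigma> where "k \<in> OV" "spin k" "(1 + e * B v w + e\<^sup>2 * Q v * Q w) * \<sigma> = 1"
    "\<And>x. x \<in> V \<Longrightarrow> k *\<^sub>v x = x + ((e * (1 + e * B v w) * B x w - e\<^sup>2 * Q w * B x v) * \<sigma>) \<cdot>\<^sub>v v
       - ((e * B x v + e\<^sup>2 * Q v * B x w) * \<sigma>) \<cdot>\<^sub>v w"
    "\<And>x. x \<in> V \<Longrightarrow> vdvd (e\<^sup>2) (k *\<^sub>v x - (x + e \<cdot>\<^sub>v wedge v w x))"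
proof -
  let ?b = "B v w" and ?s = "Q w" and ?q = "Q v"
  define r where "r = 1 + e * ?b + e\<^sup>2 * ?q * ?s"
  obtain y where y: "e * ?b + e\<^sup>2 * ?q * ?s = 4 * ell * y" using sq ..
  have r4: "r = 1 + 4 * ell * y" using y by (simp add: r_def)
  obtain t where t: "r = t\<^sup>2" using one_plus_4_ell_square[of y] r4 by metis
  have "\<not> ell dvd r"
  proof
    assume "ell dvd r"
    moreover have "ell dvd ell * (4 * y)" by simp
    ultimately have "ell dvd r - ell * (4 * y)" by (rule dvd_diff)
    then show False by (simp add: r4 algebra_simps)
  qed
  then obtain \<sigma> where \<sigma>: "r * \<sigma> = 1" by (metis padic_unit_iff dvdE)
  then have r0: "r \<noteq> 0" by auto
  define a where "a x = (e * (1 + e * ?b) * B x w - e\<^sup>2 * ?s * B x v) * \<sigma>" for x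
  define c where "c x = (e * B x v + e\<^sup>2 * ?q * B x w) * \<sigma>" for x
  obtain k where k: "k \<in> carrier_mat n n" "\<And>x. x \<in> V \<Longrightarrow> k *\<^sub>v x = x + a x \<cdot>\<^sub>v v - c x \<cdot>\<^sub>v w"
  proof (rule linear_map_matrix[of n "\<lambda>x. x + a x \<cdot>\<^sub>v v - c x \<cdot>\<^sub>v w"])
    fix x y z assume x: "x \<in> V" and y: "y \<in> V"
    show "x + y + a (x + y) \<cdot>\<^sub>v v - c (x + y) \<cdot>\<^sub>v w
      = x + a x \<cdot>\<^sub>v v - c x \<cdot>\<^sub>v w + (y + a y \<cdot>\<^sub>v v - c y \<cdot>\<^sub>v w)"
      using x y v w by (intro eq_vecI) (auto simp: a_def c_def B_simps algebra_simps)
    show "z \<cdot>\<^sub>v x + a (z \<cdot>\<^sub>v x) \<cdot>\<^sub>v v - c (z \<cdot>\<^sub>v x) \<cdot>\<^sub>v w = z \<cdot>\<^sub>v (x + a x \<cdot>\<^sub>v v - c x \<cdot>\<^sub>v w)"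
      using x v w by (intro eq_vecI) (auto simp: a_def c_def B_simps algebra_simps)
  qed (use v w in auto)
  have "k \<in> OV"
  proof (rule OV_I[OF k(1)])
    fix x assume x: "x \<in> V"
    let ?X = "B x v" and ?Y = "B x w"
    have "Q (k *\<^sub>v x) = Q (x + a x \<cdot>\<^sub>v v + (- c x) \<cdot>\<^sub>v w)"
      unfolding k(2)[OF x] by (rule arg_cong[of _ _ Q]) (use x v w in auto)
    also have "\<dots> = Q x + ((a x)\<^sup>2 * ?q + (c x)\<^sup>2 * ?s + a x * ?X - c x * ?Y - a x * c x * ?b)"
      using x v w by (simp add: Q_add Q_smult B_simps algebra_simps)
    also have "(a x)\<^sup>2 * ?q + (c x)\<^sup>2 * ?s + a x * ?X - c x * ?Y - a x * c x * ?b = 0"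
    proof -
      define A C where "A = e * (1 + e * ?b) * ?Y - e\<^sup>2 * ?s * ?X" and "C = e * ?X + e\<^sup>2 * ?q * ?Y"
      have "(a x)\<^sup>2 * ?q + (c x)\<^sup>2 * ?s + a x * ?X - c x * ?Y - a x * c x * ?b
        = \<sigma>\<^sup>2 * (A\<^sup>2 * ?q + C\<^sup>2 * ?s - A * C * ?b) + \<sigma> * (A * ?X - C * ?Y)"
        unfolding a_def c_def A_def[symmetric] C_def[symmetric]
        by (simp add: algebra_simps power2_eq_square)
      \<comment> \<open>Inserting \<open>r * \<sigma> = 1\<close> into the linear part makes
        everything a multiple of \<open>\<sigma>\<^sup>2\<close>; what remains is a polynomial
        identity without \<open>\<sigma>\<close>. The same insertion proves the two coefficient
        estimates further down.\<close>
      also have "\<dots> = \<sigma>\<^sup>2 * (A\<^sup>2 * ?q + C\<^sup>2 * ?s - A * C * ?b) + \<sigma> * (r * \<sigma>) * (A * ?X - C * ?Y)"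
        by (simp add: \<sigma>)
      also have "\<dots> = \<sigma>\<^sup>2 * (A\<^sup>2 * ?q + C\<^sup>2 * ?s - A * C * ?b + r * (A * ?X - C * ?Y))"
        by (simp add: algebra_simps power2_eq_square)
      also have "A\<^sup>2 * ?q + C\<^sup>2 * ?s - A * C * ?b + r * (A * ?X - C * ?Y) = 0"
        unfolding A_def C_def r_def by (simp add: algebra_simps power2_eq_square)
      finally show ?thesis by simp
    qed
    finally show "Q (k *\<^sub>v x) = Q x" by simp
  qed
  moreover have "spin k"
  proof -
    define v' where "v' = v + (e * ?q) \<cdot>\<^sub>v w"
    have v': "v' \<in> V" using v w by (simp add: v'_def)
    have Qv': "Q v' = ?q * r"
      using v w by (simp add: v'_def Q_add Q_smult B_simps r_def algebra_simps power2_eq_square)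
    have "map_mat to_fract k = reflection n Q v * reflection n Q v'"
    proof (rule eq_matI)
      fix i j assume "i < dim_row (reflection n Q v * reflection n Q v')"
        "j < dim_col (reflection n Q v * reflection n Q v')"
      then have ij: "i < n" "j < n" by (auto simp: reflection_def)
      let ?X = "B (unit_vec n j) v" and ?Y = "B (unit_vec n j) w"
      have "k $$ (i, j) = (k *\<^sub>v unit_vec n j) $ i"
        using k(1) ij by (simp add: scalar_prod_right_unit)
      also have "\<dots> = (if i = j then 1 else 0) + a (unit_vec n j) * v $ i - c (unit_vec n j) * w $ i"
        using ij v w by (simp add: k(2))
      finally have kij: "to_fract (k $$ (i, j)) = (if i = j then 1 else 0)
        + (to_fract (a (unit_vec n j)) * to_fract (v $ i) - to_fract (c (unit_vec n j)) * to_fract (w $ i))"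
        by simp
      let ?T = "to_fract :: 'p padic_int \<Rightarrow> 'p padic"
      have \<sigma>': "?T \<sigma> = 1 / ?T r"
        using arg_cong[OF \<sigma>, of ?T] r0 by (simp add: field_simps)
      have B1: "B (unit_vec n j) v' = ?X + e * ?q * ?Y" and B2: "B v' v = 2 * ?q + e * ?q * ?b"
        using v w by (simp_all add: v'_def B_simps B_self B_sym[of w v] mult.assoc)
      have v'i: "v' $ i = v $ i + e * ?q * w $ i" using v w ij by (simp add: v'_def)
      have r': "?T r = 1 + ?T e * ?T ?b + (?T e)\<^sup>2 * ?T ?q * ?T ?s"
        by (simp add: r_def power2_eq_square)
      have "?T (v $ i) * ((?T ?X + ?T e * ?T ?q * ?T ?Y) / (?T ?q * ?T r)) * ((2 * ?T ?q + ?T e * ?T ?q * ?T ?b) / ?T ?q)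
          - (?T ?X + ?T e * ?T ?q * ?T ?Y) / (?T ?q * ?T r) * (?T (v $ i) + ?T e * ?T ?q * ?T (w $ i)) - ?T ?X / ?T ?q * ?T (v $ i)
        = (?T e * (1 + ?T e * ?T ?b) * ?T ?Y - (?T e)\<^sup>2 * ?T ?s * ?T ?X) / ?T r * ?T (v $ i)
          - (?T e * ?T ?X + (?T e)\<^sup>2 * ?T ?q * ?T ?Y) / ?T r * ?T (w $ i)"
        by (rule reflection_product_identity) (use q r0 r' in auto)
      moreover have "?T 2 = 2" using to_fract_add[of "1 :: 'p padic_int" 1] by simp
      ultimately show "map_mat to_fract k $$ (i, j) = (reflection n Q v * reflection n Q v') $$ (i, j)"
        unfolding reflection_mult_index[OF v v' ij] Qv' B1 B2 v'i
        using k(1) ij by (simp add: kij a_def c_def \<sigma>' power2_eq_square)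
    qed (use k(1) in \<open>auto simp: reflection_def\<close>)
    then have "map_mat to_fract k = foldr (*) (map (reflection n Q) [v, v']) (1\<^sub>m n)"
      using right_mult_one_mat[OF reflection_carrier[of v']] by simp
    moreover have "to_fract (\<Prod>v\<leftarrow>[v, v']. - Q v) = (to_fract (?q * t))\<^sup>2"
      by (simp add: Qv' t power2_eq_square)
    moreover have "t \<noteq> 0" using r0 t by auto
    ultimately show ?thesis
      unfolding spin_def using v v' q r0 Qv'
      by (intro exI[of _ "[v, v']"] conjI exI[of _ "to_fract (?q * t)"]) auto
  qed
  moreover have "vdvd (e\<^sup>2) (k *\<^sub>v x - (x + e \<cdot>\<^sub>v wedge v w x))" if x: "x \<in> V" for x
  proof -
    let ?X = "B x v" and ?Y = "B x w"
    have 1: "a x - e * ?Y = e\<^sup>2 * (- \<sigma> * ?s * (?X + e * ?q * ?Y))"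
    proof -
      have "a x - e * ?Y = a x - e * ?Y * (r * \<sigma>)" by (simp add: \<sigma>)
      also have "\<dots> = e\<^sup>2 * (- \<sigma> * ?s * (?X + e * ?q * ?Y))" unfolding a_def r_def by (simp add: algebra_simps power2_eq_square)
      finally show ?thesis .
    qed
    have 2: "e * ?X - c x = e\<^sup>2 * (\<sigma> * (?b * ?X + e * ?q * ?s * ?X - ?q * ?Y))"
    proof -
      have "e * ?X - c x = e * ?X * (r * \<sigma>) - c x" by (simp add: \<sigma>)
      also have "\<dots> = e\<^sup>2 * (\<sigma> * (?b * ?X + e * ?q * ?s * ?X - ?q * ?Y))" unfolding c_def r_def by (simp add: algebra_simps power2_eq_square)
      finally show ?thesis .
    qed
    have "k *\<^sub>v x - (x + e \<cdot>\<^sub>v wedge v w x) = (a x - e * ?Y) \<cdot>\<^sub>v v + (e * ?X - c x) \<cdot>\<^sub>v w"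
      using x v w by (intro eq_vecI) (auto simp: k wedge_def algebra_simps)
    also have "vdvd (e\<^sup>2) \<dots>"
      unfolding 1 2 smult_smult_assoc[symmetric] using v w by (intro vdvd_add[of _ n]) auto
    finally show ?thesis .
  qed
  ultimately show ?thesis using that[of k \<sigma>] \<sigma> k(2) unfolding r_def a_def c_def by blast
qed

end

lemma vdvd_smult_left: "c dvd a \<Longrightarrow> vdvd c (a \<cdot>\<^sub>v v)"
  by (simp add: vdvd_def)

lemma vec_diff_triangle:
  "x \<in> carrier_vec n \<Longrightarrow> y \<in> carrier_vec n \<Longrightarrow> z \<in> carrier_vec n \<Longrightarrow>
    x - y = (x - z) + (z - y :: 'a::comm_ring_1 vec)"
  by auto

lemma vec_add_diff_cancel:
  "x \<in> carrier_vec n \<Longrightarrow> y \<in> carrier_vec n \<Longrightarrow> x + (y - x) = (y :: 'a::comm_ring_1 vec)"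
  "x \<in> carrier_vec n \<Longrightarrow> y \<in> carrier_vec n \<Longrightarrow> x + y - x = (y :: 'a::comm_ring_1 vec)"
  by auto

lemma vec_add_smult_diff:
  "x \<in> carrier_vec n \<Longrightarrow> a \<in> carrier_vec n \<Longrightarrow> b \<in> carrier_vec n \<Longrightarrow>
    x + c \<cdot>\<^sub>v a - (x + c \<cdot>\<^sub>v b) = c \<cdot>\<^sub>v (a - b :: 'a::comm_ring_1 vec)"
  by (auto simp: algebra_simps)

context quadratic_space
begin

section \<open>Isometries prescribed to first order\<close>

lemma B_zero_left: "z \<in> V \<Longrightarrow> B (0\<^sub>v n) z = 0"
proof -
  assume z: "z \<in> V"
  have "0\<^sub>v n = (0 :: 'p padic_int) \<cdot>\<^sub>v 0\<^sub>v n" by auto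
  then show ?thesis using B_smult_left[of "0\<^sub>v n" z 0] z by simp
qed

lemma wedge_cong:
  assumes car: "v \<in> V" "v' \<in> V" "w \<in> V" "w' \<in> V" "x \<in> V"
    and dvd: "vdvd ell (v - v')" "vdvd ell (w - w')"
  shows "vdvd ell (wedge v w x - wedge v' w' x)"
proof -
  have "wedge v w x - wedge v' w' x
    = B x (w - w') \<cdot>\<^sub>v v + B x w' \<cdot>\<^sub>v (v - v') - (B x (v - v') \<cdot>\<^sub>v w + B x v' \<cdot>\<^sub>v (w - w'))"
    using car by (intro eq_vecI) (auto simp: wedge_def B_simps algebra_simps)
  also have "vdvd ell \<dots>"
  proof -
    have "vdvd ell (B x (w - w') \<cdot>\<^sub>v v)" "vdvd ell (B x (v - v') \<cdot>\<^sub>v w)"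
      using car dvd by (auto intro!: vdvd_smult_left vdvd_imp_dvd_B')
    moreover have "vdvd ell (B x w' \<cdot>\<^sub>v (v - v'))" "vdvd ell (B x v' \<cdot>\<^sub>v (w - w'))"
      using dvd by (auto intro!: vdvd_smult)
    ultimately have "vdvd ell (B x (w - w') \<cdot>\<^sub>v v + B x w' \<cdot>\<^sub>v (v - v'))"
      "vdvd ell (B x (v - v') \<cdot>\<^sub>v w + B x v' \<cdot>\<^sub>v (w - w'))"
      using car by (auto intro!: vdvd_add[of _ n])
    then show ?thesis using car by (intro vdvd_diff[where n = n]) simp_all
  qed
  finally show ?thesis .
qed

text \<open>Only the reductions of \<open>v\<close> and \<open>w\<close> matter at this precision,
  so they may be exchanged for congruent vectors that satisfy the hypotheses of
  \<open>double_reflection\<close>. The quadratic error is harmless because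
  \<open>2 * j \<ge> Suc j\<close>.\<close>

lemma spin_wedge_aux:
  assumes car: "v \<in> V" "v' \<in> V" "w \<in> V" "w' \<in> V" and j: "1 \<le> j"
    and dvd: "vdvd ell (v' - v)" "vdvd ell (w' - w)"
    and q: "Q v' \<noteq> 0" and sq: "4 * ell dvd ell ^ j * B v' w' + (ell ^ j)\<^sup>2 * Q v' * Q w'"
  shows "\<exists>k\<in>OV. spin k \<and> mcong j k (1\<^sub>m n) \<and>
    (\<forall>x\<in>V. vdvd (ell ^ Suc j) (k *\<^sub>v x - (x + ell ^ j \<cdot>\<^sub>v wedge v w x)))"
proof -
  obtain k where k: "k \<in> OV" "spin k"
    "\<And>x. x \<in> V \<Longrightarrow> vdvd ((ell ^ j)\<^sup>2) (k *\<^sub>v x - (x + ell ^ j \<cdot>\<^sub>v wedge v' w' x))"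
    using double_reflection[OF car(2,4) q sq] by metis
  have le: "(ell :: 'p padic_int) ^ Suc j dvd (ell ^ j)\<^sup>2"
    unfolding power_mult[symmetric] using j by (intro le_imp_power_dvd) simp
  have main: "vdvd (ell ^ Suc j) (k *\<^sub>v x - (x + ell ^ j \<cdot>\<^sub>v wedge v w x))" if x: "x \<in> V" for x
  proof -
    have "x + ell ^ j \<cdot>\<^sub>v wedge v' w' x - (x + ell ^ j \<cdot>\<^sub>v wedge v w x)
      = ell ^ j \<cdot>\<^sub>v (wedge v' w' x - wedge v w x)"
      using car x by (intro vec_add_smult_diff) auto
    then have "k *\<^sub>v x - (x + ell ^ j \<cdot>\<^sub>v wedge v w x)
      = (k *\<^sub>v x - (x + ell ^ j \<cdot>\<^sub>v wedge v' w' x)) + ell ^ j \<cdot>\<^sub>v (wedge v' w' x - wedge v w x)"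
      using car x OV_carrier[OF k(1) x]
      by (subst vec_diff_triangle[of _ n _ "x + ell ^ j \<cdot>\<^sub>v wedge v' w' x"]) auto
    also have "vdvd (ell ^ Suc j) \<dots>"
    proof (rule vdvd_add[of _ n])
      show "vdvd (ell ^ Suc j) (k *\<^sub>v x - (x + ell ^ j \<cdot>\<^sub>v wedge v' w' x))"
        using k(3)[OF x] le by (rule vdvd_trans)
      have "vdvd (ell ^ j * ell) (ell ^ j \<cdot>\<^sub>v (wedge v' w' x - wedge v w x))"
        using wedge_cong[OF car(2,1,4,3) x dvd] by (simp add: vdvd_smult_cancel)
      then show "vdvd (ell ^ Suc j) (ell ^ j \<cdot>\<^sub>v (wedge v' w' x - wedge v w x))"
        by (simp add: mult.commute)
    qed (use car x OV_carrier[OF k(1) x] in auto)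
    finally show ?thesis .
  qed
  moreover have "mcong j k (1\<^sub>m n)"
    unfolding mcong_def
  proof
    fix x assume x: "x \<in> V"
    have "k *\<^sub>v x - 1\<^sub>m n *\<^sub>v x = (k *\<^sub>v x - (x + ell ^ j \<cdot>\<^sub>v wedge v w x)) + ell ^ j \<cdot>\<^sub>v wedge v w x"
      using car x OV_carrier[OF k(1) x] vec_add_diff_cancel(2)[of x n "ell ^ j \<cdot>\<^sub>v wedge v w x"]
      by (subst vec_diff_triangle[of _ n _ "x + ell ^ j \<cdot>\<^sub>v wedge v w x"]) auto
    also have "vdvd (ell ^ j) \<dots>"
      using car x OV_carrier[OF k(1) x] main[OF x]
      by (intro vdvd_add[of _ n]) (auto elim!: vdvd_trans)
    finally show "vdvd (ell ^ j) (k *\<^sub>v x - 1\<^sub>m n *\<^sub>v x)" .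
  qed
  ultimately show ?thesis using k by blast
qed

text \<open>The ratio of norms must be 1 modulo \<open>4 * ell\<close>. For odd \<open>ell\<close>
  this is automatic since \<open>j \<ge> 1\<close>; for \<open>ell = 2\<close> the evenness of
  \<open>B v w\<close> leaves room to correct \<open>w\<close> by a multiple of 2.\<close>

lemma spin_wedge:
  assumes v: "v \<in> V" and w: "w \<in> V" and j: "1 \<le> j" and cond: "odd CARD('p) \<or> ell dvd B v w"
  shows "\<exists>k\<in>OV. spin k \<and> mcong j k (1\<^sub>m n) \<and>
    (\<forall>x\<in>V. vdvd (ell ^ Suc j) (k *\<^sub>v x - (x + ell ^ j \<cdot>\<^sub>v wedge v w x)))"
proof (cases "vdvd ell v")
  case True
  have "vdvd (ell ^ Suc j) (1\<^sub>m n *\<^sub>v x - (x + ell ^ j \<cdot>\<^sub>v wedge v w x))" if x: "x \<in> V" for x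
  proof -
    have "1\<^sub>m n *\<^sub>v x - (x + ell ^ j \<cdot>\<^sub>v wedge v w x) = - (ell ^ j \<cdot>\<^sub>v wedge v w x)"
      using x v w by (intro eq_vecI) (auto simp: wedge_def)
    moreover have "vdvd ell (wedge v w x)"
      unfolding wedge_def using True v w x
      by (intro vdvd_diff[of _ n] vdvd_smult vdvd_smult_left[of ell "B x v"] vdvd_imp_dvd_B') auto
    then have "vdvd (ell ^ j * ell) (ell ^ j \<cdot>\<^sub>v wedge v w x)"
      by (simp add: vdvd_smult_cancel)
    ultimately show ?thesis by (simp add: mult.commute)
  qed
  then show ?thesis using OV_one spin_one by (intro bexI[of _ "1\<^sub>m n"]) auto
next
  case False
  obtain z where z: "z \<in> V" "B v z = 1" using primitive_imp_B_eq_1[OF v False] .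
  \<comment> \<open>A null vector is moved by \<open>ell\<close> times \<open>z\<close>, which gives
    \<open>Q v' = ell * (1 + ell * Q z)\<close> with a unit as second factor.\<close>
  define v' where "v' = (if Q v = 0 then v + ell \<cdot>\<^sub>v z else v)"
  have v': "v' \<in> V" using v z by (simp add: v'_def)
  have v'v: "vdvd ell (v' - v)"
  proof (cases "Q v = 0")
    case True
    have "v' - v = ell \<cdot>\<^sub>v z" using v z True by (auto simp: v'_def)
    then show ?thesis by simp
  next
    case False
    then have "v' - v = 0\<^sub>v n" using v by (simp add: v'_def)
    then show ?thesis by simp
  qed
  have q: "Q v' \<noteq> 0"
  proof (cases "Q v = 0")
    case True
    then have "Q v' = ell * (1 + ell * Q z)"
      using v z by (simp add: v'_def Q_add Q_smult B_simps power2_eq_square algebra_simps)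
    moreover have "1 + ell * Q z \<noteq> 0"
    proof
      assume "1 + ell * Q z = 0"
      then have "1 = ell * (- Q z)" by (simp add: add_eq_0_iff)
      then show False using not_ell_dvd_1[where ?'p = 'p] by (metis dvd_triv_left)
    qed
    ultimately show ?thesis by simp
  qed (simp add: v'_def)
  show ?thesis
  proof (cases "odd CARD('p)")
    case True
    show ?thesis
    proof (rule spin_wedge_aux[OF v v' w w j v'v])
      have "ell dvd ell ^ j * (B v' w + ell ^ j * Q v' * Q w)" using j by (intro dvd_mult2 dvd_power) auto
      then show "4 * ell dvd ell ^ j * B v' w + (ell ^ j)\<^sup>2 * Q v' * Q w"
        using True by (intro four_ell_dvd_odd) (auto simp: algebra_simps power2_eq_square)
    qed (use w q in auto)
  next
    case False
    then have l2: "(ell :: 'p padic_int) = 2" using card_eq_2_if_even[where ?'p = 'p] by simp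
    have "\<not> vdvd ell v'"
    proof
      assume "vdvd ell v'"
      from vdvd_diff[OF v' _ this v'v] v v' have "vdvd ell (v' - (v' - v))" by simp
      moreover have "v' - (v' - v) = v" using v v' by auto
      ultimately show False using \<open>\<not> vdvd ell v\<close> by simp
    qed
    then obtain z where z: "z \<in> V" "B v' z = 1" using primitive_imp_B_eq_1[OF v'] by blast
    have "ell dvd B v' w"
    proof -
      have "B v' w = B v w + B (v' - v) w" using v v' w by (simp add: B_simps)
      then show ?thesis using cond False vdvd_imp_dvd_B[OF v'v] v v' w by simp
    qed
    then obtain b where b: "B v' w = 2 * b" unfolding l2 ..
    \<comment> \<open>Chosen to make \<open>B v' w' = - 2 * Q v' * Q w\<close>, the value at which
      the two terms below cancel modulo 8 when \<open>j = 1\<close>.\<close>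
    define t where "t = - b - Q v' * Q w"
    define w' where "w' = w + (2 * t) \<cdot>\<^sub>v z"
    have w': "w' \<in> V" using w z by (simp add: w'_def)
    have Bw': "B v' w' = - 2 * Q v' * Q w"
      using v' w z by (simp add: w'_def B_simps b t_def algebra_simps)
    show ?thesis
    proof (rule spin_wedge_aux[OF v v' w w' j v'v _ q])
      have "w' - w = ell \<cdot>\<^sub>v (t \<cdot>\<^sub>v z)" unfolding l2 using w z by (auto simp: w'_def)
      then show "vdvd ell (w' - w)" by simp
      have "8 dvd ell ^ j * B v' w' + (ell ^ j)\<^sup>2 * Q v' * Q w'"
      \<comment> \<open>For \<open>j = 1\<close> each term is only known to be divisible by 4, but
        the sum is \<open>4 * Q v' * (Q w' - Q w)\<close> with an even difference; for larger
        \<open>j\<close> each term is divisible by 8.\<close>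
      proof (cases "j = 1")
        case True
        have "Q w' - Q w = 2 * (2 * t\<^sup>2 * Q z + t * B w z)"
          using w z by (simp add: w'_def Q_add Q_smult B_simps power2_eq_square algebra_simps)
        then have *: "Q w' = Q w + 2 * (2 * t\<^sup>2 * Q z + t * B w z)" by (simp add: algebra_simps)
        have "ell ^ j * B v' w' + (ell ^ j)\<^sup>2 * Q v' * Q w' = 8 * (Q v' * (2 * t\<^sup>2 * Q z + t * B w z))"
          unfolding True Bw' * l2 by (simp add: algebra_simps)
        then show ?thesis by simp
      next
        case False
        with j obtain i where i: "j = i + 2" by (metis One_nat_def Suc_1 add.commute le_Suc_ex nat_less_le Suc_leI)
        have "ell ^ j * B v' w' + (ell ^ j)\<^sup>2 * Q v' * Q w'
            = 8 * (2 ^ i * (- Q v' * Q w) + 2 * (2 ^ i)\<^sup>2 * Q v' * Q w')"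
          unfolding Bw' l2 i by (simp add: power_add algebra_simps power2_eq_square)
        then show ?thesis by (metis dvd_triv_left)
      qed
      then show "4 * ell dvd ell ^ j * B v' w' + (ell ^ j)\<^sup>2 * Q v' * Q w'" by (simp add: l2)
    qed
  qed
qed

section \<open>Isometries near the identity have trivial spinor norm\<close>

text \<open>The second reflection vector of \<open>double_reflection\<close> is here the midpoint of
  \<open>v\<close> and \<open>g *\<^sub>v v\<close>. Reflection in the midpoint sends
  \<open>g *\<^sub>v v\<close> to \<open>- v\<close>, reflection in \<open>v\<close> sends this to
  \<open>v\<close>, and both fix whatever is orthogonal to \<open>v\<close> and
  \<open>g *\<^sub>v v\<close>. The exponent \<open>t\<close> pays for dividing by
  \<open>2 * Q v\<close>, and \<open>f \<ge> 3\<close> makes the ratio of norms a square.\<close>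

lemma spin_move_back:
  assumes g: "g \<in> OV" and v: "v \<in> V" and q: "Q v \<noteq> 0"
    and a: "2 * Q v * a = ell ^ t" and cong: "mcong (t + f) g (1\<^sub>m n)" and f: "3 \<le> f"
  shows "\<exists>k\<in>OV. spin k \<and> mcong f k (1\<^sub>m n) \<and> k *\<^sub>v (g *\<^sub>v v) = v \<and>
    (\<forall>x\<in>V. B x v = 0 \<longrightarrow> g *\<^sub>v x = x \<longrightarrow> k *\<^sub>v x = x)"
proof -
  let ?e = "(ell :: 'p padic_int) ^ f" and ?q = "Q v"
  have gv: "g *\<^sub>v v \<in> V" using g v OV_carrier by blast
  have "vdvd (ell ^ (t + f)) (g *\<^sub>v v - v)" using cong v by (auto simp: mcong_def)
  then obtain u where u: "u \<in> V" "g *\<^sub>v v - v = ell ^ (t + f) \<cdot>\<^sub>v u"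
    using gv v by (metis vdvdE minus_carrier_vec)
  define w where "w = a \<cdot>\<^sub>v u"
  have w: "w \<in> V" using u by (simp add: w_def)
  have gv_eq: "g *\<^sub>v v = v + (2 * ?e * ?q) \<cdot>\<^sub>v w"
  proof -
    have "g *\<^sub>v v = v + (g *\<^sub>v v - v)" using vec_add_diff_cancel(1)[OF v gv] ..
    also have "(ell :: 'p padic_int) ^ (t + f) = 2 * ?e * ?q * a"
      by (simp add: power_add flip: a)
    then have "g *\<^sub>v v - v = (2 * ?e * ?q) \<cdot>\<^sub>v w" unfolding u(2) w_def by (simp add: smult_smult_assoc)
    finally show ?thesis .
  qed
  let ?b = "B v w" and ?s = "Q w"
  have sq: "4 * ell dvd ?e * ?b + ?e\<^sup>2 * ?q * ?s"
  proof -
    have "4 * ell dvd ?e * (?b + ?e * ?q * ?s)" using four_ell_dvd_power[OF f] by (rule dvd_mult2)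
    then show ?thesis by (simp add: algebra_simps power2_eq_square)
  qed
  obtain k \<sigma> where k: "k \<in> OV" "spin k" "(1 + ?e * ?b + ?e\<^sup>2 * ?q * ?s) * \<sigma> = 1"
    "\<And>x. x \<in> V \<Longrightarrow> k *\<^sub>v x = x + ((?e * (1 + ?e * ?b) * B x w - ?e\<^sup>2 * ?s * B x v) * \<sigma>) \<cdot>\<^sub>v v
       - ((?e * B x v + ?e\<^sup>2 * ?q * B x w) * \<sigma>) \<cdot>\<^sub>v w"
    "\<And>x. x \<in> V \<Longrightarrow> vdvd (?e\<^sup>2) (k *\<^sub>v x - (x + ?e \<cdot>\<^sub>v wedge v w x))"
    using double_reflection[OF v w q sq] by metis
  have e0: "?e \<noteq> 0" by simp
  \<comment> \<open>Preservation of the norm of \<open>v\<close> determines \<open>B v w\<close>; in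
    terms of \<open>\<tau>\<close> the ratio of norms becomes \<open>1 - \<tau>\<close>.\<close>
  have "Q (g *\<^sub>v v) = ?q" using g v by (simp add: OV_D)
  then have "2 * ?e * ?q * (?b + 2 * ?e * ?q * ?s) = 0"
    unfolding gv_eq using v w by (simp add: Q_add Q_smult B_simps power2_eq_square algebra_simps)
  then have b: "?b = - 2 * ?e * ?q * ?s" using e0 q by (simp add: add_eq_0_iff)
  define \<tau> where "\<tau> = ?e\<^sup>2 * ?q * ?s"
  have eb: "?e * ?b = - 2 * \<tau>" unfolding b \<tau>_def by (simp add: power2_eq_square)
  have \<sigma>: "(1 - \<tau>) * \<sigma> = 1" using k(3) unfolding eb \<tau>_def[symmetric] by simp
  have X: "B (g *\<^sub>v v) v = 2 * ?q * (1 + ?e * ?b)" and Y: "?e * B (g *\<^sub>v v) w = ?e * ?b + 4 * \<tau>"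
    unfolding gv_eq \<tau>_def using v w
    by (simp_all add: B_simps B_self B_sym[of w v] algebra_simps power2_eq_square)
  have "k *\<^sub>v (g *\<^sub>v v) = v"
  proof -
    let ?y = "g *\<^sub>v v"
    have "?e * (1 + ?e * ?b) * B ?y w - ?e\<^sup>2 * ?s * B ?y v
        = (1 + ?e * ?b) * (?e * B ?y w) - ?e\<^sup>2 * ?s * B ?y v" by (simp add: algebra_simps)
    also have "\<dots> = (1 + ?e * ?b) * (?e * ?b + 4 * \<tau>) - 2 * \<tau> * (1 + ?e * ?b)"
      unfolding X Y by (simp add: \<tau>_def algebra_simps)
    also have "\<dots> = 0" unfolding eb by (simp add: algebra_simps)
    finally have 1: "?e * (1 + ?e * ?b) * B ?y w - ?e\<^sup>2 * ?s * B ?y v = 0" .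
    have "?e * B ?y v + ?e\<^sup>2 * ?q * B ?y w = ?e * B ?y v + ?e * ?q * (?e * B ?y w)"
      by (simp add: power2_eq_square)
    also have "\<dots> = ?e * ?q * (2 * (1 + ?e * ?b) + (?e * ?b + 4 * \<tau>))"
      unfolding X Y by (simp add: algebra_simps)
    also have "\<dots> = 2 * ?e * ?q * (1 - \<tau>)" unfolding eb by (simp add: algebra_simps)
    finally have "(?e * B ?y v + ?e\<^sup>2 * ?q * B ?y w) * \<sigma> = 2 * ?e * ?q * ((1 - \<tau>) * \<sigma>)" by simp
    then have 2: "(?e * B ?y v + ?e\<^sup>2 * ?q * B ?y w) * \<sigma> = 2 * ?e * ?q" by (simp only: \<sigma> mult_1_right)
    show ?thesis
      unfolding k(4)[OF gv] 1 2 unfolding gv_eq using v w by (intro eq_vecI) auto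
  qed
  moreover have "k *\<^sub>v x = x" if x: "x \<in> V" "B x v = 0" "g *\<^sub>v x = x" for x
  proof -
    have "B x (g *\<^sub>v v) = 0" using OV_B[OF g x(1) v] x by simp
    then have "2 * ?e * ?q * B x w = 0" unfolding gv_eq using x v w by (simp add: B_simps)
    then have "B x w = 0" using e0 q by simp
    then show ?thesis using x v w by (auto simp: k(4))
  qed
  moreover have "mcong f k (1\<^sub>m n)"
    unfolding mcong_def
  proof
    fix x assume x: "x \<in> V"
    have "k *\<^sub>v x - 1\<^sub>m n *\<^sub>v x = (k *\<^sub>v x - (x + ?e \<cdot>\<^sub>v wedge v w x)) + ?e \<cdot>\<^sub>v wedge v w x"
      using v w x OV_carrier[OF k(1) x] vec_add_diff_cancel(2)[of x n "?e \<cdot>\<^sub>v wedge v w x"]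
      by (subst vec_diff_triangle[of _ n _ "x + ?e \<cdot>\<^sub>v wedge v w x"]) auto
    also have "vdvd ?e \<dots>"
      using v w x OV_carrier[OF k(1) x] k(5)[OF x]
      by (intro vdvd_add[of _ n]) (auto elim!: vdvd_trans)
    finally show "vdvd ?e (k *\<^sub>v x - 1\<^sub>m n *\<^sub>v x)" .
  qed
  ultimately show ?thesis using k(1,2) by blast
qed

definition orthogonal_family :: "'p padic_int vec list \<Rightarrow> bool" where
  "orthogonal_family xs \<longleftrightarrow> set xs \<subseteq> {v \<in> V. Q v \<noteq> 0} \<and> sorted_wrt (\<lambda>x y. B x y = 0) xs"

text \<open>A Cartan-Dieudonne argument near the identity. \<open>F\<close> collects the vectors
  already fixed; each step composes \<open>g\<close> with an isometry that restores the next vector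
  of \<open>xs\<close> and keeps \<open>F\<close>, at the price of a closer start. In the end
  \<open>g\<close> fixes a set with zero orthogonal complement, so it is the identity.\<close>

lemma spin_open_aux:
  assumes "orthogonal_family xs" "F \<subseteq> V" "\<And>x y. x \<in> F \<Longrightarrow> y \<in> set xs \<Longrightarrow> B x y = 0"
    "\<And>x. x \<in> V \<Longrightarrow> (\<And>y. y \<in> F \<union> set xs \<Longrightarrow> B x y = 0) \<Longrightarrow> x = 0\<^sub>v n"
  shows "\<exists>e. \<forall>g\<in>OV. mcong e g (1\<^sub>m n) \<longrightarrow> (\<forall>x\<in>F. g *\<^sub>v x = x) \<longrightarrow> (\<exists>h\<in>OV. spin h \<and> h * g = 1\<^sub>m n)"
  using assms
proof (induction xs arbitrary: F)
  case Nil
  have "g = 1\<^sub>m n" if g: "g \<in> OV" "\<forall>x\<in>F. g *\<^sub>v x = x" for g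
  proof (rule mat_eqI_mult_vec)
    fix x assume x: "x \<in> V"
    have gx: "g *\<^sub>v x \<in> V" using g x OV_carrier by blast
    have "g *\<^sub>v x - x = 0\<^sub>v n"
    proof (rule Nil.prems(4))
      fix y assume "y \<in> F \<union> set []"
      then have y: "y \<in> V" "g *\<^sub>v y = y" using Nil.prems(2) g by auto
      then show "B (g *\<^sub>v x - x) y = 0" using OV_B[OF g(1) x y(1)] x gx by (simp add: B_simps)
    qed (use x gx in auto)
    then have "g *\<^sub>v x = x" using x gx
      by (metis eq_vecI index_minus_vec(1) index_zero_vec(1) carrier_vecD right_minus_eq)
    then show "g *\<^sub>v x = 1\<^sub>m n *\<^sub>v x" using x by simp
  qed (use g OV_D in auto)
  then show ?case using OV_one spin_one by (metis right_mult_one_mat one_carrier_mat)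
next
  case (Cons v xs)
  have v: "v \<in> V" "Q v \<noteq> 0" and xs: "orthogonal_family xs" "\<And>y. y \<in> set xs \<Longrightarrow> B v y = 0"
    using Cons.prems(1) by (auto simp: orthogonal_family_def)
  have "\<exists>e. \<forall>g\<in>OV. mcong e g (1\<^sub>m n) \<longrightarrow> (\<forall>x\<in>insert v F. g *\<^sub>v x = x) \<longrightarrow> (\<exists>h\<in>OV. spin h \<and> h * g = 1\<^sub>m n)"
    by (rule Cons.IH[OF xs(1)]) (use Cons.prems(2-4) v xs(2) in auto)
  then obtain e where e: "\<And>g. g \<in> OV \<Longrightarrow> mcong e g (1\<^sub>m n) \<Longrightarrow> (\<forall>x\<in>insert v F. g *\<^sub>v x = x) \<Longrightarrow>
    \<exists>h\<in>OV. spin h \<and> h * g = 1\<^sub>m n" by blast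
  have "2 * Q v \<noteq> 0" using v by simp
  then obtain t a where a: "ell ^ t = 2 * Q v * a" using nonzero_dvd_ell_power by (metis dvdE)
  \<comment> \<open>After the correction the induction hypothesis needs precision \<open>e\<close>,
    \<open>spin_move_back\<close> needs at least 3, and dividing by \<open>2 * Q v\<close> costs
    \<open>t\<close> more.\<close>
  show ?case
  proof (intro exI[of _ "t + max e 3"] ballI impI)
    fix g assume g: "g \<in> OV" "mcong (t + max e 3) g (1\<^sub>m n)" "\<forall>x\<in>F. g *\<^sub>v x = x"
    obtain k where k: "k \<in> OV" "spin k" "mcong (max e 3) k (1\<^sub>m n)" "k *\<^sub>v (g *\<^sub>v v) = v"
      "\<And>x. x \<in> V \<Longrightarrow> B x v = 0 \<Longrightarrow> g *\<^sub>v x = x \<Longrightarrow> k *\<^sub>v x = x"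
      using spin_move_back[OF g(1) v a[symmetric] g(2)] by auto
    have "\<exists>h\<in>OV. spin h \<and> h * (k * g) = 1\<^sub>m n"
    proof (rule e)
      show kg: "k * g \<in> OV" using k g OV_mult by blast
      have "mcong e (k * g) (k * 1\<^sub>m n)"
        using g k OV_one by (intro mcong_mult_left mcong_le[OF g(2)]) auto
      then have "mcong e (k * g) k" using OV_D(1)[OF k(1)] by simp
      then show "mcong e (k * g) (1\<^sub>m n)"
        using mcong_trans[OF OV_D(1)[OF kg] OV_D(1)[OF k(1)] one_carrier_mat] mcong_le[OF k(3)] by simp
      show "\<forall>x\<in>insert v F. (k * g) *\<^sub>v x = x"
        using k g v Cons.prems(2,3) by (auto simp: mult_vec_assoc subset_iff)
    qed
    then obtain h where h: "h \<in> OV" "spin h" "h * (k * g) = 1\<^sub>m n" by blast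
    then have "h * k * g = 1\<^sub>m n" using assoc_mult_mat[OF OV_D(1) OV_D(1) OV_D(1)] h k g by metis
    then show "\<exists>h\<in>OV. spin h \<and> h * g = 1\<^sub>m n"
      using h k OV_mult[OF h(1) k(1)] spin_mult[OF h(2) k(2) OV_D(1)[OF h(1)] OV_D(1)[OF k(1)]] by blast
  qed
qed

text \<open>Pairwise orthogonal vectors of nonzero norm are linearly independent. The bound provides
  the maximal family in \<open>spin_open\<close>.\<close>

lemma orthogonal_family_length:
  assumes "orthogonal_family xs"
  shows "length xs \<le> n"
proof (rule ccontr)
  assume "\<not> length xs \<le> n"
  define N where "N = length xs"
  have N: "n < N" using \<open>\<not> length xs \<le> n\<close> by (simp add: N_def)
  have xs: "xs ! i \<in> V" "Q (xs ! i) \<noteq> 0" if "i < N" for i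
  proof -
    have "xs ! i \<in> set xs" using that by (simp add: N_def)
    then show "xs ! i \<in> V" "Q (xs ! i) \<noteq> 0" using assms by (auto simp: orthogonal_family_def)
  qed
  have orth: "B (xs ! i) (xs ! j) = 0" if "i < N" "j < N" "i \<noteq> j" for i j
  proof (cases "i < j")
    case True
    then show ?thesis using assms that sorted_wrt_nth_less unfolding orthogonal_family_def N_def by blast
  next
    case False
    then have "B (xs ! j) (xs ! i) = 0"
      using assms that sorted_wrt_nth_less[of "\<lambda>x y. B x y = 0" xs j i] unfolding orthogonal_family_def N_def by simp
    then show ?thesis using B_sym xs that by metis
  qed
  \<comment> \<open>A square matrix made singular by a zero row at index \<open>n\<close>. The rows
    before it hold the coordinates of the vectors; those after it are out of range and are never
    evaluated.\<close>
  define A where "A = mat\<^sub>r N N (\<lambda>i. if i = n then 0\<^sub>v N else vec N (\<lambda>j. xs ! j $ i))"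
  have A: "A \<in> carrier_mat N N" by (simp add: A_def)
  have "det A = 0" unfolding A_def using N by (intro det_row_0) auto
  then obtain c where c: "c \<in> carrier_vec N" "c \<noteq> 0\<^sub>v N" "A *\<^sub>v c = 0\<^sub>v N"
    using det_0_iff_vec_prod_zero[OF A] by blast
  have zero: "(\<Sum>j<N. xs ! j $ i * c $ j) = 0" if "i < n" for i
    using arg_cong[OF c(3), of "\<lambda>v. v $ i"] that N c(1)
    by (simp add: A_def scalar_prod_def atLeast0LessThan)
  have "c $ l = 0" if l: "l < N" for l
  proof -
    have "0 = (\<Sum>i<n. B (xs ! l) (unit_vec n i) * (\<Sum>j<N. xs ! j $ i * c $ j))" by (simp add: zero)
    also have "\<dots> = (\<Sum>i<n. \<Sum>j<N. c $ j * (xs ! j $ i * B (xs ! l) (unit_vec n i)))"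
      by (simp add: sum_distrib_left mult_ac)
    also have "\<dots> = (\<Sum>j<N. c $ j * (\<Sum>i<n. xs ! j $ i * B (xs ! l) (unit_vec n i)))"
      by (subst sum.swap) (simp add: sum_distrib_left)
    also have "\<dots> = (\<Sum>j<N. c $ j * B (xs ! l) (xs ! j))"
      by (intro sum.cong refl, subst linear_functional_expand[OF linear_functional_B, symmetric]) (use xs l in auto)
    also have "\<dots> = (\<Sum>j<N. if j = l then c $ l * B (xs ! l) (xs ! l) else 0)"
      by (intro sum.cong refl) (use orth l in auto)
    also have "\<dots> = c $ l * (2 * Q (xs ! l))" using l xs by (simp add: B_self)
    finally show ?thesis using xs(2)[OF l] by simp
  qed
  then have "c = 0\<^sub>v N" using c(1) by (intro eq_vecI) auto
  then show False using c(2) by simp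
qed

text \<open>Gram-Schmidt without division: \<open>y\<close> is \<open>c\<close> times the component
  of \<open>z\<close> orthogonal to \<open>xs\<close>, the denominators \<open>2 * Q v\<close> being
  collected in \<open>c\<close>.\<close>

lemma orthogonal_projection_exists:
  assumes "orthogonal_family xs" "z \<in> V"
  shows "\<exists>c y. c \<noteq> 0 \<and> y \<in> V \<and> (\<forall>x\<in>V. (\<forall>u\<in>set xs. B x u = 0) \<longrightarrow> B x y = c * B x z) \<and> (\<forall>u\<in>set xs. B y u = 0)"
  using assms
proof (induction xs)
  case Nil
  then show ?case by (intro exI[of _ 1] exI[of _ z]) auto
next
  case (Cons v xs)
  have v: "v \<in> V" "Q v \<noteq> 0" and xs: "orthogonal_family xs" "\<And>y. y \<in> set xs \<Longrightarrow> B v y = 0" "set xs \<subseteq> V"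
    using Cons.prems(1) by (auto simp: orthogonal_family_def)
  from Cons.IH[OF xs(1) Cons.prems(2)] obtain c y where cy: "c \<noteq> 0" "y \<in> V"
    "\<And>x. x \<in> V \<Longrightarrow> (\<And>u. u \<in> set xs \<Longrightarrow> B x u = 0) \<Longrightarrow> B x y = c * B x z" "\<And>u. u \<in> set xs \<Longrightarrow> B y u = 0"
    by metis
  let ?y = "(2 * Q v) \<cdot>\<^sub>v y - B y v \<cdot>\<^sub>v v"
  show ?case
  proof (intro exI[of _ "2 * Q v * c"] exI[of _ ?y] conjI ballI impI)
    fix x assume "x \<in> V" "\<forall>u\<in>set (v # xs). B x u = 0"
    then show "B x ?y = 2 * Q v * c * B x z" using v cy by (simp add: B_simps)
  next
    fix u assume "u \<in> set (v # xs)"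
    then show "B ?y u = 0" using v cy xs by (auto simp: B_simps B_self subset_iff)
  qed (use v cy in auto)
qed

text \<open>By maximality \<open>Q\<close> vanishes on the orthogonal complement of a longest
  orthogonal family, hence so does \<open>B\<close>. Projecting an arbitrary \<open>z\<close> to the
  complement then shows that the complement is zero, and \<open>spin_open_aux\<close> applies with
  empty \<open>F\<close>.\<close>

lemma spin_open: "\<exists>e. \<forall>g\<in>OV. mcong e g (1\<^sub>m n) \<longrightarrow> spin g"
proof -
  obtain xs where xs: "orthogonal_family xs" "\<And>ys. orthogonal_family ys \<Longrightarrow> length ys \<le> length xs"
  proof -
    have "\<exists>xs. orthogonal_family xs \<and> (\<forall>ys. orthogonal_family ys \<longrightarrow> length ys \<le> length xs)"
      by (rule ex_has_greatest_nat[of _ "[]" length "n + 1"])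
        (auto simp: orthogonal_family_length less_Suc_eq_le, simp add: orthogonal_family_def)
    then show ?thesis using that by blast
  qed
  have max: "Q y = 0" if "y \<in> V" "\<forall>u\<in>set xs. B y u = 0" for y
  proof (rule ccontr)
    assume "Q y \<noteq> 0"
    then have "orthogonal_family (y # xs)" using that xs(1) by (auto simp: orthogonal_family_def)
    from xs(2)[OF this] show False by simp
  qed
  have "x = 0\<^sub>v n" if x: "x \<in> V" "\<And>u. u \<in> set xs \<Longrightarrow> B x u = 0" for x
  proof (rule eq_vecI_B)
    fix z assume z: "z \<in> V"
    obtain c y where cy: "c \<noteq> 0" "y \<in> V" "B x y = c * B x z" "\<forall>u\<in>set xs. B y u = 0"
      using orthogonal_projection_exists[OF xs(1) z] x by metis
    have "set xs \<subseteq> V" using xs(1) by (auto simp: orthogonal_family_def)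
    then have "Q (x + y) = 0" using x cy by (intro max) (auto simp: B_simps subset_iff)
    moreover have "Q x = 0" "Q y = 0" using max x cy by auto
    ultimately have "B x y = 0" by (simp add: Q_add)
    then have "B x z = 0" using cy by simp
    then show "B x z = B (0\<^sub>v n) z" using z by (simp add: B_zero_left)
  qed (use x in auto)
  then have "\<exists>e. \<forall>g\<in>OV. mcong e g (1\<^sub>m n) \<longrightarrow> (\<forall>x\<in>{}. g *\<^sub>v x = x) \<longrightarrow> (\<exists>h\<in>OV. spin h \<and> h * g = 1\<^sub>m n)"
    by (intro spin_open_aux[OF xs(1)]) auto
  then obtain e where e: "\<And>g. g \<in> OV \<Longrightarrow> mcong e g (1\<^sub>m n) \<Longrightarrow> \<exists>h\<in>OV. spin h \<and> h * g = 1\<^sub>m n" by blast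
  have "spin g" if g: "g \<in> OV" "mcong e g (1\<^sub>m n)" for g
  proof -
    \<comment> \<open>\<open>spin_open_aux\<close> asserts \<open>spin\<close> for a left inverse,
      so it is applied to the inverse of \<open>g\<close>.\<close>
    obtain g' where g': "g' \<in> OV" "g' * g = 1\<^sub>m n" "g * g' = 1\<^sub>m n" using OV_inverse[OF g(1)] .
    have "mcong e (g' * 1\<^sub>m n) (g' * g)"
      using g g' OV_one by (intro mcong_mult_left mcong_sym[OF OV_D(1) one_carrier_mat]) auto
    then have "mcong e g' (1\<^sub>m n)" using g' OV_D(1)[OF g'(1)] by simp
    then obtain h where h: "h \<in> OV" "spin h" "h * g' = 1\<^sub>m n" using e g' by blast
    have "h = h * (g' * g)" using g' OV_D(1)[OF h(1)] by simp
    also have "\<dots> = g" using h g g' OV_D(1)[OF g(1)]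
      assoc_mult_mat[OF OV_D(1)[OF h(1)] OV_D(1)[OF g'(1)] OV_D(1)[OF g(1)]] by simp
    finally show ?thesis using h by simp
  qed
  then show ?thesis by blast
qed

end

section \<open>Counting in finite abelian groups\<close>

lemma card_uniform_fibers:
  assumes "finite S" "\<And>x. x \<in> S \<Longrightarrow> card {y \<in> S. f y = f x} = c"
  shows "card S = c * card (f ` S)"
proof -
  have "card S = (\<Sum>z\<in>f ` S. card {y \<in> S. f y = z})"
    using sum.image_gen[OF assms(1), of "\<lambda>_. 1::nat" f] by simp
  also have "\<dots> = (\<Sum>z\<in>f ` S. c)" by (rule sum.cong) (use assms(2) in auto)
  finally show ?thesis by simp
qed

text \<open>Size of a group as kernel times image. Vectors of all dimensions share one type, on
  which cancellation fails globally, so the few laws needed on \<open>S\<close> are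
  hypotheses.\<close>

lemma card_additive_fibers:
  fixes S :: "'a::{plus,minus} set"
  assumes "finite S"
    and f: "\<And>x y. x \<in> S \<Longrightarrow> y \<in> S \<Longrightarrow> f y = f x \<longleftrightarrow> y - x \<in> K"
    and add: "\<And>x k. x \<in> S \<Longrightarrow> k \<in> K \<Longrightarrow> x + k \<in> S"
    and cancel: "\<And>x k. x \<in> S \<Longrightarrow> k \<in> K \<Longrightarrow> x + k - x = k"
    and cancel': "\<And>x y. x \<in> S \<Longrightarrow> y \<in> S \<Longrightarrow> x + (y - x) = y"
  shows "card S = card K * card (f ` S)"
proof (rule card_uniform_fibers[OF assms(1)])
  fix x assume x: "x \<in> S"
  have "bij_betw (\<lambda>y. y - x) {y \<in> S. f y = f x} K"
    using x f[of x] add[of x] cancel[of x] cancel'[of x]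
    by (intro bij_betw_byWitness[where f' = "\<lambda>k. x + k"]) auto
  then show "card {y \<in> S. f y = f x} = card K" by (rule bij_betw_same_card)
qed

section \<open>Coordinates on the reduction of a submodule\<close>

text \<open>Take a smallest set \<open>I\<close> of coordinates that detects zero on
  \<open>W\<close>. Dropping \<open>i\<close> from it loses some nonzero \<open>w\<close>, whose
  only nonzero coordinate in \<open>I\<close> is at \<open>i\<close>; scaling makes this entry
  1.\<close>

lemma pivot_coordinates:
  fixes W :: "'a::field vec set"
  assumes W: "W \<subseteq> carrier_vec n" and smult: "\<And>c w. w \<in> W \<Longrightarrow> c \<cdot>\<^sub>v w \<in> W"
  shows "\<exists>I \<subseteq> {..<n}. (\<forall>w\<in>W. (\<forall>i\<in>I. w $ i = 0) \<longrightarrow> w = 0\<^sub>v n) \<and>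
    (\<forall>i\<in>I. \<exists>w\<in>W. \<forall>i'\<in>I. w $ i' = (if i = i' then 1 else 0))"
proof -
  define P where "P I \<longleftrightarrow> I \<subseteq> {..<n} \<and> (\<forall>w\<in>W. (\<forall>i\<in>I. w $ i = 0) \<longrightarrow> w = 0\<^sub>v n)" for I
  have "w = 0\<^sub>v n" if "w \<in> W" "\<forall>i\<in>{..<n}. w $ i = 0" for w
    using that W by (intro eq_vecI) auto
  then have "P {..<n}" by (simp add: P_def)
  then obtain I where I: "P I" "\<And>J. P J \<Longrightarrow> card I \<le> card J"
    using ex_has_least_nat[of P "{..<n}" card] by auto
  have "\<exists>w\<in>W. \<forall>i'\<in>I. w $ i' = (if i = i' then 1 else 0)" if i: "i \<in> I" for i
  proof -
    have fin: "finite I" using I(1) finite_subset by (auto simp: P_def)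
    have "\<not> P (I - {i})"
    proof
      assume "P (I - {i})"
      from I(2)[OF this] show False using card_Diff1_less[OF fin i] by simp
    qed
    then obtain w where w: "w \<in> W" "\<forall>i'\<in>I - {i}. w $ i' = 0" "w \<noteq> 0\<^sub>v n" using I(1) by (auto simp: P_def)
    then have "w $ i \<noteq> 0" using I(1) by (auto simp: P_def)
    moreover have "I \<subseteq> {..<dim_vec w}" using carrier_vecD[OF subsetD[OF W w(1)]] I(1) by (simp add: P_def)
    ultimately show ?thesis
      using w smult[OF w(1), of "1 / w $ i"] i
      by (intro bexI[of _ "(1 / w $ i) \<cdot>\<^sub>v w"]) auto
  qed
  then show ?thesis using I(1) unfolding P_def by blast
qed

definition submodule_vec :: "nat \<Rightarrow> 'a::comm_ring_1 vec set \<Rightarrow> bool" where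
  "submodule_vec n L \<longleftrightarrow> L \<subseteq> carrier_vec n \<and> 0\<^sub>v n \<in> L \<and>
     (\<forall>x\<in>L. \<forall>y\<in>L. x + y \<in> L) \<and> (\<forall>c. \<forall>x\<in>L. c \<cdot>\<^sub>v x \<in> L)"

lemma submodule_vec_diff:
  assumes "submodule_vec n L" "x \<in> L" "y \<in> L"
  shows "x - y \<in> L"
proof -
  have "x - y = x + (- 1) \<cdot>\<^sub>v y" using assms by (auto simp: submodule_vec_def)
  then show ?thesis using assms by (auto simp: submodule_vec_def)
qed

text \<open>The vectors \<open>wv a\<close> reduce to a basis of the reduction of \<open>L\<close>, with dual basis the coordinates \<open>\<iota> a\<close>.\<close>

definition frame ::
  "nat \<Rightarrow> 'p::prime_card padic_int vec set \<Rightarrow> nat \<Rightarrow> (nat \<Rightarrow> nat) \<Rightarrow> (nat \<Rightarrow> 'p padic_int vec) \<Rightarrow> bool" where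
  "frame n L r \<iota> wv \<longleftrightarrow> submodule_vec n L \<and> (\<forall>a<r. \<iota> a < n \<and> wv a \<in> L) \<and>
     (\<forall>a<r. \<forall>b<r. red_vec (wv a) $ \<iota> b = (if a = b then 1 else 0)) \<and>
     (\<forall>x\<in>L. (\<forall>a<r. red_vec x $ \<iota> a = 0) \<longrightarrow> vdvd ell x)"

lemma frame_exists:
  assumes L: "submodule_vec n (L :: 'p::prime_card padic_int vec set)"
  shows "\<exists>r \<iota> wv. frame n L r \<iota> wv"
proof -
  have Lc: "L \<subseteq> carrier_vec n" using L by (auto simp: submodule_vec_def)
  have sm: "c \<cdot>\<^sub>v w \<in> red_vec ` L" if w: "w \<in> red_vec ` L" for c :: "'p mod_ring" and w
  proof -
    obtain x where x: "x \<in> L" "w = red_vec x" using w by auto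
    have "c \<cdot>\<^sub>v w = red_vec (lift_mod_ring c \<cdot>\<^sub>v x)" using x Lc red_vec_simps(3)[of x n x] by auto
    then show ?thesis using x L by (auto simp: submodule_vec_def)
  qed
  have sub: "red_vec ` L \<subseteq> carrier_vec n" using Lc by auto
  obtain I where I: "I \<subseteq> {..<n}" "\<forall>w\<in>red_vec ` L. (\<forall>i\<in>I. w $ i = 0) \<longrightarrow> w = 0\<^sub>v n"
    "\<forall>i\<in>I. \<exists>w\<in>red_vec ` L. \<forall>i'\<in>I. w $ i' = (if i = i' then 1 else 0)"
    using pivot_coordinates[OF sub sm] by blast
  have fin: "finite I" using I(1) finite_subset by auto
  then obtain \<iota> where \<iota>: "bij_betw \<iota> {0..<card I} I" using ex_bij_betw_nat_finite by blast
  then have \<iota>I: "\<iota> a \<in> I" if "a < card I" for a using that by (auto simp: bij_betw_def)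
  have "\<forall>a. \<exists>x. a < card I \<longrightarrow> x \<in> L \<and> (\<forall>i'\<in>I. red_vec x $ i' = (if \<iota> a = i' then 1 else 0))"
    using I(3) \<iota>I by (metis imageE)
  then obtain wv where wv: "\<And>a. a < card I \<Longrightarrow> wv a \<in> L \<and> (\<forall>i'\<in>I. red_vec (wv a) $ i' = (if \<iota> a = i' then 1 else 0))"
    by metis
  have inj: "\<iota> a = \<iota> b \<longleftrightarrow> a = b" if "a < card I" "b < card I" for a b
    using \<iota> that by (auto simp: bij_betw_def inj_on_def)
  have "vdvd ell x" if x: "x \<in> L" "\<forall>a<card I. red_vec x $ \<iota> a = 0" for x
  proof -
    have "red_vec x $ i = 0" if "i \<in> I" for i
    proof -
      have "i \<in> \<iota> ` {0..<card I}" using that \<iota> by (simp add: bij_betw_def)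
      then show ?thesis using x(2) by auto
    qed
    then have "red_vec x = 0\<^sub>v n" using I(2) x by blast
    then show ?thesis using x Lc red_vec_eq_0_iff by blast
  qed
  then have "frame n L (card I) \<iota> wv"
    unfolding frame_def using L \<iota>I I(1) wv inj by auto
  then show ?thesis by blast
qed

lemma frame_D:
  assumes "frame n L r \<iota> wv"
  shows "submodule_vec n L" "\<And>a. a < r \<Longrightarrow> \<iota> a < n" "\<And>a. a < r \<Longrightarrow> wv a \<in> L"
    "\<And>a b. a < r \<Longrightarrow> b < r \<Longrightarrow> red_vec (wv a) $ \<iota> b = (if a = b then 1 else 0)"
    "\<And>x. x \<in> L \<Longrightarrow> (\<And>a. a < r \<Longrightarrow> red_vec x $ \<iota> a = 0) \<Longrightarrow> vdvd ell x"
    "L \<subseteq> carrier_vec n"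
  using assms by (auto simp: frame_def submodule_vec_def)

lemma red_vec_index_diff_smult:
  assumes "x \<in> carrier_vec n" "y \<in> carrier_vec n" "i < n"
  shows "red_vec (x - c \<cdot>\<^sub>v y) $ i = red_vec x $ i - reduce_padic c * red_vec y $ i"
    "red_vec (x + c \<cdot>\<^sub>v y) $ i = red_vec x $ i + reduce_padic c * red_vec y $ i"
  using assms by auto

lemma frame_interpolate:
  assumes fr: "frame n L r \<iota> wv"
  shows "\<exists>x\<in>L. \<forall>a<r. red_vec x $ \<iota> a = c a"
proof -
  have "\<exists>x\<in>L. \<forall>a<r. red_vec x $ \<iota> a = (if a < k then c a else 0)" if "k \<le> r" for k
    using that
  proof (induction k)
    case 0
    show ?case using frame_D(1,2)[OF fr] red_vec_simps(4)[OF zero_carrier_vec zero_carrier_vec, of n]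
      by (intro bexI[of _ "0\<^sub>v n"]) (auto simp: submodule_vec_def)
  next
    case (Suc k)
    then obtain x where x: "x \<in> L" "\<forall>a<r. red_vec x $ \<iota> a = (if a < k then c a else 0)" by auto
    have k: "k < r" using Suc.prems by simp
    note D = frame_D[OF fr]
    have car: "x \<in> carrier_vec n" "wv k \<in> carrier_vec n" using x D k by auto
    show ?case
    proof (intro bexI[of _ "x + lift_mod_ring (c k) \<cdot>\<^sub>v wv k"] allI impI)
      fix a assume a: "a < r"
      show "red_vec (x + lift_mod_ring (c k) \<cdot>\<^sub>v wv k) $ \<iota> a = (if a < Suc k then c a else 0)"
        using x(2) a k D(4)[OF k a] by (simp add: red_vec_index_diff_smult[OF car D(2)[OF a]] less_Suc_eq)
    qed (use x D(1,3) k in \<open>auto simp: submodule_vec_def\<close>)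
  qed
  from this[of r] show ?thesis by auto
qed

text \<open>For any \<open>h\<close> that is linear modulo \<open>ell\<close> on \<open>L\<close>:
  subtracting multiples of the frame vectors, the last one first, clears the coordinates until the
  rest is divisible by \<open>ell\<close>. The forms to which it is applied behave linearly only on
  a layer.\<close>

lemma frame_expand:
  assumes fr: "frame n L r \<iota> wv" and x: "x \<in> L"
    and diff: "\<And>x y c. x \<in> L \<Longrightarrow> y \<in> L \<Longrightarrow> h (x - c \<cdot>\<^sub>v y) = h x - reduce_padic c * h y"
    and zero: "\<And>x. x \<in> L \<Longrightarrow> vdvd ell x \<Longrightarrow> h x = 0"
  shows "h x = (\<Sum>a<r. red_vec x $ \<iota> a * h (wv a))"
proof -
  note D = frame_D[OF fr]
  have "h x = (\<Sum>a<k. red_vec x $ \<iota> a * h (wv a))" if "k \<le> r" "x \<in> L" "\<And>a. a < r \<Longrightarrow> k \<le> a \<Longrightarrow> red_vec x $ \<iota> a = 0" for k x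
    using that
  proof (induction k arbitrary: x)
    case 0
    then show ?case using zero D(5) by auto
  next
    case (Suc k)
    have k: "k < r" using Suc.prems by simp
    define c where "c = lift_mod_ring (red_vec x $ \<iota> k)"
    have car: "x \<in> carrier_vec n" "wv k \<in> carrier_vec n" using Suc.prems D k by auto
    have x': "x - c \<cdot>\<^sub>v wv k \<in> L"
      using Suc.prems D(3)[OF k] submodule_vec_diff[OF D(1)] D(1) by (auto simp: submodule_vec_def)
    have coord: "red_vec (x - c \<cdot>\<^sub>v wv k) $ \<iota> a = (if a = k then 0 else red_vec x $ \<iota> a)" if "a < r" for a
      using that D(4)[OF k that] by (simp add: red_vec_index_diff_smult[OF car D(2)[OF that]] c_def)
    have "h x - red_vec x $ \<iota> k * h (wv k) = h (x - c \<cdot>\<^sub>v wv k)"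
      using diff[OF Suc.prems(2) D(3)[OF k], of c] by (simp add: c_def)
    also have "\<dots> = (\<Sum>a<k. red_vec (x - c \<cdot>\<^sub>v wv k) $ \<iota> a * h (wv a))"
      using Suc.prems x' coord by (intro Suc.IH) auto
    also have "\<dots> = (\<Sum>a<k. red_vec x $ \<iota> a * h (wv a))"
      using k by (intro sum.cong refl) (auto simp: coord)
    finally show ?case by (simp add: algebra_simps)
  qed
  from this[of r x] x show ?thesis by simp
qed

lemma frame_coord_bij:
  assumes fr: "frame n L r \<iota> wv"
  shows "bij_betw (\<lambda>w. vec r (\<lambda>a. w $ \<iota> a)) (red_vec ` L) (carrier_vec r)"
proof (rule bij_betw_imageI)
  note D = frame_D[OF fr]
  show "inj_on (\<lambda>w. vec r (\<lambda>a. w $ \<iota> a)) (red_vec ` L)"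
  proof (rule inj_onI)
    fix w w' assume "w \<in> red_vec ` L" "w' \<in> red_vec ` L"
      and eq: "vec r (\<lambda>a. w $ \<iota> a) = vec r (\<lambda>a. w' $ \<iota> a)"
    then obtain x x' where x: "x \<in> L" "w = red_vec x" "x' \<in> L" "w' = red_vec x'" by auto
    have car: "x \<in> carrier_vec n" "x' \<in> carrier_vec n" using x D by auto
    have "vdvd ell (x - x')"
    proof (rule D(5)[OF submodule_vec_diff[OF D(1)]])
      fix a assume a: "a < r"
      have "w $ \<iota> a = w' $ \<iota> a" using arg_cong[OF eq, of "\<lambda>v. v $ a"] a by simp
      then show "red_vec (x - x') $ \<iota> a = 0"
        using D(2)[OF a] car by (simp add: x red_vec_simps(2)[OF car])
    qed (use x in auto)
    then show "w = w'" using red_vec_eq_iff[OF car] x by simp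
  qed
  show "(\<lambda>w. vec r (\<lambda>a. w $ \<iota> a)) ` red_vec ` L = carrier_vec r"
  proof
    show "carrier_vec r \<subseteq> (\<lambda>w. vec r (\<lambda>a. w $ \<iota> a)) ` red_vec ` L"
    proof
      fix c :: "'a mod_ring vec" assume c: "c \<in> carrier_vec r"
      obtain x where "x \<in> L" "\<forall>a<r. red_vec x $ \<iota> a = c $ a" using frame_interpolate[OF fr] by blast
      then show "c \<in> (\<lambda>w. vec r (\<lambda>a. w $ \<iota> a)) ` red_vec ` L"
        using c by (intro image_eqI[OF _ imageI[of x]]) auto
    qed
  qed auto
qed

lemma frame_card:
  assumes "frame n L r \<iota> (wv :: nat \<Rightarrow> 'p::prime_card padic_int vec)"
  shows "card (red_vec ` L) = CARD('p) ^ r"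
  using bij_betw_same_card[OF frame_coord_bij[OF assms]] by (simp add: card_carrier_vec)

section \<open>The layers of an isometry\<close>

lemma vec_diff_add_diff:
  "a \<in> carrier_vec n \<Longrightarrow> b \<in> carrier_vec n \<Longrightarrow> x \<in> carrier_vec n \<Longrightarrow> y \<in> carrier_vec n \<Longrightarrow>
    a + b - (x + y) = (a - x) + (b - y :: 'a::comm_ring_1 vec)"
  "a \<in> carrier_vec n \<Longrightarrow> b \<in> carrier_vec n \<Longrightarrow> x \<in> carrier_vec n \<Longrightarrow> y \<in> carrier_vec n \<Longrightarrow>
    a - b - (x - y) = (a - x) - (b - y :: 'a::comm_ring_1 vec)"
  by auto

lemma pair_vec_cancel:
  fixes z z' :: "'a::ab_group_add vec \<times> 'a vec"
  assumes "fst z \<in> carrier_vec n" "snd z \<in> carrier_vec n" "fst z' \<in> carrier_vec n" "snd z' \<in> carrier_vec n"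
  shows "z + z' - z = z'" "z + (z' - z) = z'"
  using assms by (auto simp: prod_eq_iff)

lemma smult_left_cancel_vec:
  fixes c :: "'a::idom"
  assumes "c \<noteq> 0" "c \<cdot>\<^sub>v x = c \<cdot>\<^sub>v y"
  shows "x = y"
proof (rule eq_vecI)
  show dim: "dim_vec x = dim_vec y" using arg_cong[OF assms(2), of dim_vec] by simp
  show "x $ i = y $ i" if "i < dim_vec y" for i
    using arg_cong[OF assms(2), of "\<lambda>v. v $ i"] assms(1) that dim by simp
qed

lemma smult_diff_distrib_vec:
  "v \<in> carrier_vec n \<Longrightarrow> w \<in> carrier_vec n \<Longrightarrow> c \<cdot>\<^sub>v (v - w) = c \<cdot>\<^sub>v v - c \<cdot>\<^sub>v (w :: 'a::comm_ring_1 vec)"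
  by (auto simp: right_diff_distrib)

lemma zero_smult_vec: "v \<in> carrier_vec n \<Longrightarrow> 0 \<cdot>\<^sub>v v = (0\<^sub>v n :: 'a::comm_ring_1 vec)"
  by auto

context quadratic_space
begin

definition disp :: "'p padic_int mat \<Rightarrow> 'p padic_int vec \<Rightarrow> 'p padic_int vec" where
  "disp g x = g *\<^sub>v x - x"

lemma disp_carrier: "g \<in> OV \<Longrightarrow> x \<in> V \<Longrightarrow> disp g x \<in> V"
  by (simp add: disp_def OV_carrier)

lemma disp_add: "g \<in> OV \<Longrightarrow> x \<in> V \<Longrightarrow> y \<in> V \<Longrightarrow> disp g (x + y) = disp g x + disp g y"
  unfolding disp_def mult_add_distrib_mat_vec[OF OV_D(1)]
  by (rule vec_diff_add_diff(1)) (auto intro: OV_carrier)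

lemma disp_diff: "g \<in> OV \<Longrightarrow> x \<in> V \<Longrightarrow> y \<in> V \<Longrightarrow> disp g (x - y) = disp g x - disp g y"
  unfolding disp_def mult_minus_distrib_mat_vec[OF OV_D(1)]
  by (rule vec_diff_add_diff(2)) (auto intro: OV_carrier)

lemma disp_smult: "g \<in> OV \<Longrightarrow> x \<in> V \<Longrightarrow> disp g (c \<cdot>\<^sub>v x) = c \<cdot>\<^sub>v disp g x"
  unfolding disp_def mult_mat_vec_smult[OF OV_D(1)]
  using OV_carrier[of g x] by (simp add: smult_diff_distrib_vec[of _ n])

text \<open>Skewness of \<open>g - 1\<close> up to a twist by \<open>g\<close>, from
  \<open>B (g *\<^sub>v x) (g *\<^sub>v y) = B x y\<close>. It lets divisibility of one displacement
  act on the other argument.\<close>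

lemma B_disp: "g \<in> OV \<Longrightarrow> x \<in> V \<Longrightarrow> y \<in> V \<Longrightarrow> B (disp g x) y = - B (g *\<^sub>v x) (disp g y)"
  using OV_carrier[of g x] OV_carrier[of g y] by (simp add: disp_def B_simps OV_B)

definition layer :: "nat \<Rightarrow> 'p padic_int mat \<Rightarrow> 'p padic_int vec set" where
  "layer j g = {x \<in> V. vdvd (ell ^ j) (disp g x)}"

lemma layer_iff: "g \<in> OV \<Longrightarrow> x \<in> layer j g \<longleftrightarrow> x \<in> V \<and> (\<exists>u\<in>V. disp g x = ell ^ j \<cdot>\<^sub>v u)"
  unfolding layer_def using disp_carrier vdvdE by (metis (mono_tags, lifting) mem_Collect_eq vdvd_smult_self)

lemma layer_subset: "layer j g \<subseteq> V"
  by (auto simp: layer_def)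

lemma layer_antimono: "i \<le> j \<Longrightarrow> layer j g \<subseteq> layer i g"
  unfolding layer_def using vdvd_trans le_imp_power_dvd by blast

lemma submodule_layer:
  assumes g: "g \<in> OV"
  shows "submodule_vec n (layer j g)"
proof -
  have "disp g (0\<^sub>v n) = 0\<^sub>v n"
    using disp_smult[OF g, of "0\<^sub>v n" 0] disp_carrier[OF g, of "0\<^sub>v n"] by (simp add: zero_smult_vec[of _ n])
  then show ?thesis
    using g by (auto simp: submodule_vec_def layer_def disp_add disp_smult disp_carrier intro!: vdvd_add[of _ n] vdvd_smult)
qed

lemma layer_cong:
  assumes g: "g \<in> OV" and h: "h \<in> OV" and cong: "mcong j g h"
  shows "layer j g = layer j h"
proof -
  have *: "layer j g \<subseteq> layer j h" if g: "g \<in> OV" and h: "h \<in> OV" and cong: "mcong j g h" for g h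
  proof
    fix x assume x: "x \<in> layer j g"
    then have xV: "x \<in> V" by (simp add: layer_def)
    have gx: "g *\<^sub>v x \<in> V" "h *\<^sub>v x \<in> V" using g h xV OV_carrier by auto
    have "mcong j h g" using mcong_sym[OF OV_D(1) OV_D(1)] g h cong by blast
    then have "vdvd (ell ^ j) (h *\<^sub>v x - g *\<^sub>v x)" using xV by (simp add: mcong_def)
    moreover have "vdvd (ell ^ j) (g *\<^sub>v x - x)" using x by (simp add: layer_def disp_def)
    ultimately have "vdvd (ell ^ j) ((h *\<^sub>v x - g *\<^sub>v x) + (g *\<^sub>v x - x))"
      using gx xV by (intro vdvd_add[of _ n]) auto
    then show "x \<in> layer j h"
      using vec_diff_triangle[OF gx(2) xV gx(1)] xV by (simp add: layer_def disp_def)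
  qed
  show ?thesis using *[OF g h cong] *[OF h g mcong_sym[OF OV_D(1)[OF g] OV_D(1)[OF h] cong]] by blast
qed

section \<open>The graph of the divided displacement\<close>

text \<open>The reduction modulo \<open>ell\<close> of the graph of \<open>ell^-j (g - 1)\<close>,
  which is defined on \<open>layer j g\<close> only. It is a linear relation that need not be a
  function.\<close>

definition graph_set :: "nat \<Rightarrow> 'p padic_int mat \<Rightarrow> ('p mod_ring vec \<times> 'p mod_ring vec) set" where
  "graph_set j g = {(red_vec x, red_vec u) | x u. x \<in> V \<and> u \<in> V \<and> disp g x = ell ^ j \<cdot>\<^sub>v u}"

lemma fst_graph_set: "g \<in> OV \<Longrightarrow> fst ` graph_set j g = red_vec ` layer j g"
  by (force simp: graph_set_def layer_iff image_iff)

lemma finite_graph_set: "finite (graph_set j g)"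
  by (rule finite_subset[of _ "carrier_vec n \<times> carrier_vec n"]) (auto simp: graph_set_def)

lemma graph_set_I: "x \<in> V \<Longrightarrow> u \<in> V \<Longrightarrow> disp g x = ell ^ j \<cdot>\<^sub>v u \<Longrightarrow> (red_vec x, red_vec u) \<in> graph_set j g"
  by (auto simp: graph_set_def)

lemma graph_set_carrier: "z \<in> graph_set j g \<Longrightarrow> fst z \<in> carrier_vec n \<and> snd z \<in> carrier_vec n"
  by (auto simp: graph_set_def)

lemma graph_set_diff:
  assumes "g \<in> OV" "x \<in> V" "u \<in> V" "disp g x = ell ^ j \<cdot>\<^sub>v u" "x' \<in> V" "u' \<in> V" "disp g x' = ell ^ j \<cdot>\<^sub>v u'"
  shows "disp g (x' - x) = ell ^ j \<cdot>\<^sub>v (u' - u)"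
  using assms by (simp add: disp_diff smult_diff_distrib_vec[of _ n])

lemma red_vec_smult_ell: "v \<in> V \<Longrightarrow> red_vec (ell \<cdot>\<^sub>v v) = 0\<^sub>v n"
  by (subst red_vec_eq_0_iff[of _ n]) auto

text \<open>Fibres of the second projection: a divisible \<open>u\<close> means that
  \<open>x\<close> lies one layer deeper.\<close>

lemma card_graph_set_snd:
  assumes g: "g \<in> OV"
  shows "card (graph_set j g) = card (red_vec ` layer (Suc j) g) * card (snd ` graph_set j g)"
proof -
  let ?K = "(\<lambda>w. (w, 0\<^sub>v n :: 'p mod_ring vec)) ` red_vec ` layer (Suc j) g"
  have K: "fst k \<in> carrier_vec n \<and> snd k \<in> carrier_vec n" if "k \<in> ?K" for k
    using that by (auto dest: subsetD[OF layer_subset])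
  have "card (graph_set j g) = card ?K * card (snd ` graph_set j g)"
  proof (rule card_additive_fibers[OF finite_graph_set])
    fix z z' assume "z \<in> graph_set j g" "z' \<in> graph_set j g"
    then obtain x u x' u' where z: "z = (red_vec x, red_vec u)" "x \<in> V" "u \<in> V" "disp g x = ell ^ j \<cdot>\<^sub>v u"
      and z': "z' = (red_vec x', red_vec u')" "x' \<in> V" "u' \<in> V" "disp g x' = ell ^ j \<cdot>\<^sub>v u'"
      unfolding graph_set_def by blast
    note d = graph_set_diff[OF g z(2-4) z'(2-4)]
    have zz: "z' - z = (red_vec (x' - x), red_vec (u' - u))"
      using z z' by (simp add: red_vec_simps[of _ n])
    show "snd z' = snd z \<longleftrightarrow> z' - z \<in> ?K"
    proof
      assume "snd z' = snd z"
      then have dvd: "vdvd ell (u' - u)" using z z' red_vec_eq_iff by auto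
      then have "vdvd (ell ^ j * ell) (ell ^ j \<cdot>\<^sub>v (u' - u))" by (simp add: vdvd_smult_cancel)
      then have "x' - x \<in> layer (Suc j) g" unfolding layer_def d[symmetric] using z z' by (simp add: mult.commute)
      moreover have "red_vec (u' - u) = 0\<^sub>v n" using dvd z z' red_vec_eq_0_iff[of "u' - u" n] by auto
      ultimately show "z' - z \<in> ?K" unfolding zz by auto
    next
      assume "z' - z \<in> ?K"
      then have "red_vec (u' - u) = 0\<^sub>v n" unfolding zz by auto
      then show "snd z' = snd z"
        using z z' red_vec_eq_iff[OF z'(3) z(3)] red_vec_eq_0_iff[of "u' - u" n] by auto
    qed
    show "z + (z' - z) = z'" using z z' by (intro pair_vec_cancel) auto
  next
    fix z k assume z: "z \<in> graph_set j g" and k: "k \<in> ?K"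
    show "z + k - z = k" using K[OF k] graph_set_carrier[OF z] by (intro pair_vec_cancel) auto
    from z obtain x u where z: "z = (red_vec x, red_vec u)" "x \<in> V" "u \<in> V" "disp g x = ell ^ j \<cdot>\<^sub>v u"
      unfolding graph_set_def by blast
    from k obtain y t where y: "k = (red_vec y, 0\<^sub>v n)" "y \<in> V" "t \<in> V" "disp g y = ell ^ Suc j \<cdot>\<^sub>v t"
      using g by (auto simp: layer_iff)
    have "disp g (x + y) = ell ^ j \<cdot>\<^sub>v (u + ell \<cdot>\<^sub>v t)"
      using g z y by (simp add: disp_add smult_add_distrib_vec[of _ n] smult_smult_assoc mult.commute)
    moreover have "z + k = (red_vec (x + y), red_vec (u + ell \<cdot>\<^sub>v t))"
      using z y by (simp add: red_vec_simps(1)[of _ n] red_vec_smult_ell)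
    ultimately show "z + k \<in> graph_set j g" using z y by (auto intro!: graph_set_I)
  qed
  moreover have "card ?K = card (red_vec ` layer (Suc j) g)"
    by (rule card_image) (auto simp: inj_on_def)
  ultimately show ?thesis by simp
qed

text \<open>Fibres of the first projection: if \<open>x\<close> is \<open>ell\<close> times
  \<open>y\<close>, then one factor \<open>ell\<close> cancels and \<open>u\<close> is already
  attained by \<open>y\<close> at level \<open>j\<close>.\<close>

lemma card_graph_set_fst:
  assumes g: "g \<in> OV"
  shows "card (graph_set (Suc j) g) = card (snd ` graph_set j g) * card (red_vec ` layer (Suc j) g)"
proof -
  let ?K = "(\<lambda>w. (0\<^sub>v n :: 'p mod_ring vec, w)) ` snd ` graph_set j g"
  have K: "fst k \<in> carrier_vec n \<and> snd k \<in> carrier_vec n" if "k \<in> ?K" for k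
    using that graph_set_carrier by auto
  have "card (graph_set (Suc j) g) = card ?K * card (fst ` graph_set (Suc j) g)"
  proof (rule card_additive_fibers[OF finite_graph_set])
    fix z z' assume "z \<in> graph_set (Suc j) g" "z' \<in> graph_set (Suc j) g"
    then obtain x u x' u' where z: "z = (red_vec x, red_vec u)" "x \<in> V" "u \<in> V" "disp g x = ell ^ Suc j \<cdot>\<^sub>v u"
      and z': "z' = (red_vec x', red_vec u')" "x' \<in> V" "u' \<in> V" "disp g x' = ell ^ Suc j \<cdot>\<^sub>v u'"
      unfolding graph_set_def by blast
    note d = graph_set_diff[OF g z(2-4) z'(2-4)]
    have zz: "z' - z = (red_vec (x' - x), red_vec (u' - u))"
      using z z' by (simp add: red_vec_simps[of _ n])
    show "fst z' = fst z \<longleftrightarrow> z' - z \<in> ?K"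
    proof
      assume "fst z' = fst z"
      then have dvd: "vdvd ell (x' - x)" using z z' red_vec_eq_iff by auto
      then obtain y where y: "y \<in> V" "x' - x = ell \<cdot>\<^sub>v y" using z z' vdvdE by (metis minus_carrier_vec)
      have "ell \<cdot>\<^sub>v disp g y = ell \<cdot>\<^sub>v (ell ^ j \<cdot>\<^sub>v (u' - u))"
        using d unfolding y(2) disp_smult[OF g y(1)] by (simp add: smult_smult_assoc)
      then have "disp g y = ell ^ j \<cdot>\<^sub>v (u' - u)" using smult_left_cancel_vec ell_nonzero by blast
      then have "(red_vec y, red_vec (u' - u)) \<in> graph_set j g" using y z z' by (auto intro!: graph_set_I)
      then have "red_vec (u' - u) \<in> snd ` graph_set j g" by force
      moreover have "red_vec (x' - x) = 0\<^sub>v n" using dvd z z' red_vec_eq_0_iff[of "x' - x" n] by auto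
      ultimately show "z' - z \<in> ?K" unfolding zz by auto
    next
      assume "z' - z \<in> ?K"
      then have "red_vec (x' - x) = 0\<^sub>v n" unfolding zz by auto
      then show "fst z' = fst z"
        using z z' red_vec_eq_iff[OF z'(2) z(2)] red_vec_eq_0_iff[of "x' - x" n] by auto
    qed
    show "z + (z' - z) = z'" using z z' by (intro pair_vec_cancel) auto
  next
    fix z k assume z: "z \<in> graph_set (Suc j) g" and k: "k \<in> ?K"
    show "z + k - z = k" using K[OF k] graph_set_carrier[OF z] by (intro pair_vec_cancel) auto
    from z obtain x u where z: "z = (red_vec x, red_vec u)" "x \<in> V" "u \<in> V" "disp g x = ell ^ Suc j \<cdot>\<^sub>v u"
      unfolding graph_set_def by blast
    from k obtain y t where y: "k = (0\<^sub>v n, red_vec t)" "y \<in> V" "t \<in> V" "disp g y = ell ^ j \<cdot>\<^sub>v t"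
      unfolding graph_set_def by auto
    have "disp g (x + ell \<cdot>\<^sub>v y) = ell ^ Suc j \<cdot>\<^sub>v (u + t)"
      using g z y by (simp add: disp_add disp_smult smult_add_distrib_vec[of _ n] smult_smult_assoc)
    moreover have "z + k = (red_vec (x + ell \<cdot>\<^sub>v y), red_vec (u + t))"
      using z y by (simp add: red_vec_simps(1)[of _ n] red_vec_smult_ell)
    ultimately show "z + k \<in> graph_set (Suc j) g" using z y by (auto intro!: graph_set_I)
  qed
  moreover have "card ?K = card (snd ` graph_set j g)"
    by (rule card_image) (auto simp: inj_on_def)
  ultimately show ?thesis using fst_graph_set[OF g] by simp
qed

lemma card_graph_set_0:
  assumes g: "g \<in> OV"
  shows "card (graph_set 0 g) = CARD('p) ^ n"
proof -
  have "inj_on fst (graph_set 0 g)"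
  proof (rule inj_onI)
    fix z z' assume "z \<in> graph_set 0 g" "z' \<in> graph_set 0 g" and eq: "fst z = fst z'"
    then obtain x u x' u' where z: "z = (red_vec x, red_vec u)" "x \<in> V" "u \<in> V" "disp g x = ell ^ 0 \<cdot>\<^sub>v u"
      and z': "z' = (red_vec x', red_vec u')" "x' \<in> V" "u' \<in> V" "disp g x' = ell ^ 0 \<cdot>\<^sub>v u'"
      unfolding graph_set_def by blast
    have "vdvd ell (x - x')" using eq z z' red_vec_eq_iff by auto
    then obtain y where y: "y \<in> V" "x - x' = ell \<cdot>\<^sub>v y" using z z' vdvdE by (metis minus_carrier_vec)
    have "u - u' = ell \<cdot>\<^sub>v disp g y"
      using graph_set_diff[OF g z'(2-4) z(2-4)] unfolding y(2) disp_smult[OF g y(1)] by simp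
    then have "vdvd ell (u - u')" by simp
    then show "z = z'" using eq z z' red_vec_eq_iff[OF z(3) z'(3)] by auto
  qed
  then have "card (graph_set 0 g) = card (fst ` graph_set 0 g)" by (rule card_image[symmetric])
  also have "fst ` graph_set 0 g = carrier_vec n"
  proof -
    have "layer 0 g = V" by (auto simp: layer_def vdvd_def)
    moreover have "red_vec ` V = carrier_vec n"
      by (auto, metis imageI lift_vec_carrier red_lift_vec)
    ultimately show ?thesis using fst_graph_set[OF g, of 0] by simp
  qed
  finally show ?thesis by (simp add: card_carrier_vec)
qed

text \<open>The two fibre counts give the same product, so all graphs have the size of
  \<open>graph_set 0 g\<close>, which is the graph of an endomorphism of \<open>V\<close> modulo
  \<open>ell\<close>.\<close>

lemma card_layer_mult:
  assumes g: "g \<in> OV"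
  shows "card (snd ` graph_set j g) * card (red_vec ` layer (Suc j) g) = CARD('p) ^ n"
proof (induction j)
  case 0
  show ?case using card_graph_set_snd[OF g, of 0] card_graph_set_0[OF g] by (simp add: mult.commute)
next
  case (Suc j)
  then show ?case using card_graph_set_snd[OF g, of "Suc j"] card_graph_set_fst[OF g, of j] by (simp add: mult.commute)
qed

section \<open>Orthogonal complements modulo \<open>ell\<close>\<close>

definition perp :: "'p padic_int vec set \<Rightarrow> 'p mod_ring vec set" where
  "perp L = red_vec ` {y \<in> V. \<forall>w\<in>L. ell dvd B y w}"

lemma reduce_B_cong:
  assumes "y \<in> V" "y' \<in> V" "w \<in> V" "red_vec y = red_vec y'"
  shows "reduce_padic (B y w) = reduce_padic (B y' w)"
proof -
  have "vdvd ell (y - y')" using assms red_vec_eq_iff by blast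
  then have "ell dvd B (y - y') w" using assms vdvd_imp_dvd_B by auto
  then show ?thesis using assms by (simp add: reduce_padic_eq_iff B_simps)
qed

text \<open>Pairing with the frame vectors is a map onto vectors of length \<open>r\<close> with
  kernel \<open>perp L\<close>; dual vectors at the pivot coordinates give surjectivity.\<close>

lemma card_perp:
  assumes fr: "frame n L r \<iota> wv"
  shows "card (perp L) * card (red_vec ` L) = CARD('p) ^ n"
proof -
  note D = frame_D[OF fr]
  have wv: "wv a \<in> V" if "a < r" for a using D(3,6) that by auto
  \<comment> \<open>The lift turns a pairing on \<open>V\<close> into a function of the reduction;
    by \<open>f_red\<close> any other lift gives the same value.\<close>
  define f where "f y = vec r (\<lambda>a. reduce_padic (B (lift_vec y) (wv a)))" for y
  have f_red: "f (red_vec y) = vec r (\<lambda>a. reduce_padic (B y (wv a)))" if "y \<in> V" for y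
    unfolding f_def using that wv by (intro eq_vecI) (auto intro!: reduce_B_cong)
  have fdiff: "f (red_vec y') = f (red_vec y) \<longleftrightarrow> red_vec (y' - y) \<in> perp L" if y: "y \<in> V" "y' \<in> V" for y y'
  proof
    assume "f (red_vec y') = f (red_vec y)"
    then have "reduce_padic (B y' (wv a)) = reduce_padic (B y (wv a))" if "a < r" for a
      using that unfolding f_red[OF y(1)] f_red[OF y(2)] by (metis index_vec)
    then have 0: "reduce_padic (B (y' - y) (wv a)) = 0" if "a < r" for a
      using y wv that by (simp add: B_simps)
    have "ell dvd B (y' - y) w" if w: "w \<in> L" for w
    proof -
      have "reduce_padic (B (y' - y) w) = (\<Sum>a<r. red_vec w $ \<iota> a * reduce_padic (B (y' - y) (wv a)))"
      proof (rule frame_expand[OF fr w])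
        fix x z c assume "x \<in> L" "z \<in> L"
        then have "x \<in> V" "z \<in> V" using D(6) by auto
        then show "reduce_padic (B (y' - y) (x - c \<cdot>\<^sub>v z))
          = reduce_padic (B (y' - y) x) - reduce_padic c * reduce_padic (B (y' - y) z)"
          using y by (simp add: B_simps right_diff_distrib)
      next
        fix x assume "x \<in> L" "vdvd ell x"
        then show "reduce_padic (B (y' - y) x) = 0"
          using y D(6) vdvd_imp_dvd_B'[of ell x "y' - y"] by (auto simp: reduce_padic_eq_0_iff)
      qed
      then show ?thesis by (simp add: 0 reduce_padic_eq_0_iff)
    qed
    then show "red_vec (y' - y) \<in> perp L" using y by (auto simp: perp_def)
  next
    assume "red_vec (y' - y) \<in> perp L"
    then obtain z where z: "z \<in> V" "\<forall>w\<in>L. ell dvd B z w" "red_vec (y' - y) = red_vec z"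
      by (auto simp: perp_def)
    have "reduce_padic (B (y' - y) (wv a)) = 0" if "a < r" for a
      using reduce_B_cong[OF _ z(1) wv[OF that] z(3)] y z(2) D(3)[OF that] by (simp add: reduce_padic_eq_0_iff)
    then show "f (red_vec y') = f (red_vec y)"
      unfolding f_red[OF y(1)] f_red[OF y(2)] using y wv by (intro eq_vecI) (auto simp: B_simps)
  qed
  have perpc: "perp L \<subseteq> carrier_vec n" by (auto simp: perp_def)
  have "card (carrier_vec n :: 'p mod_ring vec set) = card (perp L) * card (f ` carrier_vec n)"
  proof (rule card_additive_fibers)
    fix x y :: "'p mod_ring vec" assume "x \<in> carrier_vec n" "y \<in> carrier_vec n"
    then show "f y = f x \<longleftrightarrow> y - x \<in> perp L"
      using fdiff[of "lift_vec x" "lift_vec y"] by (simp add: red_vec_simps(2)[of _ n])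
  qed (use perpc in \<open>auto simp: subset_iff vec_add_diff_cancel[of _ n]\<close>)
  also have "f ` carrier_vec n = carrier_vec r"
  proof
    show "carrier_vec r \<subseteq> f ` carrier_vec n"
    proof
      fix c :: "'p mod_ring vec" assume c: "c \<in> carrier_vec r"
      have "\<exists>y\<in>V. \<forall>a<r. reduce_padic (B y (wv a)) = (if a < k then c $ a else 0)" if "k \<le> r" for k
        using that
      proof (induction k)
        case 0
        show ?case using wv by (intro bexI[of _ "0\<^sub>v n"]) (auto simp: B_zero_left)
      next
        case (Suc k)
        then obtain y where y: "y \<in> V" "\<forall>a<r. reduce_padic (B y (wv a)) = (if a < k then c $ a else 0)" by auto
        have k: "k < r" using Suc.prems by simp
        have dk: "dual (\<iota> k) \<in> V" using dual(1) D(2)[OF k] by blast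
        show ?case
        proof (intro bexI[of _ "y + lift_mod_ring (c $ k) \<cdot>\<^sub>v dual (\<iota> k)"] allI impI)
          fix a assume a: "a < r"
          have "B (dual (\<iota> k)) (wv a) = wv a $ \<iota> k" using dual(2) D(2)[OF k] wv[OF a] by blast
          then have "reduce_padic (B (dual (\<iota> k)) (wv a)) = (if a = k then 1 else 0)"
            using D(4)[OF a k] D(2)[OF k] wv[OF a] by simp
          then show "reduce_padic (B (y + lift_mod_ring (c $ k) \<cdot>\<^sub>v dual (\<iota> k)) (wv a))
            = (if a < Suc k then c $ a else 0)"
            using y a dk wv[OF a] by (auto simp: B_simps less_Suc_eq)
        qed (use y dk in auto)
      qed
      from this[of r] obtain y where y: "y \<in> V" "\<forall>a<r. reduce_padic (B y (wv a)) = c $ a" by auto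
      then have "f (red_vec y) = c" unfolding f_red[OF y(1)] using c by (intro eq_vecI) auto
      then show "c \<in> f ` carrier_vec n" using y(1) by (metis imageI red_vec_carrier)
    qed
  qed (auto simp: f_def)
  finally show ?thesis by (simp add: card_carrier_vec frame_card[OF fr])
qed

text \<open>Skewness of the displacement gives one inclusion. Equality follows because both sides
  have size \<open>CARD('p) ^ n\<close> divided by that of the reduced layer.\<close>

lemma snd_graph_set_eq_perp:
  assumes g: "g \<in> OV"
  shows "snd ` graph_set j g = perp (layer (Suc j) g)"
proof (rule card_subset_eq)
  show "finite (perp (layer (Suc j) g))"
    by (rule finite_subset[of _ "carrier_vec n"]) (auto simp: perp_def)
  show "snd ` graph_set j g \<subseteq> perp (layer (Suc j) g)"
  proof
    fix t assume "t \<in> snd ` graph_set j g"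
    then obtain x u where xu: "t = red_vec u" "x \<in> V" "u \<in> V" "disp g x = ell ^ j \<cdot>\<^sub>v u"
      unfolding graph_set_def by auto
    have "ell dvd B u w" if w: "w \<in> layer (Suc j) g" for w
    proof -
      have wV: "w \<in> V" "vdvd (ell ^ Suc j) (disp g w)" using w by (auto simp: layer_def)
      have "ell ^ j * B u w = - B (g *\<^sub>v x) (disp g w)"
        using B_disp[OF g xu(2) wV(1)] unfolding xu(4) using xu wV by (simp add: B_simps)
      moreover have "ell ^ Suc j dvd B (g *\<^sub>v x) (disp g w)"
        using wV xu g by (intro vdvd_imp_dvd_B') (auto simp: disp_carrier OV_carrier)
      ultimately have "ell ^ j * ell dvd ell ^ j * B u w" by (simp add: mult.commute)
      then show ?thesis by simp
    qed
    then show "t \<in> perp (layer (Suc j) g)" using xu by (auto simp: perp_def)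
  qed
  obtain r \<iota> wv where fr: "frame n (layer (Suc j) g) r \<iota> wv"
    using frame_exists[OF submodule_layer[OF g]] by blast
  have "card (red_vec ` layer (Suc j) g) > 0" by (simp add: frame_card[OF fr])
  then show "card (snd ` graph_set j g) = card (perp (layer (Suc j) g))"
    using card_layer_mult[OF g, of j] card_perp[OF fr] by (metis mult_right_cancel less_numeral_extra(3))
qed

end

section \<open>The alternating form on a layer\<close>

lemma alternating_forms_entries:
  fixes E :: "'a::comm_ring_1 mat"
  assumes E: "E \<in> alternating_forms r" and ab: "a < r" "b < r"
  shows "E $$ (a, a) = 0" "E $$ (a, b) = - E $$ (b, a)"
proof -
  have car: "E \<in> carrier_mat r r" and alt: "\<And>v. v \<in> carrier_vec r \<Longrightarrow> v \<bullet> (E *\<^sub>v v) = 0"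
    using E by (auto simp: alternating_forms_def)
  have ent: "unit_vec r i \<bullet> (E *\<^sub>v unit_vec r k) = E $$ (i, k)" if "i < r" "k < r" for i k
    using that car by (simp add: scalar_prod_left_unit scalar_prod_right_unit)
  show diag: "E $$ (a, a) = 0" using alt[of "unit_vec r a"] ent[of a a] ab by simp
  have "E $$ (b, b) = 0" using alt[of "unit_vec r b"] ent[of b b] ab by simp
  moreover have "(unit_vec r a + unit_vec r b) \<bullet> (E *\<^sub>v (unit_vec r a + unit_vec r b))
    = E $$ (a, a) + E $$ (a, b) + (E $$ (b, a) + E $$ (b, b))"
    using car ab ent
    by (simp add: mult_add_distrib_mat_vec[OF car] add_scalar_prod_distrib[of _ r] scalar_prod_add_distrib[of _ r])
  ultimately have "E $$ (a, b) + E $$ (b, a) = 0"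
    using alt[of "unit_vec r a + unit_vec r b"] diag by simp
  then show "E $$ (a, b) = - E $$ (b, a)" by (simp add: eq_neg_iff_add_eq_0)
qed

context quadratic_space
begin

definition qdiv :: "nat \<Rightarrow> 'p padic_int \<Rightarrow> 'p padic_int" where
  "qdiv j t = (SOME s. t = ell ^ j * s)"

lemma qdiv_mult [simp]: "qdiv j (ell ^ j * s) = s"
proof -
  have "ell ^ j * s = ell ^ j * qdiv j (ell ^ j * s)"
    unfolding qdiv_def by (rule someI[of _ s]) simp
  then show ?thesis by simp
qed

definition beta :: "nat \<Rightarrow> 'p padic_int mat \<Rightarrow> 'p padic_int vec \<Rightarrow> 'p padic_int vec \<Rightarrow> 'p mod_ring" where
  "beta j g x y = reduce_padic (qdiv j (B (disp g x) y))"

lemma beta_eq: "u \<in> V \<Longrightarrow> disp g x = ell ^ j \<cdot>\<^sub>v u \<Longrightarrow> y \<in> V \<Longrightarrow> beta j g x y = reduce_padic (B u y)"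
  by (simp add: beta_def B_simps)

lemma beta_diff_left:
  assumes g: "g \<in> OV" and x: "x \<in> layer j g" "x' \<in> layer j g" and y: "y \<in> V"
  shows "beta j g (x - c \<cdot>\<^sub>v x') y = beta j g x y - reduce_padic c * beta j g x' y"
proof -
  obtain u u' where u: "x \<in> V" "u \<in> V" "disp g x = ell ^ j \<cdot>\<^sub>v u" "x' \<in> V" "u' \<in> V" "disp g x' = ell ^ j \<cdot>\<^sub>v u'"
    using x g by (auto simp: layer_iff)
  have "disp g (x - c \<cdot>\<^sub>v x') = ell ^ j \<cdot>\<^sub>v (u - c \<cdot>\<^sub>v u')"
    using u g by (simp add: disp_diff disp_smult smult_diff_distrib_vec[of _ n] smult_smult_assoc mult.commute)
  from beta_eq[OF _ this y] show ?thesis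
    using u y by (simp add: beta_eq[OF u(2,3) y] beta_eq[OF u(5,6) y] B_simps)
qed

lemma beta_diff_right:
  assumes g: "g \<in> OV" and x: "x \<in> layer j g" and y: "y \<in> V" "y' \<in> V"
  shows "beta j g x (y - c \<cdot>\<^sub>v y') = beta j g x y - reduce_padic c * beta j g x y'"
proof -
  obtain u where u: "u \<in> V" "disp g x = ell ^ j \<cdot>\<^sub>v u" using x g by (auto simp: layer_iff)
  show ?thesis using u y by (simp add: beta_eq[OF u] B_simps)
qed

lemma beta_zero_right:
  assumes g: "g \<in> OV" and x: "x \<in> layer j g" and y: "y \<in> V" "vdvd ell y"
  shows "beta j g x y = 0"
proof -
  obtain u where u: "u \<in> V" "disp g x = ell ^ j \<cdot>\<^sub>v u" using x g by (auto simp: layer_iff)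
  show ?thesis using u y by (simp add: beta_eq[OF u] reduce_padic_eq_0_iff vdvd_imp_dvd_B')
qed

text \<open>Linearity does not suffice, since \<open>x\<close> divided by \<open>ell\<close> may lie
  outside the layer. Skewness moves the displacement to \<open>y\<close>, whose membership in the
  layer supplies the factor \<open>ell ^ j\<close>.\<close>

lemma beta_zero_left:
  assumes g: "g \<in> OV" and x: "x \<in> layer j g" "vdvd ell x" and y: "y \<in> layer j g"
  shows "beta j g x y = 0"
proof -
  obtain u where u: "x \<in> V" "u \<in> V" "disp g x = ell ^ j \<cdot>\<^sub>v u" using x g by (auto simp: layer_iff)
  obtain x' where x': "x' \<in> V" "x = ell \<cdot>\<^sub>v x'" using vdvdE[OF x(2) u(1)] .
  obtain t where t: "y \<in> V" "t \<in> V" "disp g y = ell ^ j \<cdot>\<^sub>v t" using y g by (auto simp: layer_iff)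
  have "ell ^ j * B u y = B (disp g x) y" using u t by (simp add: B_simps)
  also have "\<dots> = - B (g *\<^sub>v x) (disp g y)" by (rule B_disp[OF g u(1) t(1)])
  also have "g *\<^sub>v x = ell \<cdot>\<^sub>v (g *\<^sub>v x')"
    unfolding x'(2) by (rule mult_mat_vec_smult[OF OV_D(1)[OF g] x'(1)])
  finally have "ell ^ j * B u y = ell ^ j * (ell * (- B (g *\<^sub>v x') t))"
    using t x' OV_carrier[OF g x'(1)] by (simp add: B_simps algebra_simps)
  then have "B u y = ell * (- B (g *\<^sub>v x') t)" by (simp only: mult_cancel_left) simp
  then show ?thesis using u t by (simp add: beta_eq reduce_padic_eq_0_iff)
qed

text \<open>Comparing \<open>Q x\<close> with \<open>Q (x + ell ^ j \<cdot>\<^sub>v u)\<close> gives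
  \<open>B u x = - (ell ^ j * Q u)\<close>. Using \<open>Q\<close> rather than \<open>B\<close>
  gives an alternating form, not merely an antisymmetric one, also for \<open>ell = 2\<close>;
  \<open>j \<ge> 1\<close> enters here.\<close>

lemma beta_self:
  assumes g: "g \<in> OV" and x: "x \<in> layer j g" and j: "1 \<le> j"
  shows "beta j g x x = 0"
proof -
  obtain u where u: "x \<in> V" "u \<in> V" "disp g x = ell ^ j \<cdot>\<^sub>v u" using x g by (auto simp: layer_iff)
  have gx: "g *\<^sub>v x = x + disp g x"
    unfolding disp_def using vec_add_diff_cancel(1)[OF u(1) OV_carrier[OF g u(1)]] ..
  have "Q x = Q (x + ell ^ j \<cdot>\<^sub>v u)" using OV_D(2)[OF g u(1)] gx u(3) by simp
  then have "ell ^ j * (B u x + ell ^ j * Q u) = 0"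
    using u by (simp add: Q_add Q_smult B_simps B_sym[of x u] power2_eq_square algebra_simps)
  then have "B u x = - (ell ^ j * Q u)" by (simp add: add_eq_0_iff)
  moreover have "ell dvd (ell :: 'p padic_int) ^ j" using j by (intro dvd_power) auto
  ultimately show ?thesis using u by (simp add: beta_eq reduce_padic_eq_0_iff)
qed

text \<open>If \<open>x\<close> is in the kernel, then \<open>u\<close> is orthogonal to the layer,
  hence congruent to some \<open>u'\<close> with
  \<open>disp g x' = ell ^ (j - 1) \<cdot>\<^sub>v u'\<close> by
  \<open>snd_graph_set_eq_perp\<close>. Then \<open>x - ell \<cdot>\<^sub>v x'\<close> has the same
  reduction as \<open>x\<close> and lies one layer deeper.\<close>

lemma beta_kernel:
  assumes g: "g \<in> OV" and x: "x \<in> layer j g" and j: "1 \<le> j"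
  shows "(\<forall>y\<in>layer j g. beta j g x y = 0) \<longleftrightarrow> red_vec x \<in> red_vec ` layer (Suc j) g"
proof
  obtain u where u: "x \<in> V" "u \<in> V" "disp g x = ell ^ j \<cdot>\<^sub>v u" using x g by (auto simp: layer_iff)
  obtain i where i: "j = Suc i" using j by (cases j) auto
  {
    assume "\<forall>y\<in>layer j g. beta j g x y = 0"
    then have "\<forall>y\<in>layer j g. ell dvd B u y"
      using beta_eq[OF u(2,3)] subsetD[OF layer_subset] by (auto simp: reduce_padic_eq_0_iff)
    then have "red_vec u \<in> snd ` graph_set i g"
      unfolding snd_graph_set_eq_perp[OF g] i perp_def using u by auto
    then obtain x' u' where x': "x' \<in> V" "u' \<in> V" "disp g x' = ell ^ i \<cdot>\<^sub>v u'" "red_vec u = red_vec u'"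
      unfolding graph_set_def by auto
    have "disp g (x - ell \<cdot>\<^sub>v x') = ell ^ j \<cdot>\<^sub>v (u - u')"
      using u x' g by (simp add: disp_diff disp_smult smult_diff_distrib_vec[of _ n] smult_smult_assoc i)
    moreover have "vdvd ell (u - u')" using x' u red_vec_eq_iff by blast
    then have "vdvd (ell ^ j * ell) (ell ^ j \<cdot>\<^sub>v (u - u'))" by (simp add: vdvd_smult_cancel)
    ultimately have "x - ell \<cdot>\<^sub>v x' \<in> layer (Suc j) g" using u x' by (simp add: layer_def mult.commute)
    moreover have "red_vec (x - ell \<cdot>\<^sub>v x') = red_vec x"
    proof -
      have "x - ell \<cdot>\<^sub>v x' - x = - (ell \<cdot>\<^sub>v x')" using u x' by auto
      then have "vdvd ell (x - ell \<cdot>\<^sub>v x' - x)" by simp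
      then show ?thesis using u x' by (subst red_vec_eq_iff[of _ n]) auto
    qed
    ultimately show "red_vec x \<in> red_vec ` layer (Suc j) g" by (metis imageI)
  }
  {
    assume "red_vec x \<in> red_vec ` layer (Suc j) g"
    then obtain x' where x': "x' \<in> layer (Suc j) g" "red_vec x = red_vec x'" by auto
    have x'j: "x' \<in> layer j g" using layer_antimono[of j "Suc j" g] x'(1) by auto
    have x'V: "x' \<in> V" using x'(1) layer_subset by blast
    have dvd: "vdvd ell (x - x')" using x'(2) x'V u red_vec_eq_iff by blast
    have xx': "x - 1 \<cdot>\<^sub>v x' = x - x'" using x'V u by auto
    have mem: "x - x' \<in> layer j g" using submodule_vec_diff[OF submodule_layer[OF g]] x x'j by blast
    show "\<forall>y\<in>layer j g. beta j g x y = 0"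
    proof
      fix y assume y: "y \<in> layer j g"
      then have yV: "y \<in> V" using layer_subset by blast
      have "beta j g x y = beta j g x' y"
        using beta_diff_left[OF g x x'j yV, of 1] beta_zero_left[OF g mem dvd y] unfolding xx' by simp
      also obtain t where t: "t \<in> V" "disp g x' = ell ^ Suc j \<cdot>\<^sub>v t" using x'(1) g by (auto simp: layer_iff)
      have "disp g x' = ell ^ j \<cdot>\<^sub>v (ell \<cdot>\<^sub>v t)" using t by (simp add: smult_smult_assoc mult.commute)
      then have "beta j g x' y = 0"
        using t yV beta_eq[of "ell \<cdot>\<^sub>v t" g x' j y] by (simp add: B_simps reduce_padic_eq_0_iff)
      finally show "beta j g x y = 0" .
    qed
  }
qed

section \<open>Gram matrices\<close>

text \<open>The arguments are transposed so that applying the matrix to the coordinates of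
  \<open>x\<close> gives the values of \<open>beta j g x\<close>; its kernel is then the left kernel
  of \<open>beta\<close>.\<close>

definition gram :: "nat \<Rightarrow> 'p padic_int mat \<Rightarrow> nat \<Rightarrow> (nat \<Rightarrow> 'p padic_int vec) \<Rightarrow> 'p mod_ring mat" where
  "gram j g r wv = mat r r (\<lambda>(a, b). beta j g (wv b) (wv a))"

lemma gram_carrier [simp]: "gram j g r wv \<in> carrier_mat r r"
  by (simp add: gram_def)

lemma beta_expand_left:
  assumes g: "g \<in> OV" and fr: "frame n (layer j g) r \<iota> wv" and x: "x \<in> layer j g" and y: "y \<in> layer j g"
  shows "beta j g x y = (\<Sum>b<r. red_vec x $ \<iota> b * beta j g (wv b) y)"
  by (rule frame_expand[OF fr x]) (use g y subsetD[OF layer_subset] in \<open>auto intro!: beta_diff_left beta_zero_left\<close>)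

lemma beta_expand_right:
  assumes g: "g \<in> OV" and fr: "frame n (layer j g) r \<iota> wv" and x: "x \<in> layer j g" and y: "y \<in> layer j g"
  shows "beta j g x y = (\<Sum>a<r. red_vec y $ \<iota> a * beta j g x (wv a))"
  by (rule frame_expand[OF fr y]) (use g x subsetD[OF layer_subset] in \<open>auto intro!: beta_diff_right beta_zero_right\<close>)

lemma gram_mult_vec:
  assumes g: "g \<in> OV" and fr: "frame n (layer j g) r \<iota> wv" and x: "x \<in> layer j g"
  shows "gram j g r wv *\<^sub>v vec r (\<lambda>a. red_vec x $ \<iota> a) = vec r (\<lambda>a. beta j g x (wv a))"
proof (rule eq_vecI)
  fix a assume "a < dim_vec (vec r (\<lambda>a. beta j g x (wv a)))"
  then have a: "a < r" by simp
  then show "(gram j g r wv *\<^sub>v vec r (\<lambda>a. red_vec x $ \<iota> a)) $ a = vec r (\<lambda>a. beta j g x (wv a)) $ a"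
    using beta_expand_left[OF g fr x frame_D(3)[OF fr a]]
    by (simp add: gram_def scalar_prod_def atLeast0LessThan mult.commute)
qed (simp add: gram_def)

lemma gram_alternating:
  assumes g: "g \<in> OV" and j: "1 \<le> j" and fr: "frame n (layer j g) r \<iota> wv"
  shows "gram j g r wv \<in> alternating_forms r"
  unfolding alternating_forms_def
proof (intro CollectI conjI ballI)
  fix c :: "'p mod_ring vec" assume c: "c \<in> carrier_vec r"
  obtain x where x: "x \<in> layer j g" "\<forall>a<r. red_vec x $ \<iota> a = c $ a" using frame_interpolate[OF fr] by blast
  have c_eq: "c = vec r (\<lambda>a. red_vec x $ \<iota> a)" using c x by (intro eq_vecI) auto
  have "c \<bullet> (gram j g r wv *\<^sub>v c) = (\<Sum>a<r. red_vec x $ \<iota> a * beta j g x (wv a))"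
    unfolding c_eq gram_mult_vec[OF g fr x(1)] by (simp add: scalar_prod_def atLeast0LessThan)
  also have "\<dots> = beta j g x x" using beta_expand_right[OF g fr x(1) x(1)] by simp
  finally show "c \<bullet> (gram j g r wv *\<^sub>v c) = 0" using beta_self[OF g x(1) j] by simp
qed simp

lemma card_mat_kernel_gram:
  assumes g: "g \<in> OV" and j: "1 \<le> j" and fr: "frame n (layer j g) r \<iota> wv"
  shows "card (mat_kernel (gram j g r wv)) = card (red_vec ` layer (Suc j) g)"
proof -
  let ?c = "\<lambda>w. vec r (\<lambda>a. w $ \<iota> a)"
  have sub: "red_vec ` layer (Suc j) g \<subseteq> red_vec ` layer j g"
    by (rule image_mono) (rule layer_antimono, simp)
  have ker: "?c (red_vec x) \<in> mat_kernel (gram j g r wv) \<longleftrightarrow> red_vec x \<in> red_vec ` layer (Suc j) g"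
    if x: "x \<in> layer j g" for x
  proof -
    have "?c (red_vec x) \<in> mat_kernel (gram j g r wv) \<longleftrightarrow> vec r (\<lambda>a. beta j g x (wv a)) = 0\<^sub>v r"
      using gram_mult_vec[OF g fr x] by (simp add: mat_kernel_def gram_def)
    also have "\<dots> \<longleftrightarrow> (\<forall>a<r. beta j g x (wv a) = 0)" by (auto simp: vec_eq_iff)
    also have "\<dots> \<longleftrightarrow> (\<forall>y\<in>layer j g. beta j g x y = 0)"
    proof
      assume "\<forall>a<r. beta j g x (wv a) = 0"
      then show "\<forall>y\<in>layer j g. beta j g x y = 0" by (simp add: beta_expand_right[OF g fr x])
    qed (use frame_D(3)[OF fr] in blast)
    finally show ?thesis using beta_kernel[OF g x j] by simp
  qed
  have "bij_betw ?c (red_vec ` layer (Suc j) g) (mat_kernel (gram j g r wv))"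
  proof (rule bij_betw_imageI)
    show "inj_on ?c (red_vec ` layer (Suc j) g)"
      using frame_coord_bij[OF fr] sub by (auto simp: bij_betw_def intro: inj_on_subset)
    show "?c ` red_vec ` layer (Suc j) g = mat_kernel (gram j g r wv)"
    proof
      show "?c ` red_vec ` layer (Suc j) g \<subseteq> mat_kernel (gram j g r wv)"
        using ker layer_antimono[of j "Suc j" g] by auto
      show "mat_kernel (gram j g r wv) \<subseteq> ?c ` red_vec ` layer (Suc j) g"
      proof
        fix c assume c: "c \<in> mat_kernel (gram j g r wv)"
        then have "c \<in> carrier_vec r" by (auto simp: mat_kernel_def gram_def)
        then obtain x where x: "x \<in> layer j g" "c = ?c (red_vec x)"
          using frame_coord_bij[OF fr] by (auto simp: bij_betw_def image_iff)
        then show "c \<in> ?c ` red_vec ` layer (Suc j) g" using ker c by blast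
      qed
    qed
  qed
  then show ?thesis by (rule bij_betw_same_card[symmetric])
qed

section \<open>Changing the alternating form by elements of \<open>\<Omega>\<close>\<close>

text \<open>\<open>k\<close> is \<open>1 + ell ^ j N\<close> with \<open>B (N x) y\<close> congruent
  to \<open>\<phi> x y\<close> modulo \<open>ell\<close>. Only arguments from \<open>L\<close>
  count, a freedom that is essential for \<open>ell = 2\<close>.\<close>

definition shift_form ::
    "nat \<Rightarrow> 'p padic_int mat \<Rightarrow> 'p padic_int vec set \<Rightarrow> ('p padic_int vec \<Rightarrow> 'p padic_int vec \<Rightarrow> 'p padic_int) \<Rightarrow> bool"
  where
  "shift_form j k L \<phi> \<longleftrightarrow> k \<in> OV \<and> spin k \<and> mcong j k (1\<^sub>m n) \<and>
     (\<forall>x\<in>L. \<forall>y\<in>L. ell ^ Suc j dvd B (disp k x) y - ell ^ j * \<phi> x y)"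

lemma shift_form_cong:
  assumes "shift_form j k L \<phi>" "\<And>x y. x \<in> L \<Longrightarrow> y \<in> L \<Longrightarrow> ell dvd \<phi> x y - \<psi> x y"
  shows "shift_form j k L \<psi>"
  unfolding shift_form_def
proof (intro conjI ballI)
  fix x y assume xy: "x \<in> L" "y \<in> L"
  have "ell ^ Suc j dvd B (disp k x) y - ell ^ j * \<phi> x y" using assms(1) xy by (simp add: shift_form_def)
  moreover have "ell ^ Suc j dvd ell ^ j * (\<phi> x y - \<psi> x y)" using assms(2)[OF xy] by (simp add: mult.commute)
  ultimately have "ell ^ Suc j dvd B (disp k x) y - ell ^ j * \<phi> x y + ell ^ j * (\<phi> x y - \<psi> x y)" by (rule dvd_add)
  then show "ell ^ Suc j dvd B (disp k x) y - ell ^ j * \<psi> x y" by (simp add: algebra_simps)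
qed (use assms(1) in \<open>auto simp: shift_form_def\<close>)

lemma disp_one: "x \<in> V \<Longrightarrow> disp (1\<^sub>m n) x = 0\<^sub>v n"
  by (simp add: disp_def)

lemma shift_form_zero: "L \<subseteq> V \<Longrightarrow> shift_form j (1\<^sub>m n) L (\<lambda>_ _. 0)"
  unfolding shift_form_def using OV_one spin_one by (auto simp: disp_one subset_iff B_zero_left)

lemma mcong_mult_one:
  assumes "k \<in> OV" "k' \<in> OV" "mcong j k (1\<^sub>m n)" "mcong j k' (1\<^sub>m n)"
  shows "mcong j (k * k') (1\<^sub>m n)"
proof -
  have "mcong j (k * k') (1\<^sub>m n * k')" using assms OV_one by (intro mcong_mult_right)
  then have "mcong j (k * k') k'" using OV_D(1)[OF assms(2)] by simp
  then show ?thesis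
    using mcong_trans[OF OV_D(1)[OF OV_mult] OV_D(1) one_carrier_mat] assms by blast
qed

lemma disp_mult:
  assumes "k \<in> OV" "k' \<in> OV" "x \<in> V"
  shows "disp (k * k') x = disp k x + disp k (disp k' x) + disp k' x"
proof -
  have k'x: "k' *\<^sub>v x = x + disp k' x"
    unfolding disp_def using vec_add_diff_cancel(1)[OF assms(3) OV_carrier[OF assms(2,3)]] ..
  have kx: "k *\<^sub>v y = y + disp k y" if "y \<in> V" for y
    unfolding disp_def using vec_add_diff_cancel(1)[OF that OV_carrier[OF assms(1) that]] ..
  note c = disp_carrier[OF assms(2,3)] disp_carrier[OF assms(1,3)]
    disp_carrier[OF assms(1) disp_carrier[OF assms(2,3)]]
  have "(k * k') *\<^sub>v x = x + disp k' x + (disp k x + disp k (disp k' x))"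
    using assms c by (simp add: mult_vec_assoc k'x kx disp_add)
  then show ?thesis
    unfolding disp_def[of "k * k'"] using assms(3) c by auto
qed

text \<open>The first-order terms add up; the mixed term \<open>disp k (disp k' x)\<close> is
  divisible by \<open>ell ^ (2 * j)\<close> and disappears modulo
  \<open>ell ^ Suc j\<close>.\<close>

lemma shift_form_add:
  assumes k: "shift_form j k L \<phi>" and k': "shift_form j k' L \<psi>" and L: "L \<subseteq> V" and j: "1 \<le> j"
  shows "shift_form j (k * k') L (\<lambda>x y. \<phi> x y + \<psi> x y)"
  unfolding shift_form_def
proof (intro conjI ballI)
  have kk': "k \<in> OV" "k' \<in> OV" "mcong j k (1\<^sub>m n)" "mcong j k' (1\<^sub>m n)" "spin k" "spin k'"
    using k k' by (auto simp: shift_form_def)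
  show "k * k' \<in> OV" using kk' OV_mult by blast
  show "spin (k * k')" using kk' spin_mult OV_D(1) by blast
  show "mcong j (k * k') (1\<^sub>m n)" using kk' mcong_mult_one by blast
  fix x y assume xy: "x \<in> L" "y \<in> L"
  then have xV: "x \<in> V" "y \<in> V" using L by auto
  have "vdvd (ell ^ j) (disp k' x)" using kk'(4) xV by (auto simp: mcong_def disp_def)
  then obtain t where t: "t \<in> V" "disp k' x = ell ^ j \<cdot>\<^sub>v t" using disp_carrier[OF kk'(2) xV(1)] vdvdE by metis
  have "vdvd (ell ^ j) (disp k t)" using kk'(3) t by (auto simp: mcong_def disp_def)
  then obtain s where s: "s \<in> V" "disp k t = ell ^ j \<cdot>\<^sub>v s" using disp_carrier[OF kk'(1) t(1)] vdvdE by metis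
  have "disp k (disp k' x) = (ell ^ j * ell ^ j) \<cdot>\<^sub>v s"
    unfolding t(2) disp_smult[OF kk'(1) t(1)] s(2) by (simp add: smult_smult_assoc)
  then have "B (disp k (disp k' x)) y = ell ^ j * ell ^ j * B s y" using s xV by (simp add: B_simps)
  moreover have "ell ^ Suc j dvd (ell :: 'p padic_int) ^ j * ell ^ j"
    unfolding power_add[symmetric] using j by (intro le_imp_power_dvd) simp
  ultimately have 1: "ell ^ Suc j dvd B (disp k (disp k' x)) y" by simp
  have 2: "ell ^ Suc j dvd B (disp k x) y - ell ^ j * \<phi> x y" "ell ^ Suc j dvd B (disp k' x) y - ell ^ j * \<psi> x y"
    using k k' xy by (auto simp: shift_form_def)
  have "B (disp (k * k') x) y = B (disp k x) y + B (disp k (disp k' x)) y + B (disp k' x) y"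
    using kk' xV by (simp add: disp_mult disp_carrier B_simps)
  then have "B (disp (k * k') x) y - ell ^ j * (\<phi> x y + \<psi> x y)
    = (B (disp k x) y - ell ^ j * \<phi> x y) + B (disp k (disp k' x)) y + (B (disp k' x) y - ell ^ j * \<psi> x y)"
    by (simp add: algebra_simps)
  then show "ell ^ Suc j dvd B (disp (k * k') x) y - ell ^ j * (\<phi> x y + \<psi> x y)"
    using 1 2 by simp
qed

lemma shift_form_sum:
  assumes "finite S" "\<And>p. p \<in> S \<Longrightarrow> \<exists>k. shift_form j k L (\<phi> p)" "L \<subseteq> V" "1 \<le> j"
  shows "\<exists>k. shift_form j k L (\<lambda>x y. \<Sum>p\<in>S. \<phi> p x y)"
  using assms(1,2)
proof (induction S rule: finite_induct)
  case empty
  show ?case using shift_form_zero[OF assms(3)] by auto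
next
  case (insert p S)
  then obtain k k' where "shift_form j k L (\<phi> p)" "shift_form j k' L (\<lambda>x y. \<Sum>p\<in>S. \<phi> p x y)" by blast
  from shift_form_add[OF this assms(3,4)] show ?case using insert by auto
qed

lemma shift_form_wedge:
  assumes v: "v \<in> V" and w: "w \<in> V" and j: "1 \<le> j" and cond: "odd CARD('p) \<or> ell dvd B v w" and L: "L \<subseteq> V"
  shows "\<exists>k. shift_form j k L (\<lambda>x y. B x w * B v y - B x v * B w y)"
proof -
  obtain k where k: "k \<in> OV" "spin k" "mcong j k (1\<^sub>m n)"
    "\<And>x. x \<in> V \<Longrightarrow> vdvd (ell ^ Suc j) (k *\<^sub>v x - (x + ell ^ j \<cdot>\<^sub>v wedge v w x))"
    using spin_wedge[OF v w j cond] by blast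
  have "ell ^ Suc j dvd B (disp k x) y - ell ^ j * (B x w * B v y - B x v * B w y)" if "x \<in> L" "y \<in> L" for x y
  proof -
    have xV: "x \<in> V" "y \<in> V" using L that by auto
    have kx: "k *\<^sub>v x \<in> V" using k(1) xV OV_carrier by blast
    have "ell ^ Suc j dvd B (k *\<^sub>v x - (x + ell ^ j \<cdot>\<^sub>v wedge v w x)) y"
      using k(4)[OF xV(1)] kx xV v w by (intro vdvd_imp_dvd_B) auto
    also have "B (k *\<^sub>v x - (x + ell ^ j \<cdot>\<^sub>v wedge v w x)) y
      = B (disp k x) y - ell ^ j * (B x w * B v y - B x v * B w y)"
      using kx xV v w by (simp add: B_simps disp_def wedge_def algebra_simps)
    finally show ?thesis .
  qed
  then show ?thesis using k unfolding shift_form_def by blast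
qed

text \<open>For \<open>ell = 2\<close> the parity of \<open>B v w\<close> is circumvented by
  \<open>z\<close>, which pairs trivially with \<open>L\<close>. On \<open>L\<close> the pair
  \<open>v\<close>, \<open>w\<close> has the same form as the sum of the pairs \<open>v + z\<close>,
  \<open>w + y0\<close> and \<open>v\<close>, \<open>- y0\<close>; for suitable \<open>y0\<close>
  both pairs are orthogonal.\<close>

lemma shift_form_wedge':
  assumes v: "v \<in> V" and w: "w \<in> V" and j: "1 \<le> j" and L: "L \<subseteq> V"
    and cond: "odd CARD('p) \<or> (\<exists>z\<in>V. \<not> vdvd ell z \<and> (\<forall>x\<in>L. ell dvd B z x))"
  shows "\<exists>k. shift_form j k L (\<lambda>x y. B x w * B v y - B x v * B w y)"
proof (cases "odd CARD('p)")
  case True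
  then show ?thesis using shift_form_wedge[OF v w j _ L] by blast
next
  case False
  then obtain z where z: "z \<in> V" "\<not> vdvd ell z" "\<And>x. x \<in> L \<Longrightarrow> ell dvd B z x" using cond by blast
  show ?thesis
  proof (cases "\<forall>x\<in>L. ell dvd B v x")
    case True
    \<comment> \<open>Each term of the form contains a pairing of \<open>v\<close> with
      \<open>L\<close>, so the form vanishes modulo \<open>ell\<close>.\<close>
    have "shift_form j (1\<^sub>m n) L (\<lambda>x y. B x w * B v y - B x v * B w y)"
    proof (rule shift_form_cong[OF shift_form_zero[OF L]])
      fix x y assume xy: "x \<in> L" "y \<in> L"
      then have "ell dvd B x v" using True L v B_sym by (metis subsetD)
      then show "ell dvd 0 - (B x w * B v y - B x v * B w y)" using True xy by auto
    qed
    then show ?thesis by blast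
  next
    case False
    then obtain x0 where x0: "x0 \<in> L" "\<not> ell dvd B v x0" by blast
    then have "\<not> vdvd ell v" using vdvd_imp_dvd_B v L by blast
    then obtain p where p: "p \<in> V" "B v p = 1" using primitive_imp_B_eq_1[OF v] by blast
    \<comment> \<open>\<open>z'\<close> is orthogonal to \<open>p\<close>. Its primitivity expresses
      that \<open>v\<close> and \<open>z\<close> are independent modulo \<open>ell\<close>, which
      \<open>x0\<close> witnesses: it pairs to a unit with \<open>v\<close> but not with
      \<open>z\<close>.\<close>
    define z' where "z' = z - B z p \<cdot>\<^sub>v v"
    have z': "z' \<in> V" using z v by (simp add: z'_def)
    have "\<not> vdvd ell z'"
    proof
      assume dvd: "vdvd ell z'"
      have x0V: "x0 \<in> V" using x0 L by auto
      have "ell dvd B z x0 - B z' x0" using z(3)[OF x0(1)] vdvd_imp_dvd_B[OF dvd z' x0V] by (rule dvd_diff)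
      then have "ell dvd B z p * B v x0" using z v x0V by (simp add: z'_def B_simps)
      then have "ell dvd B z p" using x0(2) by (simp add: ell_dvd_mult_iff)
      then have "vdvd ell (z' + B z p \<cdot>\<^sub>v v)"
        using dvd z' v by (intro vdvd_add[of _ n]) (auto intro: vdvd_smult_left)
      moreover have "z' + B z p \<cdot>\<^sub>v v = z" using z v by (auto simp: z'_def)
      ultimately show False using z(2) by simp
    qed
    then obtain q where q: "q \<in> V" "B z' q = 1" using primitive_imp_B_eq_1[OF z'] by blast
    \<comment> \<open>The vector in parentheses pairs to 0 with \<open>v\<close> and to 1 with
      \<open>z\<close>; the coefficient makes \<open>B (v + z) (w + y0) = 0\<close>.\<close>
    define y0 where "y0 = (- B v w - B z w) \<cdot>\<^sub>v (q - B v q \<cdot>\<^sub>v p)"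
    have y0: "y0 \<in> V" using q p by (simp add: y0_def)
    have Bv: "B v y0 = 0" using v q p by (simp add: y0_def B_simps)
    have "B z (q - B v q \<cdot>\<^sub>v p) = 1" using z q p v by (simp add: B_simps z'_def mult.commute)
    then have Bz: "B z y0 = - B v w - B z w" using z q p by (simp add: y0_def B_simps)
    obtain k1 where k1: "shift_form j k1 L (\<lambda>x y. B x (w + y0) * B (v + z) y - B x (v + z) * B (w + y0) y)"
      using shift_form_wedge[of "v + z" "w + y0" j L] v z w y0 j L Bv Bz by (auto simp: B_simps)
    obtain k2 where k2: "shift_form j k2 L (\<lambda>x y. B x (- y0) * B v y - B x v * B (- y0) y)"
      using shift_form_wedge[of v "- y0" j L] v y0 j L Bv by (auto simp: B_simps)
    have "shift_form j (k1 * k2) L (\<lambda>x y. B x w * B v y - B x v * B w y)"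
    proof (rule shift_form_cong[OF shift_form_add[OF k1 k2 L j]])
      fix x y assume xy: "x \<in> L" "y \<in> L"
      then have xV: "x \<in> V" "y \<in> V" using L by auto
      have d: "ell dvd B z y" "ell dvd B x z" using z xy B_sym[OF xV(1) z(1)] by auto
      have "(B x (w + y0) * B (v + z) y - B x (v + z) * B (w + y0) y)
          + (B x (- y0) * B v y - B x v * B (- y0) y) - (B x w * B v y - B x v * B w y)
        = B x (w + y0) * B z y - B x z * B (w + y0) y"
        using xV v w z y0 by (simp add: B_simps algebra_simps)
      also have "ell dvd \<dots>" using d by auto
      finally show "ell dvd (B x (w + y0) * B (v + z) y - B x (v + z) * B (w + y0) y)
          + (B x (- y0) * B v y - B x v * B (- y0) y) - (B x w * B v y - B x v * B w y)" .
    qed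
    then show ?thesis by blast
  qed
qed

text \<open>\<open>g * k - 1\<close> equals \<open>(g - 1) + g * (k - 1)\<close>, and the
  \<open>g\<close> in front of \<open>k - 1\<close> is invisible modulo \<open>ell\<close> because
  \<open>y\<close> lies in the layer.\<close>

lemma beta_shift:
  assumes g: "g \<in> OV" and k: "shift_form j k (layer j g) \<phi>" and j: "1 \<le> j"
    and x: "x \<in> layer j g" and y: "y \<in> layer j g"
  shows "beta j (g * k) x y = beta j g x y + reduce_padic (\<phi> x y)"
proof -
  have kO: "k \<in> OV" "mcong j k (1\<^sub>m n)" using k by (auto simp: shift_form_def)
  obtain u where u: "x \<in> V" "u \<in> V" "disp g x = ell ^ j \<cdot>\<^sub>v u" using x g by (auto simp: layer_iff)
  obtain s where s: "y \<in> V" "s \<in> V" "disp g y = ell ^ j \<cdot>\<^sub>v s" using y g by (auto simp: layer_iff)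
  have "vdvd (ell ^ j) (disp k x)" using kO(2) u by (auto simp: mcong_def disp_def)
  then obtain t where t: "t \<in> V" "disp k x = ell ^ j \<cdot>\<^sub>v t" using disp_carrier[OF kO(1) u(1)] vdvdE by metis
  have gt: "g *\<^sub>v t \<in> V" using g t OV_carrier by blast
  have "disp g t + t = g *\<^sub>v t"
    unfolding disp_def using vec_add_diff_cancel(1)[OF t(1) gt] comm_add_vec[of "g *\<^sub>v t - t" n t] t gt by simp
  then have gt_eq: "u + disp g t + t = u + g *\<^sub>v t"
    using u t disp_carrier[OF g t(1)] by (simp add: assoc_add_vec[of _ n])
  have "disp (g * k) x = ell ^ j \<cdot>\<^sub>v (u + disp g t + t)"
    unfolding disp_mult[OF g kO(1) u(1)] u(3) t(2) disp_smult[OF g t(1)]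
    using u t disp_carrier[OF g t(1)] by (simp add: smult_add_distrib_vec[of _ n])
  then have "beta j (g * k) x y = reduce_padic (B (u + g *\<^sub>v t) y)"
    unfolding gt_eq using u gt s by (intro beta_eq) auto
  also have "\<dots> = beta j g x y + reduce_padic (B (g *\<^sub>v t) y)"
    using u gt s by (simp add: B_simps beta_eq)
  also have "reduce_padic (B (g *\<^sub>v t) y) = reduce_padic (\<phi> x y)"
  proof -
    have "B (disp g t) y = - B (g *\<^sub>v t) (disp g y)" by (rule B_disp[OF g t(1) s(1)])
    then have "B (g *\<^sub>v t) y = B t y - ell ^ j * B (g *\<^sub>v t) s"
      unfolding s(3) unfolding disp_def using gt t s by (simp add: B_simps algebra_simps)
    moreover have "ell dvd ell ^ j * B (g *\<^sub>v t) s" using j by (intro dvd_mult2 dvd_power) auto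
    moreover have "ell dvd B t y - \<phi> x y"
    proof -
      have "ell ^ Suc j dvd B (disp k x) y - ell ^ j * \<phi> x y" using k x y by (simp add: shift_form_def)
      also have "B (disp k x) y - ell ^ j * \<phi> x y = ell ^ j * (B t y - \<phi> x y)"
        unfolding t(2) using t s by (simp add: B_simps algebra_simps)
      finally have "ell ^ j * ell dvd ell ^ j * (B t y - \<phi> x y)" by (simp add: mult.commute)
      then show ?thesis by simp
    qed
    ultimately have "ell dvd (B t y - \<phi> x y) - ell ^ j * B (g *\<^sub>v t) s"
      and "B (g *\<^sub>v t) y - \<phi> x y = (B t y - \<phi> x y) - ell ^ j * B (g *\<^sub>v t) s"
      by (auto intro: dvd_diff)
    then show ?thesis unfolding reduce_padic_eq_iff by (simp only:)
  qed
  finally show ?thesis .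
qed

text \<open>A trivial complement would, by \<open>card_perp\<close>, make the reduction of
  \<open>L\<close> as large as \<open>V\<close> modulo \<open>ell\<close>.\<close>

lemma perp_vector_exists:
  assumes fr: "frame n L r \<iota> wv" and r: "r \<noteq> n"
  shows "\<exists>z\<in>V. \<not> vdvd ell z \<and> (\<forall>x\<in>L. ell dvd B z x)"
proof (rule ccontr)
  assume "\<not> ?thesis"
  then have "perp L \<subseteq> {0\<^sub>v n}"
    by (auto simp: perp_def, metis red_vec_eq_0_iff)
  moreover have "card (perp L) * CARD('p) ^ r = CARD('p) ^ n"
    using card_perp[OF fr] by (simp add: frame_card[OF fr])
  moreover have "card (perp L) \<le> 1" using card_mono[OF _ calculation(1)] by simp
  ultimately have "card (perp L) = 1" by (cases "card (perp L)") auto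
  then have "CARD('p) ^ r = CARD('p) ^ n" using \<open>card (perp L) * CARD('p) ^ r = CARD('p) ^ n\<close> by simp
  moreover have "1 < CARD('p)" using card_gt_1[where ?'p = 'p] by simp
  ultimately show False using r power_inject_exp by blast
qed

text \<open>\<open>E\<close> is a sum of elementary alternating forms, each the wedge of two dual
  vectors at pivot coordinates. The same \<open>k\<close> works for all \<open>g\<close> with the
  given layer, as the translation argument for measures demands.\<close>

lemma gram_transitive:
  assumes j: "1 \<le> j" and fr: "frame n L r \<iota> wv"
    and cond: "odd CARD('p) \<or> r \<noteq> n" and E: "E \<in> alternating_forms r"
  shows "\<exists>k\<in>OV. spin k \<and> mcong j k (1\<^sub>m n) \<and>
    (\<forall>g\<in>OV. layer j g = L \<longrightarrow> gram j (g * k) r wv = gram j g r wv + E)"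
proof -
  note D = frame_D[OF fr]
  let ?S = "{(a, b). a < b \<and> b < r}"
  \<comment> \<open>The signs follow the transposed \<open>gram\<close>: at \<open>x = wv b\<close>,
    \<open>y = wv a\<close> the value reduces to the entry of \<open>E\<close> at
    \<open>(a, b)\<close>.\<close>
  let ?\<phi> = "\<lambda>(a, b) x y. lift_mod_ring (E $$ (a, b)) * (x $ \<iota> b * y $ \<iota> a - x $ \<iota> a * y $ \<iota> b)"
  have fin: "finite ?S" by (rule finite_subset[of _ "{..<r} \<times> {..<r}"]) auto
  have ex: "\<exists>k. shift_form j k L (?\<phi> p)" if p: "p \<in> ?S" for p
  proof -
    obtain a b where ab: "p = (a, b)" "a < b" "b < r" using p by auto
    have d: "dual (\<iota> a) \<in> V" "dual (\<iota> b) \<in> V" "\<iota> a < n" "\<iota> b < n" using ab D(2) dual(1) by auto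
    let ?e = "lift_mod_ring (E $$ (a, b))"
    have "\<exists>k. shift_form j k L (\<lambda>x y. B x (?e \<cdot>\<^sub>v dual (\<iota> b)) * B (dual (\<iota> a)) y - B x (dual (\<iota> a)) * B (?e \<cdot>\<^sub>v dual (\<iota> b)) y)"
      using d j D(6) cond perp_vector_exists[OF fr] by (intro shift_form_wedge') auto
    then obtain k where k: "shift_form j k L (\<lambda>x y. B x (?e \<cdot>\<^sub>v dual (\<iota> b)) * B (dual (\<iota> a)) y - B x (dual (\<iota> a)) * B (?e \<cdot>\<^sub>v dual (\<iota> b)) y)" ..
    have "shift_form j k L (?\<phi> p)"
    proof (rule shift_form_cong[OF k])
      fix x y assume "x \<in> L" "y \<in> L"
      then have "x \<in> V" "y \<in> V" using D(6) by blast+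
      then show "ell dvd B x (?e \<cdot>\<^sub>v dual (\<iota> b)) * B (dual (\<iota> a)) y - B x (dual (\<iota> a)) * B (?e \<cdot>\<^sub>v dual (\<iota> b)) y - ?\<phi> p x y"
        using d by (simp add: ab B_simps dual(2) B_sym[of x] algebra_simps)
    qed
    then show ?thesis ..
  qed
  have "\<exists>k. shift_form j k L (\<lambda>x y. \<Sum>p\<in>?S. ?\<phi> p x y)"
    by (rule shift_form_sum[OF fin _ D(6) j]) (rule ex)
  then obtain k where k: "shift_form j k L (\<lambda>x y. \<Sum>p\<in>?S. ?\<phi> p x y)" ..
  have "gram j (g * k) r wv = gram j g r wv + E" if g: "g \<in> OV" and L: "layer j g = L" for g
  proof (rule eq_matI)
    fix a b assume "a < dim_row (gram j g r wv + E)" "b < dim_col (gram j g r wv + E)"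
    then have ab: "a < r" "b < r" using E by (auto simp: alternating_forms_def)
    have coord: "reduce_padic (wv a $ \<iota> b) = (if a = b then 1 else 0)" if "a < r" "b < r" for a b
      using D(4)[OF that] D(2)[OF that(2)] D(3)[OF that(1)] D(6) by auto
    have rsum: "reduce_padic (\<Sum>p\<in>T. f p) = (\<Sum>p\<in>T. reduce_padic (f p))" for T :: "(nat \<times> nat) set" and f :: "nat \<times> nat \<Rightarrow> 'p padic_int"
      by (induction T rule: infinite_finite_induct) auto
    have "reduce_padic (\<Sum>p\<in>?S. ?\<phi> p (wv b) (wv a))
      = (\<Sum>p\<in>?S. (if p = (a, b) then E $$ (a, b) else 0) - (if p = (b, a) then E $$ (b, a) else 0))"
      unfolding rsum
    proof (rule sum.cong)
      fix p assume "p \<in> ?S"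
      then obtain a' b' where p: "p = (a', b')" "a' < b'" "b' < r" by auto
      then show "reduce_padic (?\<phi> p (wv b) (wv a))
        = (if p = (a, b) then E $$ (a, b) else 0) - (if p = (b, a) then E $$ (b, a) else 0)"
        using ab by (auto simp: coord)
    qed simp
    also have "\<dots> = (if a < b then E $$ (a, b) else 0) - (if b < a then E $$ (b, a) else 0)"
      using fin ab by (simp add: sum_subtractf)
    also have "\<dots> = E $$ (a, b)"
      using alternating_forms_entries[OF E ab] by (cases a b rule: linorder_cases) auto
    finally have "reduce_padic (\<Sum>p\<in>?S. ?\<phi> p (wv b) (wv a)) = E $$ (a, b)" .
    then show "gram j (g * k) r wv $$ (a, b) = (gram j g r wv + E) $$ (a, b)"
      using ab E beta_shift[where j = j and g = g, unfolded L, OF g k j D(3)[OF ab(2)] D(3)[OF ab(1)]]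
      by (auto simp: gram_def alternating_forms_def)
  qed (use E in \<open>auto simp: gram_def alternating_forms_def\<close>)
  then show ?thesis using k by (auto simp: shift_form_def)
qed

end

section \<open>Dimensions and cardinalities\<close>

text \<open>Counting is the bridge between the encodings of dimension in \<open>layer_dim\<close>,
  \<open>kernel_dim\<close> and frames.\<close>

lemma (in vectorspace) card_eq_power_dim:
  assumes "finite (carrier V)" "finite (carrier K)"
  shows "card (carrier V) = card (carrier K) ^ dim"
proof -
  have "gen_set (carrier V)"
    using in_own_span[of "carrier V"] span_is_subset2[of "carrier V"] by auto
  then have "fin_dim" using assms(1) unfolding fin_dim_def by blast
  then obtain A where A: "finite A" "basis A" using finite_basis_exists by blast
  have AV: "A \<subseteq> carrier V" using A(2) by (simp add: basis_def)
  have ex1: "\<forall>v. v \<in> carrier V \<longrightarrow> (\<exists>!a. a \<in> A \<rightarrow>\<^sub>E carrier K \<and> lincomb a A = v)"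
    using basis_criterion[OF A(1) AV] A(2) by blast
  have "bij_betw (\<lambda>a. lincomb a A) (A \<rightarrow>\<^sub>E carrier K) (carrier V)"
  proof (rule bij_betw_imageI)
    have closed: "lincomb a A \<in> carrier V" if "a \<in> A \<rightarrow>\<^sub>E carrier K" for a
      using that AV A(1) by (intro lincomb_closed) auto
    show "inj_on (\<lambda>a. lincomb a A) (A \<rightarrow>\<^sub>E carrier K)"
      using ex1 closed by (intro inj_onI) metis
    show "(\<lambda>a. lincomb a A) ` (A \<rightarrow>\<^sub>E carrier K) = carrier V"
      using ex1 closed by (auto simp: image_iff)
  qed
  then have "card (carrier V) = card (A \<rightarrow>\<^sub>E carrier K)" by (rule bij_betw_same_card[symmetric])
  also have "\<dots> = card (carrier K) ^ card A" using A(1) by (simp add: card_PiE)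
  finally show ?thesis using dim_basis[OF A] by simp
qed

lemma card_mat_kernel:
  fixes A :: "'p::prime_card mod_ring mat"
  assumes A: "A \<in> carrier_mat r r"
  shows "card (mat_kernel A) = CARD('p) ^ kernel_dim A"
proof -
  interpret K: kernel r r A by (rule kernel.intro[OF A])
  have "finite (mat_kernel A)"
    by (rule finite_subset[of _ "carrier_vec r"]) (use A in \<open>auto simp: mat_kernel_def\<close>)
  then show ?thesis using K.Ker.card_eq_power_dim by simp
qed

lemma card_image_eq_if_same_fibers:
  assumes "\<And>x y. x \<in> L \<Longrightarrow> y \<in> L \<Longrightarrow> f x = f y \<longleftrightarrow> h x = h y"
  shows "card (f ` L) = card (h ` L)"
proof (rule bij_betw_same_card[of "\<lambda>z. h (inv_into L f z)"])
  have *: "inv_into L f (f x) \<in> L" "f (inv_into L f (f x)) = f x" if "x \<in> L" for x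
    using that by (auto intro: inv_into_into f_inv_into_f)
  have hh: "h (inv_into L f (f x)) = h x" if "x \<in> L" for x
    using *[OF that] assms that by blast
  show "bij_betw (\<lambda>z. h (inv_into L f z)) (f ` L) (h ` L)"
    by (rule bij_betw_imageI) (auto simp: inj_on_def hh assms image_image)
qed

section \<open>Torsion elements as fractions\<close>

definition qfrac :: "nat \<Rightarrow> 'p::prime_card padic_int \<Rightarrow> 'p padic_quot" where
  "qfrac j a = abs_padic_quot (to_fract a / to_fract (ell ^ j))"

lemma qfrac_add: "qfrac j (a + b) = qfrac j a + qfrac j b"
  by (simp add: qfrac_def plus_padic_quot.abs_eq add_divide_distrib)

lemma qfrac_diff: "qfrac j (a - b) = qfrac j a - qfrac j b"
  by (simp add: qfrac_def minus_padic_quot.abs_eq diff_divide_distrib)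

lemma qfrac_scale: "scale_padic_quot c (qfrac j a) = qfrac j (c * a)"
  by (simp add: qfrac_def scale_padic_quot.abs_eq)

lemma qfrac_eq_0_iff: "qfrac j a = 0 \<longleftrightarrow> ell ^ j dvd a"
proof -
  have "qfrac j a = 0 \<longleftrightarrow> to_fract a / to_fract (ell ^ j) \<in> range to_fract"
    unfolding qfrac_def zero_padic_quot_def padic_quot.abs_eq_iff by simp
  also have "\<dots> \<longleftrightarrow> (\<exists>b. to_fract a / to_fract (ell ^ j) = to_fract b)" by auto
  also have "\<dots> \<longleftrightarrow> (\<exists>b. to_fract a = to_fract (ell ^ j * b))"
    by (simp add: divide_eq_eq mult.commute del: of_nat_power)
  also have "\<dots> \<longleftrightarrow> ell ^ j dvd a" by (simp only: to_fract_eq_iff dvd_def)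
  finally show ?thesis .
qed

lemma qfrac_eq_iff: "qfrac j a = qfrac j b \<longleftrightarrow> ell ^ j dvd a - b"
  unfolding qfrac_eq_0_iff[symmetric] qfrac_diff by simp

lemma qfrac_sum: "qfrac j (\<Sum>i\<in>S. f i) = (\<Sum>i\<in>S. qfrac j (f i))"
proof -
  have 0: "qfrac j 0 = (0 :: 'a padic_quot)" by (simp add: qfrac_eq_0_iff)
  show ?thesis by (induction S rule: infinite_finite_induct) (auto simp: qfrac_add 0)
qed

lemma torsion_imp_qfrac:
  assumes "scale_padic_quot (ell ^ j) x = 0"
  shows "\<exists>a. x = qfrac j a"
proof -
  obtain y where y: "x = abs_padic_quot y" by (metis Quotient_abs_rep Quotient_padic_quot)
  from assms have "to_fract (ell ^ j) * y \<in> range to_fract"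
    unfolding y scale_padic_quot.abs_eq zero_padic_quot_def padic_quot.abs_eq_iff by simp
  then obtain a where "to_fract (ell ^ j) * y = to_fract a" by auto
  then have "y = to_fract a / to_fract (ell ^ j)" by (simp add: eq_divide_eq mult.commute del: of_nat_power)
  then show ?thesis using y by (auto simp: qfrac_def)
qed

lemma qfrac_scale_down:
  assumes "1 \<le> j"
  shows "scale_padic_quot (ell ^ (j - 1)) (qfrac j a) = qfrac (Suc 0) a"
proof -
  obtain i where i: "j = Suc i" using assms by (cases j) auto
  have "to_fract (ell ^ i * a) / to_fract (ell ^ Suc i) = to_fract a / to_fract (ell ^ Suc 0 :: 'a padic_int)"
    by (simp add: divide_simps del: of_nat_power)
  then show ?thesis unfolding qfrac_scale unfolding qfrac_def i by simp
qed

definition vfrac :: "nat \<Rightarrow> 'p::prime_card padic_int vec \<Rightarrow> 'p padic_quot vec" where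
  "vfrac j v = map_vec (qfrac j) v"

lemma vfrac_carrier [simp]: "vfrac j v \<in> carrier_vec n \<longleftrightarrow> v \<in> carrier_vec n"
  by (simp add: vfrac_def)

lemma vfrac_eq_iff:
  "v \<in> carrier_vec n \<Longrightarrow> w \<in> carrier_vec n \<Longrightarrow> vfrac j v = vfrac j w \<longleftrightarrow> vdvd (ell ^ j) (v - w)"
  by (auto simp: vfrac_def vec_eq_iff qfrac_eq_iff vdvd_def)

lemma vfrac_zero: "vfrac j (0\<^sub>v n) = 0\<^sub>v n"
  by (auto simp: vfrac_def qfrac_eq_0_iff)

lemma vfrac_eq_0_iff: "v \<in> carrier_vec n \<Longrightarrow> vfrac j v = 0\<^sub>v n \<longleftrightarrow> vdvd (ell ^ j) v"
  by (auto simp: vfrac_def vec_eq_iff qfrac_eq_0_iff vdvd_def)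

lemma vfrac_add: "v \<in> carrier_vec n \<Longrightarrow> w \<in> carrier_vec n \<Longrightarrow> vfrac j (v + w) = vfrac j v + vfrac j w"
  by (auto simp: vfrac_def qfrac_add)

lemma vfrac_diff: "v \<in> carrier_vec n \<Longrightarrow> w \<in> carrier_vec n \<Longrightarrow> vfrac j (v - w) = vfrac j v - vfrac j w"
  by (auto simp: vfrac_def qfrac_diff)

lemma scale_vec_vfrac: "scale_vec c (vfrac j v) = vfrac j (c \<cdot>\<^sub>v v)"
  by (auto simp: vfrac_def scale_vec_def qfrac_scale)

lemma scale_vec_vfrac_down: "1 \<le> j \<Longrightarrow> scale_vec (ell ^ (j - 1)) (vfrac j v) = vfrac (Suc 0) v"
  by (auto simp: vfrac_def scale_vec_def qfrac_scale_down[unfolded One_nat_def])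

lemma vfrac_1_eq_iff:
  "v \<in> carrier_vec n \<Longrightarrow> w \<in> carrier_vec n \<Longrightarrow> vfrac (Suc 0) v = vfrac (Suc 0) w \<longleftrightarrow> red_vec v = red_vec w"
  using vfrac_eq_iff[of v n w "Suc 0"] red_vec_eq_iff[of v n w] by simp

lemma tensor_act_vfrac:
  assumes "g \<in> carrier_mat n n" "v \<in> carrier_vec n"
  shows "tensor_act g (vfrac j v) = vfrac j (g *\<^sub>v v)"
  using assms
  by (intro eq_vecI) (auto simp: tensor_act_def vfrac_def scalar_prod_def atLeast0LessThan qfrac_sum qfrac_scale)

lemma torsion_eq: "torsion n j = vfrac j ` (carrier_vec n :: 'p::prime_card padic_int vec set)" (is "?T = ?F")
proof
  show "?F \<subseteq> ?T"
    by (auto simp: torsion_def scale_vec_vfrac vfrac_eq_0_iff simp del: of_nat_power)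
  show "?T \<subseteq> ?F"
  proof
    fix x assume "x \<in> ?T"
    then have x: "x \<in> carrier_vec n" "scale_vec (ell ^ j) x = 0\<^sub>v n" by (auto simp: torsion_def)
    have "\<exists>a. x $ i = qfrac j a" if "i < n" for i
      using arg_cong[OF x(2), of "\<lambda>v. v $ i"] x(1) that
      by (intro torsion_imp_qfrac) (simp add: scale_vec_def)
    then obtain a where "\<And>i. i < n \<Longrightarrow> x $ i = qfrac j (a i)" by metis
    then have "x = vfrac j (vec n a)" using x(1) by (intro eq_vecI) (auto simp: vfrac_def)
    then show "x \<in> ?F" by auto
  qed
qed

lemma red_vec_smult: "red_vec (c \<cdot>\<^sub>v v) = reduce_padic c \<cdot>\<^sub>v red_vec v"
  by (auto simp: red_vec_def)

text \<open>The class of \<open>v\<close> divided by \<open>ell\<close> depends on \<open>v\<close>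
  modulo \<open>ell\<close> only, so this subgroup is a copy of the reduction of
  \<open>L\<close>.\<close>

lemma dim_F_vfrac:
  assumes L: "submodule_vec n (L :: 'p::prime_card padic_int vec set)"
  shows "CARD('p) ^ dim_F n (vfrac (Suc 0) ` L) = card (red_vec ` L)"
proof -
  let ?M = "\<lparr>carrier = vfrac (Suc 0) ` L, mult = undefined, one = undefined, zero = 0\<^sub>v n, add = (+),
      smult = (\<lambda>c. scale_vec (of_int (to_int_mod_ring c)))\<rparr> :: ('p mod_ring, 'p padic_quot vec) module"
  have Lc: "L \<subseteq> carrier_vec n" using L by (simp add: submodule_vec_def)
  have add: "vfrac (Suc 0) v + vfrac (Suc 0) w = vfrac (Suc 0) (v + w)" if "v \<in> L" "w \<in> L" for v w
    using vfrac_add[of v n w "Suc 0"] subsetD[OF Lc that(1)] subsetD[OF Lc that(2)] by simp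
  have addL: "v + w \<in> L" "c \<cdot>\<^sub>v v \<in> L" if "v \<in> L" "w \<in> L" for v w c
    using that L by (auto simp: submodule_vec_def)
  have zL: "0\<^sub>v n \<in> L" using L by (simp add: submodule_vec_def)
  have smult: "scale_vec (of_int (to_int_mod_ring c)) (vfrac (Suc 0) v) = vfrac (Suc 0) (lift_mod_ring c \<cdot>\<^sub>v v)" for c and v :: "'p padic_int vec"
    by (simp add: scale_vec_vfrac lift_mod_ring_def)
  \<comment> \<open>\<open>lift_mod_ring\<close> respects addition and multiplication only modulo
    \<open>ell\<close>, so the module laws are compared after reduction.\<close>
  have eq: "vfrac (Suc 0) v = vfrac (Suc 0) w \<longleftrightarrow> red_vec v = red_vec w" if "v \<in> L" "w \<in> L" for v w
    using that Lc vfrac_1_eq_iff by blast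
  have car: "v \<in> carrier_vec n" if "v \<in> L" for v using that Lc by auto
  note rs = red_vec_simps(1)[of _ n] red_vec_smult
  have "abelian_group ?M"
  proof (rule abelian_groupI)
    show "x \<oplus>\<^bsub>?M\<^esub> y \<in> carrier ?M" if "x \<in> carrier ?M" "y \<in> carrier ?M" for x y
      using that by (auto simp: add addL)
    show "\<zero>\<^bsub>?M\<^esub> \<in> carrier ?M" using imageI[OF zL, of "vfrac (Suc 0)"] by (simp add: vfrac_zero)
    show "(x \<oplus>\<^bsub>?M\<^esub> y) \<oplus>\<^bsub>?M\<^esub> z = x \<oplus>\<^bsub>?M\<^esub> (y \<oplus>\<^bsub>?M\<^esub> z)"
      if "x \<in> carrier ?M" "y \<in> carrier ?M" "z \<in> carrier ?M" for x y z
      using that car by (auto simp: add addL assoc_add_vec[of _ n])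
    show "x \<oplus>\<^bsub>?M\<^esub> y = y \<oplus>\<^bsub>?M\<^esub> x" if "x \<in> carrier ?M" "y \<in> carrier ?M" for x y
      using that car by (auto simp: add comm_add_vec[of _ n])
    show "\<zero>\<^bsub>?M\<^esub> \<oplus>\<^bsub>?M\<^esub> x = x" if "x \<in> carrier ?M" for x
      using that car by auto
    show "\<exists>y\<in>carrier ?M. y \<oplus>\<^bsub>?M\<^esub> x = \<zero>\<^bsub>?M\<^esub>" if x: "x \<in> carrier ?M" for x
    proof -
      obtain v where v: "v \<in> L" "x = vfrac (Suc 0) v" using x by auto
      have "(- 1) \<cdot>\<^sub>v v + v = 0\<^sub>v n" using car[OF v(1)] by auto
      then have "vfrac (Suc 0) ((- 1) \<cdot>\<^sub>v v) + vfrac (Suc 0) v = 0\<^sub>v n"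
        using add[OF addL(2)[OF v(1) v(1), of "- 1"] v(1)] by (simp add: vfrac_zero)
      then show ?thesis using v addL(2)[OF v(1) v(1), of "- 1"] by auto
    qed
  qed
  have "module (class_ring :: 'p mod_ring ring) ?M"
  proof (rule moduleI)
    show "cring (class_ring :: 'p mod_ring ring)" by (rule class_cring.is_cring)
    show "abelian_group ?M" by fact
    show "a \<odot>\<^bsub>?M\<^esub> x \<in> carrier ?M" if "x \<in> carrier ?M" for a x
      using that by (auto simp: smult addL)
    show "(a \<oplus>\<^bsub>class_ring\<^esub> b) \<odot>\<^bsub>?M\<^esub> x = (a \<odot>\<^bsub>?M\<^esub> x) \<oplus>\<^bsub>?M\<^esub> (b \<odot>\<^bsub>?M\<^esub> x)"
      if "x \<in> carrier ?M" for a b x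
      using that car by (auto simp: smult add addL eq rs add_smult_distrib_vec)
    show "a \<odot>\<^bsub>?M\<^esub> (x \<oplus>\<^bsub>?M\<^esub> y) = (a \<odot>\<^bsub>?M\<^esub> x) \<oplus>\<^bsub>?M\<^esub> (a \<odot>\<^bsub>?M\<^esub> y)"
      if "x \<in> carrier ?M" "y \<in> carrier ?M" for a x y
      using that car by (auto simp: smult add addL eq rs smult_add_distrib_vec[of _ n])
    show "(a \<otimes>\<^bsub>class_ring\<^esub> b) \<odot>\<^bsub>?M\<^esub> x = a \<odot>\<^bsub>?M\<^esub> (b \<odot>\<^bsub>?M\<^esub> x)" if "x \<in> carrier ?M" for a b x
      using that car by (auto simp: smult add addL eq rs smult_smult_assoc)
    show "\<one>\<^bsub>class_ring\<^esub> \<odot>\<^bsub>?M\<^esub> x = x" if "x \<in> carrier ?M" for x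
      using that by (auto simp: scale_vec_vfrac)
  qed
  then interpret M: vectorspace "class_ring :: 'p mod_ring ring" ?M
    by (intro vectorspace.intro class_field)
  have "finite (red_vec ` L)"
    by (rule finite_subset[of _ "carrier_vec n"]) (use Lc in auto)
  moreover have card: "card (vfrac (Suc 0) ` L) = card (red_vec ` L)"
    by (rule card_image_eq_if_same_fibers) (use eq in auto)
  moreover have "red_vec ` L \<noteq> {}" using zL by auto
  ultimately have "finite (vfrac (Suc 0) ` L)" by (metis card_gt_0_iff)
  then have "card (vfrac (Suc 0) ` L) = CARD('p) ^ M.dim" using M.card_eq_power_dim by simp
  then show ?thesis using card by (simp add: dim_F_def)
qed

text \<open>The kernel on the \<open>ell ^ j\<close> torsion consists of the fractions
  \<open>x / ell^j\<close> with \<open>x\<close> in the layer, and multiplication by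
  \<open>ell ^ (j - 1)\<close> leaves \<open>x / ell\<close>.\<close>

lemma (in quadratic_space) layer_dim_card:
  assumes g: "g \<in> OV" and j: "1 \<le> j"
  shows "CARD('p) ^ layer_dim n j g = card (red_vec ` layer j g)"
proof -
  have "kernel_on_torsion n j g = vfrac j ` layer j g"
  proof -
    have "tensor_act g (vfrac j v) - vfrac j v = 0\<^sub>v n \<longleftrightarrow> v \<in> layer j g" if v: "v \<in> V" for v
    proof -
      have "tensor_act g (vfrac j v) - vfrac j v = vfrac j (disp g v)"
        unfolding tensor_act_vfrac[OF OV_D(1)[OF g] v] disp_def
        by (rule vfrac_diff[symmetric, of _ n]) (use v g OV_carrier in auto)
      then show ?thesis using vfrac_eq_0_iff[OF disp_carrier[OF g v], of j] v by (simp add: layer_def)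
    qed
    then show ?thesis using layer_subset by (auto simp: kernel_on_torsion_def torsion_eq image_iff) blast
  qed
  then have "scale_vec (ell ^ (j - 1)) ` kernel_on_torsion n j g = vfrac (Suc 0) ` layer j g"
    using scale_vec_vfrac_down[OF j] by (auto simp: image_image simp del: of_nat_power)
  then show ?thesis unfolding layer_dim_def using dim_F_vfrac[OF submodule_layer[OF g]] by simp
qed

lemma prime_card_power_inject: "CARD('p::prime_card) ^ a = CARD('p) ^ b \<longleftrightarrow> a = b"
  using card_gt_1[where ?'p = 'p] by (simp add: power_inject_exp)

section \<open>Haar measure and unions of cosets\<close>

lemma finite_mats:
  assumes "finite S"
  shows "finite {A \<in> carrier_mat n m. \<forall>i<n. \<forall>j<m. A $$ (i, j) \<in> S}"
proof (rule finite_subset)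
  show "{A \<in> carrier_mat n m. \<forall>i<n. \<forall>j<m. A $$ (i, j) \<in> S}
    \<subseteq> (\<lambda>f. mat n m f) ` (({..<n} \<times> {..<m}) \<rightarrow>\<^sub>E S)"
  proof
    fix A assume A: "A \<in> {A \<in> carrier_mat n m. \<forall>i<n. \<forall>j<m. A $$ (i, j) \<in> S}"
    then have "A = mat n m (restrict (\<lambda>p. A $$ p) ({..<n} \<times> {..<m}))" by (intro eq_matI) auto
    moreover have "restrict (\<lambda>p. A $$ p) ({..<n} \<times> {..<m}) \<in> ({..<n} \<times> {..<m}) \<rightarrow>\<^sub>E S" using A by auto
    ultimately show "A \<in> (\<lambda>f. mat n m f) ` (({..<n} \<times> {..<m}) \<rightarrow>\<^sub>E S)" by (rule image_eqI)
  qed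
  show "finite ((\<lambda>f. mat n m f) ` (({..<n} \<times> {..<m}) \<rightarrow>\<^sub>E S))"
    using assms by (intro finite_imageI finite_PiE) auto
qed

lemma finite_alternating_forms: "finite (alternating_forms r :: 'p::prime_card mod_ring mat set)"
  by (rule finite_subset[OF _ finite_mats[of UNIV r r]]) (auto simp: alternating_forms_def)

lemma zero_alternating_form: "(0\<^sub>m r r :: 'a::comm_ring_1 mat) \<in> alternating_forms r"
proof -
  have "0\<^sub>m r r *\<^sub>v v = 0\<^sub>v r" if "v \<in> carrier_vec r" for v :: "'a::comm_ring_1 vec"
    using that by (intro eq_vecI) auto
  then show ?thesis by (simp add: alternating_forms_def)
qed

lemma alternating_forms_diff:
  assumes "A \<in> alternating_forms r" "A' \<in> alternating_forms r"
  shows "A' - A \<in> alternating_forms (r :: nat)" "A + (A' - A) = (A' :: 'a::comm_ring_1 mat)"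
proof -
  have c: "A \<in> carrier_mat r r" "A' \<in> carrier_mat r r" using assms by (auto simp: alternating_forms_def)
  show "A + (A' - A) = A'" using c by (intro eq_matI) auto
  show "A' - A \<in> alternating_forms r"
    unfolding alternating_forms_def
  proof (intro CollectI conjI ballI)
    fix v :: "'a vec" assume v: "v \<in> carrier_vec r"
    have "(A' - A) *\<^sub>v v = A' *\<^sub>v v - A *\<^sub>v v" by (rule minus_mult_distrib_mat_vec[OF c(2) c(1) v])
    then have "v \<bullet> ((A' - A) *\<^sub>v v) = v \<bullet> (A' *\<^sub>v v) - v \<bullet> (A *\<^sub>v v)"
      using c v by (simp add: scalar_prod_minus_distrib[of v r])
    then show "v \<bullet> ((A' - A) *\<^sub>v v) = 0" using assms v by (simp add: alternating_forms_def)
  qed (use c in auto)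
qed

definition alternating_kernel_prob :: "'a::field itself \<Rightarrow> nat \<Rightarrow> nat \<Rightarrow> real" where
  "alternating_kernel_prob _ r k =
     measure_pmf.prob (pmf_of_set (alternating_forms r :: 'a mat set)) {A. kernel_dim A = k}"

lemma alternating_kernel_prob_eq:
  "alternating_kernel_prob TYPE('p::prime_card mod_ring) r k
    = card {A \<in> alternating_forms r :: 'p mod_ring mat set. kernel_dim A = k}
    / card (alternating_forms r :: 'p mod_ring mat set)"
proof -
  have "alternating_forms r \<noteq> ({} :: 'p mod_ring mat set)" using zero_alternating_form by blast
  then show ?thesis
    using finite_alternating_forms[where ?'p = 'p] unfolding alternating_kernel_prob_def
    by (subst measure_pmf_of_set) (auto simp: Int_def)
qed

context quadratic_space
begin

lemma mcong_reduce_padic: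
  assumes "g \<in> OV" "h \<in> OV" "mcong (Suc 0) g h"
  shows "map_mat reduce_padic (g - 1\<^sub>m n) = map_mat reduce_padic (h - 1\<^sub>m n)"
proof -
  have c: "g \<in> carrier_mat n n" "h \<in> carrier_mat n n" using assms OV_D by auto
  have eq: "reduce_mat (Suc 0) g = reduce_mat (Suc 0) h" using assms reduce_mat_eq_iff[OF c] by simp
  have "reduce_padic (g $$ (i, j)) = reduce_padic (h $$ (i, j))" if "i < n" "j < n" for i j
    using arg_cong[OF eq, of "\<lambda>A. A $$ (i, j)"] that c by (simp add: reduce_mat_def reduce_padic_def)
  then show ?thesis using c by (intro eq_matI) auto
qed

text \<open>The Dickson invariant is read off modulo \<open>ell\<close>, where \<open>w * k\<close>
  and \<open>w\<close> agree.\<close>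

lemma Omega_mult:
  assumes w: "w \<in> Omega n Q" and k: "k \<in> OV" "spin k" "mcong (Suc 0) k (1\<^sub>m n)"
  shows "w * k \<in> Omega n Q"
proof -
  have wO: "w \<in> OV" "dickson_invariant n w = 0" "spin w"
    using w by (auto simp: Omega_def one_in_neg_spinor_norm_iff)
  have "mcong (Suc 0) (w * k) (w * 1\<^sub>m n)" using wO k OV_one by (intro mcong_mult_left) auto
  then have "mcong (Suc 0) (w * k) w" using OV_D(1)[OF wO(1)] by simp
  then have "dickson_invariant n (w * k) = 0"
    using mcong_reduce_padic[OF OV_mult[OF wO(1) k(1)] wO(1)] wO(2) by (simp add: dickson_invariant_def)
  then show ?thesis
    using OV_mult[OF wO(1) k(1)] spin_mult[OF wO(3) k(2) OV_D(1)[OF wO(1)] OV_D(1)[OF k(1)]]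
    by (simp add: Omega_def one_in_neg_spinor_norm_iff)
qed

lemma beta_cong:
  assumes g: "g \<in> OV" and h: "h \<in> OV" and cong: "mcong (Suc j) g h" and x: "x \<in> layer j g" and y: "y \<in> V"
  shows "beta j g x y = beta j h x y"
proof -
  have "layer j g = layer j h" using layer_cong[OF g h] mcong_le[OF cong, of j] by simp
  then have xh: "x \<in> layer j h" using x by simp
  obtain u where u: "x \<in> V" "u \<in> V" "disp g x = ell ^ j \<cdot>\<^sub>v u" using x g by (auto simp: layer_iff)
  obtain u' where u': "u' \<in> V" "disp h x = ell ^ j \<cdot>\<^sub>v u'" using xh h by (auto simp: layer_iff)
  have gx: "g *\<^sub>v x \<in> V" "h *\<^sub>v x \<in> V" using g h u OV_carrier by auto
  have "vdvd (ell ^ Suc j) (g *\<^sub>v x - h *\<^sub>v x)" using cong u by (simp add: mcong_def)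
  also have "g *\<^sub>v x - h *\<^sub>v x = disp g x - disp h x"
    unfolding disp_def using gx u(1) vec_diff_add_diff(2)[OF gx(1) u(1) gx(2) u(1)] by (auto simp: vec_eq_iff)
  also have "\<dots> = ell ^ j \<cdot>\<^sub>v (u - u')" unfolding u(3) u'(2) using u u' by (simp add: smult_diff_distrib_vec[of _ n])
  finally have "vdvd (ell ^ j * ell) (ell ^ j \<cdot>\<^sub>v (u - u'))" by (simp add: mult.commute)
  then have "vdvd ell (u - u')" by (simp add: vdvd_smult_cancel)
  then have "red_vec u = red_vec u'" using u u' red_vec_eq_iff by blast
  then show ?thesis using reduce_B_cong[OF u(2) u'(1) y] beta_eq[OF u(2,3) y] beta_eq[OF u' y] by simp
qed

lemma layer_dim_le:
  assumes g: "g \<in> OV" and j: "1 \<le> j"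
  shows "layer_dim n j g \<le> n"
proof -
  have "CARD('p) ^ layer_dim n j g \<le> card (carrier_vec n :: 'p mod_ring vec set)"
    unfolding layer_dim_card[OF g j] by (rule card_mono) (auto dest: subsetD[OF layer_subset])
  then show ?thesis using card_gt_1[where ?'p = 'p] by (simp add: card_carrier_vec power_increasing_iff)
qed

lemma layer_dim_antimono:
  assumes g: "g \<in> OV" and ij: "1 \<le> i" "i \<le> j"
  shows "layer_dim n j g \<le> layer_dim n i g"
proof -
  have "CARD('p) ^ layer_dim n j g \<le> CARD('p) ^ layer_dim n i g"
    unfolding layer_dim_card[OF g ij(1)] layer_dim_card[OF g order.trans[OF ij]]
  proof (rule card_mono)
    show "finite (red_vec ` layer i g)"
      by (rule finite_subset[of _ "carrier_vec n"]) (auto dest: subsetD[OF layer_subset])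
  qed (rule image_mono[OF layer_antimono[OF ij(2)]])
  then show ?thesis using card_gt_1[where ?'p = 'p] by (simp add: power_increasing_iff)
qed

lemma layer_dim_cong:
  assumes "g \<in> OV" "h \<in> OV" "mcong j g h" "1 \<le> j"
  shows "layer_dim n j g = layer_dim n j h"
  using layer_dim_card[of g j] layer_dim_card[of h j] layer_cong[of g h j] assms
  by (metis prime_card_power_inject)

end

section \<open>Haar measure of sets determined modulo a power of \<open>ell\<close>\<close>

locale haar_space = quadratic_space +
  fixes M :: "'a padic_int mat measure"
  assumes haar: "haar_measure n Q M"
begin

abbreviation OVmod where "OVmod e \<equiv> orthogonal_group_mod n Q e"

lemma space_M: "space M = OV"
  using haar by (simp add: haar_measure_def)

lemma finite_OVmod: "finite (OVmod e)"
proof (rule finite_subset)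
  show "OVmod e \<subseteq> {A \<in> carrier_mat n n. \<forall>i<n. \<forall>j<n. A $$ (i, j) \<in> {0..<int CARD('a) ^ e}}"
    using residue_padic_range by (auto simp: orthogonal_group_mod_def reduce_mat_def)
  show "finite {A \<in> carrier_mat n n. \<forall>i<n. \<forall>j<n. A $$ (i, j) \<in> {0..<int CARD('a) ^ e}}"
    by (rule finite_mats) simp
qed

lemma reduce_mat_in_OVmod:
  assumes g: "g \<in> OV"
  shows "reduce_mat e g \<in> OVmod e"
proof -
  obtain h where h: "h \<in> OV" "h * g = 1\<^sub>m n" "g * h = 1\<^sub>m n" using OV_inverse[OF g] .
  show ?thesis
    unfolding orthogonal_group_mod_def
    using g h OV_D[of g] OV_D[of h] by (intro imageI CollectI conjI) (auto intro!: bexI[of _ h])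
qed

lemma measurable_reduce_mat: "reduce_mat e \<in> measurable M (count_space (OVmod e))"
proof -
  have "reduce_mat e -` {A} \<inter> OV \<in> sets M" for A
  proof -
    have "reduce_mat e -` {A} \<inter> OV \<in> {reduce_mat e -` {A} \<inter> OV | e A. True}" by blast
    then show ?thesis using haar by (auto simp: haar_measure_def intro: sigma_sets.Basic)
  qed
  then show ?thesis
    unfolding measurable_count_space_eq2[OF finite_OVmod] using reduce_mat_in_OVmod by (auto simp: space_M)
qed

lemma emeasure_reduce_mat:
  assumes "T \<subseteq> OVmod e"
  shows "emeasure M (reduce_mat e -` T \<inter> OV) = ennreal (card T / card (OVmod e))"
proof -
  have "emeasure M (reduce_mat e -` T \<inter> OV) = emeasure (distr M (count_space (OVmod e)) (reduce_mat e)) T"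
    using emeasure_distr[OF measurable_reduce_mat, of T e] assms by (simp add: space_M)
  also have "\<dots> = emeasure (uniform_count_measure (OVmod e)) T"
    using haar by (simp add: haar_measure_def)
  finally show ?thesis using emeasure_uniform_count_measure[OF finite_OVmod assms] by simp
qed

sublocale prob_space M
proof
  have "reduce_mat 0 -` OVmod 0 \<inter> OV = OV" using reduce_mat_in_OVmod by auto
  moreover have "card (OVmod 0) \<noteq> 0" using reduce_mat_in_OVmod[OF OV_one, of 0] finite_OVmod[of 0] by auto
  ultimately show "emeasure M (space M) = 1" using emeasure_reduce_mat[of "OVmod 0" 0] by (simp add: space_M)
qed

text \<open>Preimages of sets of residues modulo \<open>ell ^ e\<close>. Their measure is a ratio of
  cardinalities, and all events that occur are of this kind.\<close>

definition saturated :: "nat \<Rightarrow> 'a padic_int mat set \<Rightarrow> bool" where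
  "saturated e S \<longleftrightarrow> S \<subseteq> OV \<and> (\<forall>g\<in>S. \<forall>h\<in>OV. mcong e g h \<longrightarrow> h \<in> S)"

lemma saturated_le: "saturated e S \<Longrightarrow> e \<le> e' \<Longrightarrow> saturated e' S"
  unfolding saturated_def using mcong_le by blast

lemma saturated_Int: "saturated e S \<Longrightarrow> saturated e T \<Longrightarrow> saturated e (S \<inter> T)"
  unfolding saturated_def by blast

lemma saturated_eq:
  assumes "saturated e S"
  shows "S = reduce_mat e -` (reduce_mat e ` S) \<inter> OV" "reduce_mat e ` S \<subseteq> OVmod e"
proof -
  have "h \<in> S" if "h \<in> OV" "g \<in> S" "reduce_mat e h = reduce_mat e g" for g h
    using that assms reduce_mat_eq_iff[OF OV_D(1) OV_D(1), of g h e] unfolding saturated_def by auto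
  then show "S = reduce_mat e -` (reduce_mat e ` S) \<inter> OV" using assms unfolding saturated_def by blast
  show "reduce_mat e ` S \<subseteq> OVmod e" using assms reduce_mat_in_OVmod unfolding saturated_def by blast
qed

lemma saturated_sets: "saturated e S \<Longrightarrow> S \<in> sets M"
  using measurable_sets[OF measurable_reduce_mat, of "reduce_mat e ` S" e] saturated_eq[of e S]
  by (simp add: space_M)

lemma measure_saturated:
  assumes "saturated e S"
  shows "measure M S = card (reduce_mat e ` S) / card (OVmod e)"
  using emeasure_reduce_mat[OF saturated_eq(2)[OF assms]] saturated_eq(1)[OF assms]
  by (simp add: measure_def)

lemma measure_saturated_pos:
  assumes "saturated e S" "S \<noteq> {}"
  shows "0 < measure M S"
proof -
  have "finite (reduce_mat e ` S)" using finite_subset[OF saturated_eq(2)[OF assms(1)] finite_OVmod] .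
  moreover have "OVmod e \<noteq> {}" using saturated_eq(2)[OF assms(1)] assms(2) by auto
  ultimately show ?thesis
    unfolding measure_saturated[OF assms(1)] using assms(2) finite_OVmod[of e] by (simp add: card_gt_0_iff)
qed

text \<open>Right translation by \<open>k\<close> is injective on residue classes, so counting them
  gives the inequality. Used in both directions it takes the place of invariance of the
  measure.\<close>

lemma measure_saturated_mult_le:
  assumes S: "saturated e S" and T: "saturated e T" and k: "k \<in> OV" and ST: "\<And>g. g \<in> S \<Longrightarrow> g * k \<in> T"
  shows "measure M S \<le> measure M T"
proof -
  have fin: "finite (reduce_mat e ` T)" using finite_subset[OF saturated_eq(2)[OF T] finite_OVmod] .
  obtain k' where k': "k' \<in> OV" "k * k' = 1\<^sub>m n" using OV_inverse[OF k] by metis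
  define rep where "rep A = inv_into S (reduce_mat e) A" for A
  have rep: "rep A \<in> S" "reduce_mat e (rep A) = A" if "A \<in> reduce_mat e ` S" for A
    using that by (auto simp: rep_def intro: inv_into_into f_inv_into_f)
  have SO: "S \<subseteq> OV" using S by (simp add: saturated_def)
  have "inj_on (\<lambda>A. reduce_mat e (rep A * k)) (reduce_mat e ` S)"
  proof (rule inj_onI)
    fix A A' assume A: "A \<in> reduce_mat e ` S" "A' \<in> reduce_mat e ` S"
      and eq: "reduce_mat e (rep A * k) = reduce_mat e (rep A' * k)"
    have r: "rep A \<in> OV" "rep A' \<in> OV" using rep(1) A SO by auto
    have "mcong e (rep A * k) (rep A' * k)"
      using eq reduce_mat_eq_iff[OF OV_D(1) OV_D(1)] OV_mult r k by blast
    then have "mcong e (rep A * k * k') (rep A' * k * k')"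
      by (rule mcong_mult_right[OF _ OV_mult[OF r(1) k] OV_mult[OF r(2) k] k'(1)])
    moreover have "g * k * k' = g" if "g \<in> OV" for g
      using assoc_mult_mat[OF OV_D(1)[OF that] OV_D(1)[OF k] OV_D(1)[OF k'(1)]] k'(2) OV_D(1)[OF that] by simp
    ultimately have "mcong e (rep A) (rep A')" using r by simp
    then have "reduce_mat e (rep A) = reduce_mat e (rep A')" using reduce_mat_eq_iff[OF OV_D(1) OV_D(1)] r by blast
    then show "A = A'" using rep(2) A by simp
  qed
  then have "card (reduce_mat e ` S) \<le> card (reduce_mat e ` T)"
    by (rule card_inj_on_le[OF _ _ fin]) (use rep(1) ST in auto)
  then show ?thesis unfolding measure_saturated[OF S] measure_saturated[OF T] by (simp add: divide_right_mono)
qed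

end

section \<open>Conditional law of the next dimension\<close>

locale haar_coset_union = haar_space +
  fixes H :: "'a padic_int mat set"
  assumes cosets: "union_of_cosets_Omega n Q H" and H_nonempty: "H \<noteq> {}"
begin

lemma H_mult:
  assumes h: "h \<in> H" and k: "k \<in> OV" "spin k" "mcong (Suc 0) k (1\<^sub>m n)"
  shows "h * k \<in> H"
proof -
  obtain S where S: "S \<subseteq> OV" "H = (\<Union>h\<in>S. (\<lambda>w. h * w) ` Omega n Q)"
    using cosets unfolding union_of_cosets_Omega_def by blast
  then obtain s w where sw: "s \<in> S" "w \<in> Omega n Q" "h = s * w" using h by auto
  have O: "s \<in> OV" "w \<in> OV" using sw S by (auto simp: Omega_def)
  have "h * k = s * (w * k)"
    using assoc_mult_mat[OF OV_D(1)[OF O(1)] OV_D(1)[OF O(2)] OV_D(1)[OF k(1)]] sw by simp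
  then show ?thesis using S sw Omega_mult[OF sw(2) k] by auto
qed

lemma H_subset: "H \<subseteq> OV"
proof -
  obtain S where "S \<subseteq> OV" "H = (\<Union>h\<in>S. (\<lambda>w. h * w) ` Omega n Q)"
    using cosets unfolding union_of_cosets_Omega_def by blast
  then show ?thesis using OV_mult by (auto simp: Omega_def)
qed

text \<open>If \<open>h'\<close> is close to \<open>h\<close> and \<open>i\<close> inverts
  \<open>h\<close>, then \<open>i * h'\<close> is close to the identity, so \<open>spin\<close> by
  \<open>spin_open\<close>; the 1 in \<open>max 1 e\<close> preserves the Dickson invariant. Hence
  \<open>h' = h * (i * h')\<close> stays in \<open>H\<close>.\<close>

lemma saturated_H: "\<exists>e. saturated e H"
proof -
  obtain e where e: "\<And>g. g \<in> OV \<Longrightarrow> mcong e g (1\<^sub>m n) \<Longrightarrow> spin g" using spin_open by blast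
  have "h' \<in> H" if h: "h \<in> H" and h': "h' \<in> OV" and cong: "mcong (max 1 e) h h'" for h h'
  proof -
    have hO: "h \<in> OV" using h H_subset by blast
    obtain i where i: "i \<in> OV" "i * h = 1\<^sub>m n" "h * i = 1\<^sub>m n" using OV_inverse[OF hO] .
    have ih': "i * h' \<in> OV" using i h' OV_mult by blast
    have "mcong (max 1 e) (i * h) (i * h')" using i hO h' cong by (intro mcong_mult_left)
    then have c: "mcong (max 1 e) (i * h') (1\<^sub>m n)" using mcong_sym[OF one_carrier_mat OV_D(1)[OF ih']] i by simp
    have "h * (i * h') \<in> H"
      by (rule H_mult[OF h ih']) (use e[OF ih'] mcong_le[OF c] in auto)
    moreover have "h * (i * h') = h'"
      using assoc_mult_mat[OF OV_D(1)[OF hO] OV_D(1)[OF i(1)] OV_D(1)[OF h']] i OV_D(1)[OF h'] by simp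
    ultimately show ?thesis by simp
  qed
  then show ?thesis using H_subset unfolding saturated_def by blast
qed

text \<open>The residue class of \<open>g0\<close> modulo \<open>ell ^ i\<close> fixes the layer and
  its frame while the Gram matrix still varies. Translations from \<open>gram_transitive\<close>
  stay in \<open>H\<close> and in this class and carry any Gram matrix to any other, so all
  alternating matrices are equally likely.\<close>

lemma measure_class:
  assumes g0: "g0 \<in> H" and i: "1 \<le> i" and r: "layer_dim n i g0 = r" and cond: "odd CARD('a) \<or> r \<noteq> n"
  shows "measure M {g \<in> H. mcong i g g0 \<and> layer_dim n (Suc i) g = k}
    = measure M {g \<in> H. mcong i g g0} * alternating_kernel_prob TYPE('a mod_ring) r k"
proof -
  have g0O: "g0 \<in> OV" using g0 H_subset by blast
  let ?L = "layer i g0"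
  obtain r' \<iota> wv where fr': "frame n ?L r' \<iota> wv" using frame_exists[OF submodule_layer[OF g0O]] by blast
  have "CARD('a) ^ r' = CARD('a) ^ r" using frame_card[OF fr'] layer_dim_card[OF g0O i] r by simp
  then have fr: "frame n ?L r \<iota> wv" using fr' prime_card_power_inject by metis
  define C where "C = {g \<in> H. mcong i g g0}"
  define CA where "CA A = {g \<in> C. gram i g r wv = A}" for A
  let ?Alt = "alternating_forms r :: 'a mod_ring mat set"
  have CO: "g \<in> OV" "layer i g = ?L" if "g \<in> C" for g
    using that H_subset layer_cong[OF _ g0O] by (auto simp: C_def)
  obtain e0 where e0: "saturated e0 H" using saturated_H ..
  \<comment> \<open>\<open>e0\<close> decides membership in \<open>H\<close>; the Gram matrix,
    obtained after division by \<open>ell ^ i\<close>, depends on one digit more than the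
    class.\<close>
  define e where "e = max e0 (Suc i)"
  have satCA: "saturated e (CA A)" for A
    unfolding saturated_def
  proof (intro conjI ballI impI)
    show "CA A \<subseteq> OV" using CO by (auto simp: CA_def)
    fix g h assume g: "g \<in> CA A" and h: "h \<in> OV" and cong: "mcong e g h"
    have gO: "g \<in> OV" "g \<in> H" "mcong i g g0" "gram i g r wv = A" using g CO by (auto simp: CA_def C_def)
    have c1: "mcong (Suc i) g h" using mcong_le[OF cong] by (simp add: e_def)
    have "h \<in> H" using e0 gO(2) h mcong_le[OF cong, of e0] by (auto simp: saturated_def e_def)
    moreover have "mcong i h g0"
      using mcong_trans[OF OV_D(1)[OF h] OV_D(1)[OF gO(1)] OV_D(1)[OF g0O]]
        mcong_sym[OF OV_D(1)[OF gO(1)] OV_D(1)[OF h] mcong_le[OF c1, of i]] gO(3) by simp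
    moreover have "gram i h r wv = A"
    proof -
      have "beta i g (wv b) (wv a) = beta i h (wv b) (wv a)" if "a < r" "b < r" for a b
        using beta_cong[OF gO(1) h c1] frame_D(3,6)[OF fr] that CO(2)[of g] g by (auto simp: CA_def)
      then have "gram i g r wv = gram i h r wv" unfolding gram_def by (intro eq_matI) auto
      then show ?thesis using gO(4) by simp
    qed
    ultimately show "h \<in> CA A" by (simp add: CA_def C_def)
  qed
  have le: "measure M (CA A) \<le> measure M (CA A')" if A: "A \<in> ?Alt" "A' \<in> ?Alt" for A A'
  proof -
    obtain k where k: "k \<in> OV" "spin k" "mcong i k (1\<^sub>m n)"
      "\<And>g. g \<in> OV \<Longrightarrow> layer i g = ?L \<Longrightarrow> gram i (g * k) r wv = gram i g r wv + (A' - A)"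
      using gram_transitive[OF i fr cond alternating_forms_diff(1)[OF A]] by blast
    show ?thesis
    proof (rule measure_saturated_mult_le[OF satCA satCA k(1)])
      fix g assume g: "g \<in> CA A"
      then have gC: "g \<in> C" "g \<in> H" "mcong i g g0" "gram i g r wv = A" by (auto simp: CA_def C_def)
      have gO: "g \<in> OV" using CO gC by blast
      have gk: "g * k \<in> OV" using gO k OV_mult by blast
      have "mcong i (g * k) (g * 1\<^sub>m n)" using gO k OV_one by (intro mcong_mult_left) auto
      then have "mcong i (g * k) g" using OV_D(1)[OF gO] by simp
      then have "mcong i (g * k) g0"
        using mcong_trans[OF OV_D(1)[OF gk] OV_D(1)[OF gO] OV_D(1)[OF g0O]] gC(3) by blast
      moreover have "g * k \<in> H" using H_mult[OF gC(2) k(1,2)] mcong_le[OF k(3)] i by simp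
      moreover have "gram i (g * k) r wv = A'"
        using k(4)[OF gO CO(2)[OF gC(1)]] gC(4) alternating_forms_diff(2)[OF A] by simp
      ultimately show "g * k \<in> CA A'" by (simp add: CA_def C_def)
    qed
  qed
  define c where "c = measure M (CA (0\<^sub>m r r))"
  have c: "measure M (CA A) = c" if "A \<in> ?Alt" for A
    using le[OF that zero_alternating_form] le[OF zero_alternating_form that] by (simp add: c_def)
  have union: "measure M (\<Union>A\<in>T. CA A) = card T * c" if "T \<subseteq> ?Alt" for T
  proof -
    have "measure M (\<Union>A\<in>T. CA A) = (\<Sum>A\<in>T. measure M (CA A))"
      using finite_subset[OF that finite_alternating_forms] saturated_sets[OF satCA]
      by (intro finite_measure_finite_Union) (auto simp: disjoint_family_on_def CA_def)
    also have "\<dots> = (\<Sum>A\<in>T. c)" by (rule sum.cong) (use c that in auto)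
    finally show ?thesis by simp
  qed
  have alt: "gram i g r wv \<in> ?Alt" "kernel_dim (gram i g r wv) = layer_dim n (Suc i) g" if "g \<in> C" for g
  proof -
    have frg: "frame n (layer i g) r \<iota> wv" using fr CO(2)[OF that] by simp
    show "gram i g r wv \<in> ?Alt" by (rule gram_alternating[OF CO(1)[OF that] i frg])
    have "CARD('a) ^ kernel_dim (gram i g r wv) = CARD('a) ^ layer_dim n (Suc i) g"
      using card_mat_kernel[OF gram_carrier, of i g r wv] card_mat_kernel_gram[OF CO(1)[OF that] i frg]
        layer_dim_card[OF CO(1)[OF that], of "Suc i"] by simp
    then show "kernel_dim (gram i g r wv) = layer_dim n (Suc i) g" using prime_card_power_inject by metis
  qed
  have "C = (\<Union>A\<in>?Alt. CA A)" using alt(1) by (auto simp: CA_def)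
  then have mC: "measure M C = card ?Alt * c" using union[of ?Alt] by simp
  have "{g \<in> H. mcong i g g0 \<and> layer_dim n (Suc i) g = k} = (\<Union>A\<in>{A \<in> ?Alt. kernel_dim A = k}. CA A)"
    using alt by (auto simp: CA_def C_def)
  then have "measure M {g \<in> H. mcong i g g0 \<and> layer_dim n (Suc i) g = k} = card {A \<in> ?Alt. kernel_dim A = k} * c"
    using union[of "{A \<in> ?Alt. kernel_dim A = k}"] by simp
  moreover have "card ?Alt \<noteq> 0"
    using zero_alternating_form[of r] finite_alternating_forms[of r] by (metis card_eq_0_iff empty_iff)
  ultimately show ?thesis using mC by (simp add: alternating_kernel_prob_eq C_def)
qed

text \<open>Sums \<open>measure_class\<close> over the residue classes in \<open>E\<close>. The
  factor depends on \<open>E\<close> through \<open>r\<close> only; since \<open>E\<close> may be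
  the whole history or just the last value, this contains the Markov property.\<close>

lemma measure_layer_dim_Suc:
  assumes E: "saturated i E" and i: "1 \<le> i" and r: "\<And>g. g \<in> E \<Longrightarrow> layer_dim n i g = r"
    and cond: "odd CARD('a) \<or> r \<noteq> n"
  shows "measure M {g \<in> H \<inter> E. layer_dim n (Suc i) g = k} = measure M (H \<inter> E) * alternating_kernel_prob TYPE('a mod_ring) r k"
proof -
  obtain e0 where e0: "saturated e0 H" using saturated_H ..
  define e where "e = max e0 (Suc i)"
  have EO: "E \<subseteq> OV" using E by (simp add: saturated_def)
  let ?T = "reduce_mat i ` (H \<inter> E)"
  have fin: "finite ?T"
    by (rule finite_subset[OF _ finite_OVmod[of i]]) (use EO reduce_mat_in_OVmod in auto)
  define rep where "rep A = inv_into (H \<inter> E) (reduce_mat i) A" for A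
  have rep: "rep A \<in> H \<inter> E" "reduce_mat i (rep A) = A" if "A \<in> ?T" for A
    unfolding rep_def using inv_into_into[OF that] f_inv_into_f[OF that] by auto
  define Cl where "Cl A = {g \<in> H. mcong i g (rep A)}" for A
  define Ck where "Ck A = {g \<in> H. mcong i g (rep A) \<and> layer_dim n (Suc i) g = k}" for A
  have iff: "mcong i g h \<longleftrightarrow> reduce_mat i g = reduce_mat i h" if "g \<in> OV" "h \<in> OV" for g h
    using reduce_mat_eq_iff[OF OV_D(1) OV_D(1)] that by blast
  have ClE: "g \<in> E \<and> reduce_mat i g = A" if A: "A \<in> ?T" and g: "g \<in> Cl A" for A g
  proof -
    have O: "g \<in> OV" "rep A \<in> OV" "rep A \<in> E" using g rep(1)[OF A] H_subset EO by (auto simp: Cl_def)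
    have cong: "mcong i g (rep A)" using g by (simp add: Cl_def)
    then have "mcong i (rep A) g" by (rule mcong_sym[OF OV_D(1)[OF O(1)] OV_D(1)[OF O(2)]])
    then have "g \<in> E" using E O(1,3) by (simp add: saturated_def)
    then show ?thesis using cong iff[OF O(1,2)] rep(2)[OF A] by simp
  qed
  have memCl: "g \<in> Cl (reduce_mat i g)" if "g \<in> H \<inter> E" for g
  proof -
    have "reduce_mat i g \<in> ?T" using that by blast
    from rep[OF this] show ?thesis using that iff H_subset by (auto simp: Cl_def subset_iff)
  qed
  have sat: "saturated e (Cl A)" "saturated e (Ck A)" if A: "A \<in> ?T" for A
  proof -
    have rO: "rep A \<in> OV" using rep(1)[OF A] H_subset by auto
    have s1: "saturated e H" using saturated_le[OF e0] by (simp add: e_def)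
    have "saturated i {g \<in> OV. mcong i g (rep A)}"
      using rO by (auto simp: saturated_def iff)
    then have s2: "saturated e {g \<in> OV. mcong i g (rep A)}" by (rule saturated_le) (simp add: e_def)
    have "saturated (Suc i) {g \<in> OV. layer_dim n (Suc i) g = k}"
      using layer_dim_cong[of _ _ "Suc i"] by (auto simp: saturated_def)
    then have s3: "saturated e {g \<in> OV. layer_dim n (Suc i) g = k}" by (rule saturated_le) (simp add: e_def)
    have "Cl A = H \<inter> {g \<in> OV. mcong i g (rep A)}" using H_subset by (auto simp: Cl_def)
    then show "saturated e (Cl A)" using saturated_Int[OF s1 s2] by simp
    have "Ck A = H \<inter> {g \<in> OV. mcong i g (rep A)} \<inter> {g \<in> OV. layer_dim n (Suc i) g = k}"
      using H_subset by (auto simp: Ck_def)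
    then show "saturated e (Ck A)" using saturated_Int[OF saturated_Int[OF s1 s2] s3] by simp
  qed
  have CkCl: "Ck A = {g \<in> Cl A. layer_dim n (Suc i) g = k}" for A
    by (auto simp: Cl_def Ck_def)
  have HE: "H \<inter> E = (\<Union>A\<in>?T. Cl A)"
  proof (intro equalityI subsetI)
    fix g assume g: "g \<in> H \<inter> E"
    then have "reduce_mat i g \<in> ?T" by blast
    then show "g \<in> (\<Union>A\<in>?T. Cl A)" using memCl[OF g] by blast
  next
    fix g assume "g \<in> (\<Union>A\<in>?T. Cl A)"
    then obtain A where A: "A \<in> ?T" "g \<in> Cl A" by blast
    then show "g \<in> H \<inter> E" using ClE[OF A] by (simp add: Cl_def)
  qed
  have disj: "disjoint_family_on Cl ?T" "disjoint_family_on Ck ?T"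
  proof -
    have "Cl A \<inter> Cl A' = {}" if "A \<in> ?T" "A' \<in> ?T" "A \<noteq> A'" for A A'
      using ClE[OF that(1)] ClE[OF that(2)] that(3) by blast
    then show "disjoint_family_on Cl ?T" "disjoint_family_on Ck ?T"
      unfolding disjoint_family_on_def using CkCl by blast+
  qed
  have sets: "Cl ` ?T \<subseteq> sets M" "Ck ` ?T \<subseteq> sets M" using saturated_sets sat by blast+
  have "{g \<in> H \<inter> E. layer_dim n (Suc i) g = k} = (\<Union>A\<in>?T. Ck A)"
    unfolding CkCl by (subst (1) HE) blast
  then have "measure M {g \<in> H \<inter> E. layer_dim n (Suc i) g = k} = (\<Sum>A\<in>?T. measure M (Ck A))"
    using finite_measure_finite_Union[OF fin sets(2) disj(2)] by simp
  also have "\<dots> = (\<Sum>A\<in>?T. measure M (Cl A) * alternating_kernel_prob TYPE('a mod_ring) r k)"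
    unfolding Ck_def Cl_def
    by (intro sum.cong refl measure_class[OF _ i _ cond]) (use rep r in auto)
  also have "\<dots> = (\<Sum>A\<in>?T. measure M (Cl A)) * alternating_kernel_prob TYPE('a mod_ring) r k" by (simp add: sum_distrib_right)
  also have "(\<Sum>A\<in>?T. measure M (Cl A)) = measure M (H \<inter> E)"
    unfolding finite_measure_finite_Union[OF fin sets(1) disj(1), symmetric]
    by (rule arg_cong[OF HE[symmetric]])
  finally show ?thesis .
qed

section \<open>The Markov property\<close>

abbreviation P where "P \<equiv> uniform_measure M H"

lemma measure_H_pos: "0 < measure M H"
  using saturated_H measure_saturated_pos H_nonempty by blast

lemma emeasure_H: "emeasure M H \<noteq> 0" "emeasure M H \<noteq> \<infinity>"
  using measure_H_pos by (auto simp: measure_def)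

lemma prob_space_P: "prob_space P"
  using emeasure_H by (rule prob_space_uniform_measure)

lemma space_P: "space P = OV"
  by (simp add: space_M)

lemma measure_P: "A \<in> sets M \<Longrightarrow> measure P A = measure M (H \<inter> A) / measure M H"
  using emeasure_H by (rule measure_uniform_measure)

lemma saturated_layer_dim: "1 \<le> j \<Longrightarrow> saturated j {g \<in> OV. layer_dim n j g = d}"
  using layer_dim_cong by (auto simp: saturated_def)

lemma cond_prob_layer_dim_Suc:
  assumes i: "1 \<le> i" and E: "saturated i {g \<in> OV. E g}"
    and r: "\<And>g. g \<in> OV \<Longrightarrow> E g \<Longrightarrow> layer_dim n i g = r" and cond: "odd CARD('a) \<or> r \<noteq> n"
    and pos: "\<P>(g in P. E g) > 0"
  shows "\<P>(g in P. layer_dim n (Suc i) g = k \<bar> E g) = alternating_kernel_prob TYPE('a mod_ring) r k"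
proof -
  let ?E = "{g \<in> OV. E g}" and ?X = "{g \<in> OV. layer_dim n (Suc i) g = k}"
  have sE: "?E \<in> sets M" and sX: "?X \<in> sets M"
    using saturated_sets[OF E] saturated_sets[OF saturated_layer_dim] by auto
  have eq: "{g \<in> space P. layer_dim n (Suc i) g = k \<and> E g} = ?X \<inter> ?E" by (auto simp: space_M)
  have eqE: "{g \<in> space P. E g} = ?E" by (simp add: space_M)
  have HX: "H \<inter> (?X \<inter> ?E) = {g \<in> H \<inter> ?E. layer_dim n (Suc i) g = k}" using H_subset by auto
  have "measure M (H \<inter> ?E) / measure M H > 0" using pos unfolding eqE measure_P[OF sE] .
  then have nz: "measure M (H \<inter> ?E) \<noteq> 0" by auto
  have "measure M (H \<inter> (?X \<inter> ?E)) = measure M (H \<inter> ?E) * alternating_kernel_prob TYPE('a mod_ring) r k"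
    unfolding HX by (rule measure_layer_dim_Suc[OF E i _ cond]) (use r in auto)
  then show ?thesis
    unfolding cond_prob_def eq eqE measure_P[OF sE] measure_P[OF sets.Int[OF sX sE]]
    using nz measure_H_pos by simp
qed

lemma saturated_history:
  assumes "1 \<le> i"
  shows "saturated i {g \<in> OV. \<forall>j\<in>{1..i}. layer_dim n j g = a j}"
  unfolding saturated_def
proof (intro conjI ballI impI)
  fix g h assume g: "g \<in> {g \<in> OV. \<forall>j\<in>{1..i}. layer_dim n j g = a j}" and h: "h \<in> OV" and cong: "mcong i g h"
  have "layer_dim n j h = a j" if "j \<in> {1..i}" for j
    using g h that layer_dim_cong[of g h j] mcong_le[OF cong, of j] by auto
  then show "h \<in> {g \<in> OV. \<forall>j\<in>{1..i}. layer_dim n j g = a j}" using h by auto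
qed auto

lemma layer_dim_measurable:
  assumes "1 \<le> j"
  shows "layer_dim n j \<in> measurable P (count_space UNIV)"
proof -
  have "layer_dim n j -` {d} \<inter> space P \<in> sets P" for d
  proof -
    have "layer_dim n j -` {d} \<inter> space P = {g \<in> OV. layer_dim n j g = d}" by (auto simp: space_M)
    then show ?thesis using saturated_sets[OF saturated_layer_dim[OF assms]] by simp
  qed
  then show ?thesis
    unfolding measurable_count_space_eq2_countable by auto
qed

text \<open>
  If \<open>\<ell> = 2\<close> and the layer has full dimension, then so have all previous layers, hence conditioning on the
  history is the same as conditioning on the last value.
\<close>

lemma markov_chain_layer_dim: "markov_chain P (layer_dim n)"
  unfolding markov_chain_def
proof (intro conjI allI impI prob_space_P layer_dim_measurable)
  fix i a k
  assume i: "1 \<le> i" and pos: "\<P>(x in P. \<forall>j\<in>{1..i}. layer_dim n j x = a j) > 0"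
  interpret P: prob_space P by (rule prob_space_P)
  let ?E = "\<lambda>g. \<forall>j\<in>{1..i}. layer_dim n j g = a j"
  show "\<P>(x in P. layer_dim n (Suc i) x = k \<bar> ?E x) = \<P>(x in P. layer_dim n (Suc i) x = k \<bar> layer_dim n i x = a i)"
  proof (cases "odd CARD('a) \<or> a i \<noteq> n")
    case True
    have "{x \<in> space P. layer_dim n i x = a i} \<in> sets P"
      using saturated_sets[OF saturated_layer_dim[OF i]] by (simp add: space_M)
    then have "\<P>(x in P. ?E x) \<le> \<P>(x in P. layer_dim n i x = a i)"
      using i by (intro P.finite_measure_mono) auto
    then have "\<P>(x in P. layer_dim n i x = a i) > 0" using pos by simp
    \<comment> \<open>Both conditional probabilities equal the kernel law of alternating forms of
      size \<open>a i\<close>.\<close>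
    then show ?thesis
      using cond_prob_layer_dim_Suc[OF i saturated_history[OF i] _ True pos, of k]
        cond_prob_layer_dim_Suc[OF i saturated_layer_dim[OF i, of "a i"] _ True, of k] i by simp
  next
    case False
    have "{x \<in> space P. ?E x} \<noteq> {}"
    proof
      assume "{x \<in> space P. ?E x} = {}"
      then show False using pos by (metis measure_empty less_irrefl)
    qed
    then obtain g0 where g0: "g0 \<in> OV" "?E g0" by (auto simp: space_M)
    have full: "layer_dim n j g = n" if g: "g \<in> OV" "layer_dim n i g = n" and j: "j \<in> {1..i}" for g j
      using layer_dim_antimono[OF g(1), of j i] layer_dim_le[OF g(1), of j] g(2) j by auto
    have a: "a j = n" if "j \<in> {1..i}" for j
    proof -
      have "layer_dim n i g0 = n" using g0 i False by auto
      from full[OF g0(1) this that] show ?thesis using g0 that by auto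
    qed
    have iff: "?E g \<longleftrightarrow> layer_dim n i g = a i" if "g \<in> OV" for g
      using full[OF that] a i by auto
    have "{x \<in> space P. ?E x} = {x \<in> space P. layer_dim n i x = a i}"
      "{x \<in> space P. layer_dim n (Suc i) x = k \<and> ?E x} = {x \<in> space P. layer_dim n (Suc i) x = k \<and> layer_dim n i x = a i}"
      unfolding space_P using iff by blast+
    then show ?thesis unfolding cond_prob_def by (simp only:)
  qed
qed

end

theorem theorem5p4:
  fixes Q :: "'p::prime_card padic_int vec \<Rightarrow> 'p padic_int"
    and m :: nat
    and M :: "'p padic_int mat measure"
    and H :: "'p padic_int mat set"
  assumes "nondegenerate_quadratic_space (2 * m) Q"
    and "haar_measure (2 * m) Q M"
    and "union_of_cosets_Omega (2 * m) Q H"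
    and "H \<noteq> {}"
  shows "markov_chain (uniform_measure M H) (layer_dim (2 * m)) \<and>
    (\<forall>i\<ge>1. \<forall>r. (odd CARD('p) \<or> r \<noteq> 2 * m) \<and>
        \<P>(g in uniform_measure M H. layer_dim (2 * m) i g = r) > 0 \<longrightarrow>
      (\<forall>k. \<P>(g in uniform_measure M H. layer_dim (2 * m) (Suc i) g = k \<bar> layer_dim (2 * m) i g = r)
        = measure_pmf.prob (pmf_of_set (alternating_forms r :: 'p mod_ring mat set))
            {A. kernel_dim A = k}))"
proof -
  interpret haar_coset_union "2 * m" Q M H
    by unfold_locales (use assms in auto)
  show ?thesis
    using markov_chain_layer_dim cond_prob_layer_dim_Suc[OF _ saturated_layer_dim]
    unfolding alternating_kernel_prob_def by blast
qed

end
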